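(* Let $R$ be a set with two or more elements, let $r_0\in R$, and let $S$ be a subset of $R$ with $r_0 \in S \subset R$. Then: 1. Any pure state of $C^*_r(F_S)$ has a unique extension to a pure state of $C^*_r(F_R)$. 2. The projection $P_S$ is the unique conditional expectation of $C^*_r(F_R)$ onto $C^*_r(F_S)$.
   Context: $F_R$ denotes the free group on the set $R$ with generators $\{u_r : r\in R\}$, and $C^*_r(F_R)$ its reduced group C*-algebra; elements of $F_R$ are identified with the corresponding unitaries in $C^*_r(F_R)$. For $S\subset R$, $C^*_r(F_S)$ is viewed as the C*-subalgebra of $C^*_r(F_R)$ generated by the unitaries $\{u_s : s\in S\}$. $P_S$ denotes the unique trace-preserving conditional expectation from $C^*_r(F_R)$ onto $C^*_r(F_S)$, where the trace is the canonical trace on $C^*_r(F_R)$ (the coefficient of the identity element). *)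

theory Defs
  imports "HOL-Analysis.Analysis"
begin

section \<open>Free groups\<close>

text \<open>The free group on the set of all elements of the type \<open>'r\<close>, realised by reduced words.
  The letter \<open>(r, True)\<close> is the generator of index \<open>r\<close>, the letter \<open>(r, False)\<close> its inverse.\<close>

type_synonym 'r letter = "'r \<times> bool"

definition inv_letter :: "'r letter \<Rightarrow> 'r letter" where
  "inv_letter x = (fst x, \<not> snd x)"

fun reduced :: "'r letter list \<Rightarrow> bool" where
  "reduced [] \<longleftrightarrow> True"
| "reduced [x] \<longleftrightarrow> True"
| "reduced (x # y # w) \<longleftrightarrow> y \<noteq> inv_letter x \<and> reduced (y # w)"

fun cons_red :: "'r letter \<Rightarrow> 'r letter list \<Rightarrow> 'r letter list" where
  "cons_red x [] = [x]"
| "cons_red x (y # w) = (if y = inv_letter x then w else x # y # w)"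

definition mult_red :: "'r letter list \<Rightarrow> 'r letter list \<Rightarrow> 'r letter list" where
  "mult_red v w = foldr cons_red v w"

definition inv_red :: "'r letter list \<Rightarrow> 'r letter list" where
  "inv_red w = rev (map inv_letter w)"

lemma inv_letter_inv_letter [simp]: "inv_letter (inv_letter x) = x"
  by (simp add: inv_letter_def)

lemma inv_letter_neq [simp]: "inv_letter x \<noteq> x" "x \<noteq> inv_letter x"
  by (simp_all add: inv_letter_def prod_eq_iff)

lemma reduced_tl: "reduced (x # w) \<Longrightarrow> reduced w"
  by (cases w) auto

lemma reduced_cons_red: "reduced w \<Longrightarrow> reduced (cons_red x w)"
  by (cases w) (auto dest: reduced_tl)

lemma reduced_mult_red: "reduced w \<Longrightarrow> reduced (mult_red v w)"
  unfolding mult_red_def by (induction v) (auto intro: reduced_cons_red)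

lemma cons_red_inv: "reduced w \<Longrightarrow> cons_red (inv_letter x) (cons_red x w) = w"
proof (cases w)
  case (Cons y v)
  then show "reduced w \<Longrightarrow> ?thesis"
    by (cases v) auto
qed auto

lemma cons_red_inv': "reduced w \<Longrightarrow> cons_red x (cons_red (inv_letter x) w) = w"
  using cons_red_inv[of w "inv_letter x"] by simp

lemma mult_red_cons_red:
  "reduced w \<Longrightarrow> mult_red (cons_red x v) w = cons_red x (mult_red v w)"
proof (cases v)
  case (Cons y u)
  assume "reduced w"
  then have "reduced (mult_red u w)" by (rule reduced_mult_red)
  then show ?thesis using Cons cons_red_inv'[of "mult_red u w" x]
    by (simp add: mult_red_def)
qed (simp add: mult_red_def)

lemma mult_red_assoc:
  "reduced w \<Longrightarrow> mult_red (mult_red u v) w = mult_red u (mult_red v w)"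
proof (induction u)
  case (Cons x u)
  then show ?case
    using mult_red_cons_red[of w x "mult_red u v"] by (simp add: mult_red_def)
qed (simp add: mult_red_def)

lemma mult_red_Nil2: "reduced w \<Longrightarrow> mult_red w [] = w"
proof (induction w)
  case (Cons x w)
  then have "mult_red w [] = w" by (auto dest: reduced_tl)
  then show ?case using Cons.prems by (cases w) (auto simp: mult_red_def)
qed (simp add: mult_red_def)

lemma reduced_snoc: "reduced (w @ [y, x]) \<longleftrightarrow> reduced (w @ [y]) \<and> x \<noteq> inv_letter y"
  by (induction w rule: reduced.induct) auto

lemma reduced_inv_red: "reduced w \<Longrightarrow> reduced (inv_red w)"
proof (induction w rule: reduced.induct)
  case (3 x y w)
  then show ?case by (auto simp: inv_red_def reduced_snoc)
qed (auto simp: inv_red_def)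

lemma inv_red_mult_red: "reduced w \<Longrightarrow> mult_red (inv_red v) (mult_red v w) = w"
proof (induction v arbitrary: w)
  case (Cons x v)
  then show ?case
    using cons_red_inv[OF reduced_mult_red[OF Cons.prems], of x v]
    by (simp add: mult_red_def inv_red_def)
qed (simp add: mult_red_def inv_red_def)

typedef 'r free_group = "{w :: 'r letter list. reduced w}"
  by (rule exI[of _ "[]"]) simp

setup_lifting type_definition_free_group

text \<open>The library's type class of not necessarily commutative groups is additive: the group
  law is \<open>+\<close>, the neutral element is \<open>0\<close>, and the inverse of \<open>g\<close> is \<open>- g\<close>.\<close>

instantiation free_group :: (type) group_add
begin

lift_definition zero_free_group :: "'a free_group" is "[]" by simp

lift_definition plus_free_group :: "'a free_group \<Rightarrow> 'a free_group \<Rightarrow> 'a free_group"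
  is mult_red by (rule reduced_mult_red)

lift_definition uminus_free_group :: "'a free_group \<Rightarrow> 'a free_group"
  is inv_red by (rule reduced_inv_red)

definition minus_free_group :: "'a free_group \<Rightarrow> 'a free_group \<Rightarrow> 'a free_group" where
  "minus_free_group g h = g + (- h)"

instance
proof
  fix a b c :: "'a free_group"
  show "a + b + c = a + (b + c)" by transfer (rule mult_red_assoc)
  show "0 + a = a" by transfer (simp add: mult_red_def)
  show "a + 0 = a" by transfer (rule mult_red_Nil2)
  show "- a + a = 0"
  proof transfer
    fix w :: "'a letter list"
    assume "reduced w"
    then show "mult_red (inv_red w) w = []"
      using inv_red_mult_red[of "[]" w] by (simp add: mult_red_Nil2)
  qed
  show "a + - b = a - b" by (simp add: minus_free_group_def)
qed

end

lift_definition free_gen :: "'r \<Rightarrow> 'r free_group" is "\<lambda>r. [(r, True)]" by simp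


section \<open>The Hilbert space of square summable functions\<close>

typedef 'g ell2 = "{f :: 'g \<Rightarrow> complex. (\<lambda>x. (cmod (f x))\<^sup>2) summable_on UNIV}"
  by (rule exI[of _ "\<lambda>_. 0"]) simp

setup_lifting type_definition_ell2

lemma square_summable_add:
  fixes f g :: "'g \<Rightarrow> complex"
  assumes "(\<lambda>x. (cmod (f x))\<^sup>2) summable_on UNIV" "(\<lambda>x. (cmod (g x))\<^sup>2) summable_on UNIV"
  shows "(\<lambda>x. (cmod (f x + g x))\<^sup>2) summable_on UNIV"
proof (rule summable_on_comparison_test)
  show "(\<lambda>x. 2 * (cmod (f x))\<^sup>2 + 2 * (cmod (g x))\<^sup>2) summable_on UNIV"
    using assms by (intro summable_on_add summable_on_cmult_right)
next
  fix x
  have "(cmod (f x + g x))\<^sup>2 \<le> (cmod (f x) + cmod (g x))\<^sup>2"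
    by (intro power_mono norm_triangle_ineq) simp
  also have "\<dots> \<le> 2 * (cmod (f x))\<^sup>2 + 2 * (cmod (g x))\<^sup>2"
    using sum_squares_bound[of "cmod (f x)" "cmod (g x)"] by (simp add: power2_sum)
  finally show "(cmod (f x + g x))\<^sup>2 \<le> 2 * (cmod (f x))\<^sup>2 + 2 * (cmod (g x))\<^sup>2" .
qed simp

lemma square_summable_scale:
  fixes f :: "'g \<Rightarrow> complex"
  assumes "(\<lambda>x. (cmod (f x))\<^sup>2) summable_on UNIV"
  shows "(\<lambda>x. (cmod (c * f x))\<^sup>2) summable_on UNIV"
  using summable_on_cmult_right[OF assms, of "(cmod c)\<^sup>2"]
  by (simp add: norm_mult power_mult_distrib)

lemma square_summable_mult:
  fixes f g :: "'g \<Rightarrow> complex"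
  assumes "(\<lambda>x. (cmod (f x))\<^sup>2) summable_on UNIV" "(\<lambda>x. (cmod (g x))\<^sup>2) summable_on UNIV"
  shows "(\<lambda>x. cnj (f x) * g x) summable_on UNIV"
proof -
  have le: "cmod (cnj (f x) * g x) \<le> (cmod (f x))\<^sup>2 + (cmod (g x))\<^sup>2" for x
    using sum_squares_bound[of "cmod (f x)" "cmod (g x)"]
      mult_nonneg_nonneg[OF norm_ge_zero[of "f x"] norm_ge_zero[of "g x"]]
    unfolding norm_mult complex_mod_cnj by linarith
  have "(\<lambda>x. cmod (cnj (f x) * g x)) summable_on UNIV"
    by (rule summable_on_comparison_test[OF summable_on_add[OF assms]]) (use le in auto)
  then show ?thesis by (rule abs_summable_summable)
qed

lift_definition cscale :: "complex \<Rightarrow> 'g ell2 \<Rightarrow> 'g ell2" is "\<lambda>c f x. c * f x"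
  using square_summable_scale by auto

text \<open>The inner product is conjugate linear in the first argument.\<close>

lift_definition cinner :: "'g ell2 \<Rightarrow> 'g ell2 \<Rightarrow> complex"
  is "\<lambda>f g. \<Sum>\<^sub>\<infinity>x. cnj (f x) * g x" .

text \<open>The real inner product space underlying the complex one; its norm is the usual norm
  \<open>sqrt (\<Sum>\<^sub>\<infinity>x. (cmod (f x))\<^sup>2)\<close>.\<close>

instantiation ell2 :: (type) real_inner
begin

lift_definition zero_ell2 :: "'a ell2" is "\<lambda>_. 0" by simp

lift_definition plus_ell2 :: "'a ell2 \<Rightarrow> 'a ell2 \<Rightarrow> 'a ell2" is "\<lambda>f g x. f x + g x"
  using square_summable_add by auto

lift_definition uminus_ell2 :: "'a ell2 \<Rightarrow> 'a ell2" is "\<lambda>f x. - f x"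
  by simp

definition minus_ell2 :: "'a ell2 \<Rightarrow> 'a ell2 \<Rightarrow> 'a ell2" where
  "minus_ell2 f g = f + (- g)"

definition scaleR_ell2 :: "real \<Rightarrow> 'a ell2 \<Rightarrow> 'a ell2" where
  "scaleR_ell2 r f = cscale (complex_of_real r) f"

definition inner_ell2 :: "'a ell2 \<Rightarrow> 'a ell2 \<Rightarrow> real" where
  "inner_ell2 f g = Re (cinner f g)"

definition norm_ell2 :: "'a ell2 \<Rightarrow> real" where
  "norm_ell2 f = sqrt (inner f f)"

definition sgn_ell2 :: "'a ell2 \<Rightarrow> 'a ell2" where
  "sgn_ell2 f = inverse (norm f) *\<^sub>R f"

definition dist_ell2 :: "'a ell2 \<Rightarrow> 'a ell2 \<Rightarrow> real" where
  "dist_ell2 f g = norm (f - g)"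

definition uniformity_ell2 :: "('a ell2 \<times> 'a ell2) filter" where
  "uniformity_ell2 = (INF e\<in>{0<..}. principal {(x, y). dist x y < e})"

definition open_ell2 :: "'a ell2 set \<Rightarrow> bool" where
  "open_ell2 U \<longleftrightarrow> (\<forall>x\<in>U. \<forall>\<^sub>F (x', y) in uniformity. x' = x \<longrightarrow> y \<in> U)"

lemma cinner_add_left: "cinner (f + g) h = cinner f h + cinner (g :: 'a ell2) h"
proof -
  have "(\<lambda>x. cnj (Rep_ell2 k x) * Rep_ell2 h x) summable_on UNIV" for k
    by (rule square_summable_mult) (use Rep_ell2 in auto)
  then show ?thesis
    by (simp add: cinner.rep_eq plus_ell2.rep_eq distrib_right infsum_add)
qed

lemma cinner_cscale_left: "cinner (cscale c f) g = cnj c * cinner f (g :: 'a ell2)"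
  by transfer (simp add: mult.assoc infsum_cmult_right')

lemma cinner_commute: "cinner g f = cnj (cinner f (g :: 'a ell2))"
  unfolding cinner.rep_eq infsum_cnj[symmetric] by (intro infsum_cong) (simp add: mult.commute)

lemma cinner_self: "cinner f f = complex_of_real (\<Sum>\<^sub>\<infinity>x. (cmod (Rep_ell2 f x))\<^sup>2)"
proof -
  have "cinner f f = (\<Sum>\<^sub>\<infinity>x. complex_of_real ((cmod (Rep_ell2 f x))\<^sup>2))"
    unfolding cinner.rep_eq
    by (intro infsum_cong) (metis complex_norm_square mult.commute)
  then show ?thesis
    using Rep_ell2[of f] by (simp add: infsumI has_sum_of_real has_sum_infsum del: of_real_power)
qed

instance
proof
  fix f g h :: "'a ell2" and r s :: real
  show "f + g + h = f + (g + h)" by transfer (simp add: add.assoc)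
  show "f + g = g + f" by transfer (simp add: add.commute)
  show "0 + f = f" by transfer simp
  show "- f + f = 0" by transfer simp
  show "f - g = f + - g" by (simp add: minus_ell2_def)
  show "r *\<^sub>R (f + g) = r *\<^sub>R f + r *\<^sub>R g"
    unfolding scaleR_ell2_def by transfer (simp add: distrib_left)
  show "(r + s) *\<^sub>R f = r *\<^sub>R f + s *\<^sub>R f"
    unfolding scaleR_ell2_def by transfer (simp add: distrib_right)
  show "r *\<^sub>R s *\<^sub>R f = (r * s) *\<^sub>R f"
    unfolding scaleR_ell2_def by transfer (simp add: mult.assoc)
  show "1 *\<^sub>R f = f"
    unfolding scaleR_ell2_def by transfer simp
  show "sgn f = inverse (norm f) *\<^sub>R f" by (rule sgn_ell2_def)
  show "dist f g = norm (f - g)" by (rule dist_ell2_def)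
  show "uniformity = (INF e\<in>{0<..}. principal {(x, y :: 'a ell2). dist x y < e})"
    by (rule uniformity_ell2_def)
  show "open U \<longleftrightarrow> (\<forall>x\<in>U. \<forall>\<^sub>F (x', y) in uniformity. x' = x \<longrightarrow> y \<in> U)" for U :: "'a ell2 set"
    by (rule open_ell2_def)
  show "inner f g = inner g f"
    unfolding inner_ell2_def by (subst cinner_commute) simp
  show "inner (f + g) h = inner f h + inner g h"
    by (simp add: inner_ell2_def cinner_add_left)
  show "inner (r *\<^sub>R f) g = r * inner f g"
    by (simp add: inner_ell2_def scaleR_ell2_def cinner_cscale_left)
  show "0 \<le> inner f f"
    by (simp add: inner_ell2_def cinner_self infsum_nonneg)
  show "inner f f = 0 \<longleftrightarrow> f = 0"
  proof
    assume "inner f f = 0"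
    then have *: "(\<Sum>\<^sub>\<infinity>x. (cmod (Rep_ell2 f x))\<^sup>2) \<le> 0"
      by (simp add: inner_ell2_def cinner_self)
    have "(cmod (Rep_ell2 f x))\<^sup>2 = 0" for x
      using * by (rule nonneg_infsum_le_0D) (use Rep_ell2[of f] in auto)
    then show "f = 0" by transfer auto
  qed (simp add: inner_ell2_def, transfer, simp)
  show "norm f = sqrt (inner f f)" by (rule norm_ell2_def)
qed

end

lemma norm_ell2_eq: "norm f = sqrt (\<Sum>\<^sub>\<infinity>x. (cmod (Rep_ell2 f x))\<^sup>2)"
  by (simp add: norm_ell2_def inner_ell2_def cinner_self)

lemma norm_cscale: "norm (cscale c f) = cmod c * norm f"
  by (simp add: norm_ell2_eq cscale.rep_eq norm_mult power_mult_distrib infsum_cmult_right'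
      real_sqrt_mult)

lift_definition delta :: "'g \<Rightarrow> 'g ell2" is "\<lambda>a x. if x = a then 1 else 0"
proof -
  fix a :: 'g
  have "(\<lambda>x. (cmod (if x = a then 1 else 0))\<^sup>2) summable_on {a}" by simp
  then show "(\<lambda>x. (cmod (if x = a then 1 else 0))\<^sup>2) summable_on (UNIV :: 'g set)"
    by (subst summable_on_cong_neutral[where T = "{a}" and g = "\<lambda>x. (cmod (if x = a then 1 else 0))\<^sup>2"])
      auto
qed


section \<open>Bounded operators and C*-subalgebras\<close>

text \<open>Elements of \<open>'g op\<close> are bounded and real linear; the complex linear ones are singled out
  by \<open>bounded_ops\<close>. The library's norm on this type is the operator norm.\<close>

type_synonym 'g op = "'g ell2 \<Rightarrow>\<^sub>L 'g ell2"

definition bounded_ops :: "'g op set" where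
  "bounded_ops = {T :: 'g op. \<forall>c f. T (cscale c f) = cscale c (T f)}"

lemma bounded_linear_cscale: "bounded_linear (cscale c :: 'g ell2 \<Rightarrow> 'g ell2)"
proof (rule bounded_linear_intro[where K = "cmod c"])
  fix f g :: "'g ell2" and r :: real
  show "cscale c (f + g) = cscale c f + cscale c g"
    by transfer (simp add: distrib_left)
  show "cscale c (r *\<^sub>R f) = r *\<^sub>R cscale c f"
    unfolding scaleR_ell2_def by transfer (simp add: mult.left_commute)
  show "norm (cscale c f) \<le> norm f * cmod c"
    by (simp add: norm_cscale mult.commute)
qed

definition op_cscale :: "complex \<Rightarrow> 'g op \<Rightarrow> 'g op" where
  "op_cscale c T = Blinfun (cscale c) o\<^sub>L T"

lemma op_cscale_apply: "op_cscale c T f = cscale c (T f)"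
  by (simp add: op_cscale_def bounded_linear_Blinfun_apply bounded_linear_cscale)

definition adj :: "'g op \<Rightarrow> 'g op" where
  "adj T = (THE T' :: 'g op. \<forall>f g. cinner (T f) g = cinner f (T' g))"

text \<open>Every element of \<open>bounded_ops\<close> has exactly one adjoint, so \<open>adj\<close> is the usual adjoint there.\<close>

lemma cinner_add_right: "cinner h (f + g) = cinner h f + cinner h (g :: 'g ell2)"
  by (metis cinner_add_left cinner_commute complex_cnj_add)

lemma cinner_cscale_right: "cinner g (cscale c f) = c * cinner g (f :: 'g ell2)"
  by (metis cinner_cscale_left cinner_commute complex_cnj_cnj complex_cnj_mult)

lemma cinner_sum_left: "cinner (sum f F) h = (\<Sum>x\<in>F. cinner (f x) (h :: 'g ell2))"
proof -
  have "cinner 0 h = 0" by transfer simp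
  then show ?thesis
    by (induction F rule: infinite_finite_induct) (auto simp: cinner_add_left)
qed

lemma cinner_delta_left: "cinner (delta a) f = Rep_ell2 f a"
proof -
  have "(\<Sum>\<^sub>\<infinity>x. cnj (if x = a then 1 else 0) * Rep_ell2 f x) = (\<Sum>\<^sub>\<infinity>x\<in>{a}. Rep_ell2 f x)"
    by (rule infsum_cong_neutral) auto
  then show ?thesis by (simp add: cinner.rep_eq delta.rep_eq)
qed

lemma cinner_self_norm: "cinner f f = complex_of_real ((norm f)\<^sup>2)"
  by (simp add: cinner_self norm_ell2_eq infsum_nonneg)

lemma cinner_bound: "cmod (cinner f g) \<le> norm f * norm (g :: 'g ell2)"
proof (cases "cinner f g = 0")
  case False
  define c where "c = cnj (sgn (cinner f g))"
  have "cinner f (cscale c g) = complex_of_real (cmod (cinner f g))"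
    using False unfolding c_def cinner_cscale_right
    by (simp add: sgn_eq complex_norm_square[symmetric] power2_eq_square field_simps)
  then have "cmod (cinner f g) = inner f (cscale c g)"
    by (simp add: inner_ell2_def)
  also have "\<dots> \<le> norm f * norm (cscale c g)"
    by (rule norm_cauchy_schwarz)
  also have "\<dots> = norm f * norm g"
    using False by (simp add: c_def norm_cscale norm_sgn)
  finally show ?thesis .
qed simp

lemma cinner_eqI: "(\<And>f. cinner f g = cinner f h) \<Longrightarrow> g = (h :: 'g ell2)"
  by (metis cinner_delta_left Rep_ell2_inject ext)

lemma sum_delta_rep: "finite F \<Longrightarrow>
    Rep_ell2 (\<Sum>x\<in>F. cscale (c x) (delta x)) y = (if y \<in> F then c y else 0)"
proof (induction F rule: finite_induct)
  case empty
  show ?case by (simp add: zero_ell2.rep_eq)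
next
  case (insert a F)
  then show ?case by (auto simp: plus_ell2.rep_eq cscale.rep_eq delta.rep_eq)
qed

lemma has_sum_delta: "((\<lambda>x. cscale (Rep_ell2 f x) (delta x)) has_sum f) UNIV"
  unfolding has_sum_def
proof (rule tendstoI)
  fix e :: real
  assume e: "0 < e"
  let ?s = "\<lambda>x. (cmod (Rep_ell2 f x))\<^sup>2"
  have sm: "?s summable_on UNIV" using Rep_ell2[of f] by simp
  then have "(?s has_sum infsum ?s UNIV) UNIV" by (rule has_sum_infsum)
  then have ev: "\<forall>\<^sub>F F in finite_subsets_at_top UNIV. dist (sum ?s F) (infsum ?s UNIV) < e\<^sup>2"
    unfolding has_sum_def by (rule tendstoD) (use e in simp)
  have fin: "\<forall>\<^sub>F F in finite_subsets_at_top (UNIV :: 'a set). finite F"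
    by (rule eventually_finite_subsets_at_top_weakI)
  show "\<forall>\<^sub>F F in finite_subsets_at_top UNIV. dist (\<Sum>x\<in>F. cscale (Rep_ell2 f x) (delta x)) f < e"
    using ev fin
  proof eventually_elim
    case (elim F)
    let ?g = "\<Sum>x\<in>F. cscale (Rep_ell2 f x) (delta x)"
    have r: "Rep_ell2 (f - ?g) y = (if y \<in> F then 0 else Rep_ell2 f y)" for y
      unfolding minus_ell2_def plus_ell2.rep_eq uminus_ell2.rep_eq sum_delta_rep[OF elim(2)] by simp
    have "(norm (f - ?g))\<^sup>2 = (\<Sum>\<^sub>\<infinity>y. (cmod (Rep_ell2 (f - ?g) y))\<^sup>2)"
      by (simp add: norm_ell2_eq infsum_nonneg)
    also have "\<dots> = infsum ?s (- F)"
      by (rule infsum_cong_neutral) (auto simp: r)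
    also have "\<dots> = infsum ?s UNIV - sum ?s F"
      using infsum_Diff[OF sm, of F] elim(2) by (simp add: Compl_eq_Diff_UNIV)
    also have "\<dots> < e\<^sup>2" using elim(1) by (simp add: dist_real_def)
    finally have "norm (f - ?g) < e" using e by (simp add: power_less_imp_less_base)
    then show ?case by (simp add: dist_norm norm_minus_commute)
  qed
qed

lemma adjoint_exists:
  fixes T :: "'g op"
  assumes T: "T \<in> bounded_ops"
  shows "\<exists>T' :: 'g op. \<forall>f g. cinner (T f) g = cinner f (T' g)"
proof -
  define h where "h = (\<lambda>g x. cinner (T (delta x)) g)"
  have lin: "T (cscale c f) = cscale c (T f)" for c f
    using T by (simp add: bounded_ops_def)
  have fin: "(\<Sum>x\<in>F. (cmod (h g x))\<^sup>2) \<le> (norm T * norm g)\<^sup>2" if "finite F" for F g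
  proof -
    define f where "f = (\<Sum>x\<in>F. cscale (h g x) (delta x))"
    define s where "s = (\<Sum>x\<in>F. (cmod (h g x))\<^sup>2)"
    have s0: "s \<ge> 0" by (simp add: s_def sum_nonneg)
    have "cinner f f = (\<Sum>x\<in>F. cnj (h g x) * h g x)"
      using that by (subst (1) f_def, unfold cinner_sum_left cinner_cscale_left cinner_delta_left)
        (simp add: f_def sum_delta_rep)
    also have "\<dots> = complex_of_real s"
      unfolding s_def of_real_sum by (intro sum.cong refl) (metis complex_norm_square mult.commute)
    finally have nf: "(norm f)\<^sup>2 = s"
      by (metis cinner_self_norm of_real_eq_iff)
    have "cinner (T f) g = (\<Sum>x\<in>F. cnj (h g x) * h g x)"
      unfolding f_def blinfun.sum_right lin cinner_sum_left cinner_cscale_left h_def ..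
    also have "\<dots> = complex_of_real s"
      unfolding s_def of_real_sum by (intro sum.cong refl) (metis complex_norm_square mult.commute)
    finally have "s \<le> norm (T f) * norm g"
      using cinner_bound[of "T f" g] s0 by simp
    also have "\<dots> \<le> norm T * norm f * norm g"
      by (intro mult_right_mono norm_blinfun) simp
    finally have le: "norm f * norm f \<le> norm f * (norm T * norm g)"
      using nf by (simp add: power2_eq_square mult_ac)
    have "norm f \<le> norm T * norm g"
    proof (cases "f = 0")
      case False
      then show ?thesis using le by simp
    qed simp
    then show ?thesis using nf unfolding s_def[symmetric]
      by (metis norm_ge_zero power_mono)
  qed
  have sq: "(\<lambda>x. (cmod (h g x))\<^sup>2) summable_on UNIV" for g
    by (rule nonneg_bdd_above_summable_on) (auto intro!: bdd_aboveI2 fin)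
  define U where "U = (\<lambda>g. Abs_ell2 (h g))"
  have RepU: "Rep_ell2 (U g) = h g" for g
    unfolding U_def by (rule Abs_ell2_inverse) (simp add: sq)
  have "norm (U g) \<le> norm g * norm T" for g
  proof -
    have "(\<Sum>\<^sub>\<infinity>x. (cmod (h g x))\<^sup>2) \<le> (norm T * norm g)\<^sup>2"
      by (rule infsum_le_finite_sums[OF sq fin])
    then have "norm (U g) \<le> sqrt ((norm T * norm g)\<^sup>2)"
      unfolding norm_ell2_eq RepU by (rule real_sqrt_le_mono)
    then show ?thesis by (simp add: mult.commute)
  qed
  then have blU: "bounded_linear U"
    by (intro bounded_linear_intro[where K = "norm T"])
      (simp_all add: RepU h_def cinner_add_right cinner_cscale_right plus_ell2.rep_eq
        scaleR_ell2_def cscale.rep_eq fun_eq_iff flip: Rep_ell2_inject)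
  have cont: "continuous_on UNIV (\<lambda>f. cinner f k)" for k :: "'g ell2"
  proof -
    have "bounded_linear (\<lambda>f. cinner f k)"
      by (rule bounded_linear_intro[where K = "norm k"])
        (simp_all add: cinner_add_left cinner_cscale_left scaleR_ell2_def cinner_bound
          scaleR_conv_of_real)
    then show ?thesis by (rule linear_continuous_on)
  qed
  have "cinner (T f) g = cinner f (U g)" for f g
  proof -
    let ?c = "\<lambda>F. \<Sum>x\<in>F. cscale (Rep_ell2 f x) (delta x)"
    have lim: "(?c \<longlongrightarrow> f) (finite_subsets_at_top UNIV)"
      using has_sum_delta[of f] by (simp add: has_sum_def)
    have "((\<lambda>F. cinner (T (?c F)) g) \<longlongrightarrow> cinner (T f) g) (finite_subsets_at_top UNIV)"
      by (rule continuous_on_tendsto_compose[OF cont]) (auto intro!: tendsto_intros lim)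
    moreover have "((\<lambda>F. cinner (?c F) (U g)) \<longlongrightarrow> cinner f (U g)) (finite_subsets_at_top UNIV)"
      by (rule continuous_on_tendsto_compose[OF cont lim]) auto
    moreover have "cinner (T (?c F)) g = cinner (?c F) (U g)" for F
      by (simp add: blinfun.sum_right lin cinner_sum_left cinner_cscale_left cinner_delta_left
          RepU h_def)
    ultimately show ?thesis
      using tendsto_unique[OF finite_subsets_at_top_neq_bot] by fastforce
  qed
  then show ?thesis
    using blU by (intro exI[of _ "Blinfun U"]) (simp add: bounded_linear_Blinfun_apply)
qed

lemma adj_eqI:
  fixes T T' :: "'g op"
  assumes "\<And>f g. cinner (T f) g = cinner f (T' g)"
  shows "adj T = T'"
  unfolding adj_def
proof (rule the_equality)
  fix T'' :: "'g op"
  assume "\<forall>f g. cinner (T f) g = cinner f (T'' g)"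
  then show "T'' = T'" using assms by (intro blinfun_eqI cinner_eqI) metis
qed (simp add: assms)

lemma cinner_adj:
  fixes T :: "'g op"
  assumes "T \<in> bounded_ops"
  shows "cinner (T f) g = cinner f (adj T g)"
  using adjoint_exists[OF assms] adj_eqI by metis

definition cstar_subalgebra :: "'g op set \<Rightarrow> bool" where
  "cstar_subalgebra A \<longleftrightarrow>
     A \<subseteq> bounded_ops \<and> 0 \<in> A \<and>
     (\<forall>a\<in>A. \<forall>b\<in>A. a + b \<in> A) \<and>
     (\<forall>c. \<forall>a\<in>A. op_cscale c a \<in> A) \<and>
     (\<forall>a\<in>A. \<forall>b\<in>A. a o\<^sub>L b \<in> A) \<and>
     (\<forall>a\<in>A. adj a \<in> A) \<and>
     closed A"

definition cstar_generated :: "'g op set \<Rightarrow> 'g op set" where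
  "cstar_generated X = \<Inter> {A. cstar_subalgebra A \<and> X \<subseteq> A}"

definition positive_elements :: "'g op set \<Rightarrow> 'g op set" where
  "positive_elements A = {adj a o\<^sub>L a | a. a \<in> A}"


section \<open>States and conditional expectations\<close>

text \<open>Here \<open>A\<close> is a C*-subalgebra containing the identity operator. Functions on \<open>A\<close> are made
  unique by requiring the value \<open>undefined\<close> outside \<open>A\<close>.\<close>

definition states :: "'g op set \<Rightarrow> ('g op \<Rightarrow> complex) set" where
  "states A = {\<phi> \<in> extensional A.
     (\<forall>a\<in>A. \<forall>b\<in>A. \<phi> (a + b) = \<phi> a + \<phi> b) \<and>
     (\<forall>c. \<forall>a\<in>A. \<phi> (op_cscale c a) = c * \<phi> a) \<and>
     (\<forall>a\<in>positive_elements A. \<phi> a \<in> \<real>\<^sub>\<ge>\<^sub>0) \<and>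
     \<phi> id_blinfun = 1}"

text \<open>Pure states are the extreme points of the convex set of states.\<close>

definition pure_states :: "'g op set \<Rightarrow> ('g op \<Rightarrow> complex) set" where
  "pure_states A = {\<phi> \<in> states A.
     \<forall>\<psi>\<in>states A. \<forall>\<theta>\<in>states A. \<forall>t::real. 0 < t \<and> t < 1 \<and>
       (\<forall>a\<in>A. \<phi> a = of_real (1 - t) * \<psi> a + of_real t * \<theta> a) \<longrightarrow> \<psi> = \<phi> \<and> \<theta> = \<phi>}"

definition conditional_expectation :: "'g op set \<Rightarrow> 'g op set \<Rightarrow> ('g op \<Rightarrow> 'g op) \<Rightarrow> bool" where
  "conditional_expectation A B E \<longleftrightarrow>
     E \<in> A \<rightarrow>\<^sub>E B \<and>
     (\<forall>a\<in>A. \<forall>b\<in>A. E (a + b) = E a + E b) \<and>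
     (\<forall>c. \<forall>a\<in>A. E (op_cscale c a) = op_cscale c (E a)) \<and>
     (\<forall>a\<in>positive_elements A. E a \<in> positive_elements B) \<and>
     (\<forall>b\<in>B. E b = b) \<and>
     (\<forall>b\<in>B. \<forall>b'\<in>B. \<forall>a\<in>A. E (b o\<^sub>L a o\<^sub>L b') = b o\<^sub>L E a o\<^sub>L b')"


section \<open>Reduced group C*-algebras of free groups\<close>

text \<open>The left regular representation: \<open>left_reg g\<close> maps \<open>delta h\<close> to \<open>delta (g + h)\<close>.\<close>

lemma bij_left_translation: "bij (\<lambda>h. - g + h :: 'g :: group_add)"
  by (rule bij_betw_byWitness[where f' = "\<lambda>h. g + h"]) (auto simp: add.assoc[symmetric])

lift_definition left_shift :: "'g :: group_add \<Rightarrow> 'g ell2 \<Rightarrow> 'g ell2" is "\<lambda>g f h. f (- g + h)"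
proof -
  fix g :: 'g and f :: "'g \<Rightarrow> complex"
  assume "(\<lambda>x. (cmod (f x))\<^sup>2) summable_on UNIV"
  then show "(\<lambda>h. (cmod (f (- g + h)))\<^sup>2) summable_on UNIV"
    using summable_on_reindex_bij_betw[OF bij_left_translation[of g], of "\<lambda>x. (cmod (f x))\<^sup>2"]
    by simp
qed

lemma norm_left_shift: "norm (left_shift g f) = norm f"
  using infsum_reindex_bij_betw[OF bij_left_translation[of g], of "\<lambda>x. (cmod (Rep_ell2 f x))\<^sup>2"]
  by (simp add: norm_ell2_eq left_shift.rep_eq)

lift_definition left_reg :: "'g :: group_add \<Rightarrow> 'g op" is left_shift
proof (rule bounded_linear_intro[where K = 1])
  fix g :: 'g and f h :: "'g ell2" and r :: real
  show "left_shift g (f + h) = left_shift g f + left_shift g h"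
    by transfer simp
  show "left_shift g (r *\<^sub>R f) = r *\<^sub>R left_shift g f"
    unfolding scaleR_ell2_def by transfer simp
  show "norm (left_shift g f) \<le> norm f * 1"
    by (simp add: norm_left_shift)
qed

lemma left_reg_delta: "left_reg g (delta h) = delta (g + h)"
proof -
  have "- g + x = h \<longleftrightarrow> x = g + h" for x
    by (metis add_minus_cancel minus_add_cancel)
  then show ?thesis
    by (simp add: left_reg.rep_eq left_shift.rep_eq delta.rep_eq fun_eq_iff flip: Rep_ell2_inject)
qed

definition reduced_cstar :: "'g :: group_add op set" where
  "reduced_cstar = cstar_generated (range left_reg)"

definition canonical_trace :: "'g :: group_add op \<Rightarrow> complex" where
  "canonical_trace a = cinner (delta 0) (a (delta 0))"

definition free_cstar_sub :: "'r set \<Rightarrow> 'r free_group op set" where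
  "free_cstar_sub S = cstar_generated ((\<lambda>s. left_reg (free_gen s)) ` S)"

text \<open>The unique trace preserving conditional expectation.\<close>

definition cond_exp_free :: "'r set \<Rightarrow> 'r free_group op \<Rightarrow> 'r free_group op" where
  "cond_exp_free S = (THE E. conditional_expectation reduced_cstar (free_cstar_sub S) E \<and>
     (\<forall>a\<in>reduced_cstar. canonical_trace (E a) = canonical_trace a))"

end

theory Submission
  imports Defs
begin

text \<open>
  Let \<open>\<psi>\<close> be a state of \<open>B = reduced_cstar\<close> that extends a pure state \<open>\<phi>\<close> of
  \<open>A = free_cstar_sub S\<close>; the point is that \<open>\<psi>\<close> vanishes at every group element \<open>h\<close> outside
  the subgroup \<open>H\<close> generated by \<open>S\<close>. Minimising \<open>\<phi> ((1 - a)\<^sup>* (1 - a)) + \<parallel>a \<delta>\<parallel>\<^sup>2\<close> over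
  \<open>a \<in> A\<close>, with \<open>\<delta>\<close> the trace vector, shows that \<open>\<phi>\<close> is either a vector state on the square
  summable functions or singular to the trace. The first case is impossible, since right
  translations decompose vector states. In the second case there are \<open>a \<in> A\<close> with \<open>a \<delta>\<close>
  small and \<open>1 - a\<close> small for \<open>\<phi>\<close>. Now \<open>h\<close> maps the complement of some set \<open>Y\<close> onto a set
  \<open>Z\<close> such that \<open>Y\<close> and \<open>Z\<close> meet each coset \<open>H + x\<close> at most once. Restricting \<open>a f\<close> to such a
  set gives a vector of norm at most \<open>\<parallel>a \<delta>\<parallel> \<parallel>f\<parallel>\<close>, so \<open>a\<^sup>* h a\<close> is small compared to
  \<open>1 + a\<^sup>* a\<close>, whence \<open>\<psi> h = 0\<close>. For a conditional expectation \<open>E\<close>, the state \<open>\<tau> \<circ> E\<close>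
  is invariant under conjugation by a generator \<open>u\<close> in \<open>H\<close>, and the same sets \<open>Y\<close>, \<open>Z\<close> show
  that the averages of \<open>u\<^sup>i h u\<^sup>-\<^sup>i\<close> tend to \<open>0\<close> in norm, so \<open>E\<close> preserves the trace.
\<close>

subsection \<open>Operators on square summable functions\<close>

text \<open>Positivity in \<open>states\<close> refers to products \<open>adj a o\<^sub>L a\<close>
  inside the algebra, whereas the estimates compare quadratic forms. An iterated square root, which
  stays in a closed algebra, identifies the two notions, so neither spectral theory nor a GNS
  construction occurs. The difficulty in the singular case is that the operators a from the
  minimisation come without a common norm bound. Hence all errors are measured by \<phi> and by the
  norm of a \<delta>, and the wandering sets must control a f through a \<delta> alone. They do so
  because a commutes with right translations: each row of its matrix has the norm of a \<delta>, and
  distinct points of Y see f on disjoint cosets. Vanishing off H determines \<psi> by density;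
  existence comes from compressing operators to the cosets of H. A trace preserving E is determined
  because the trace is faithful on A. The index \<open>r0\<close> provides the identity operator in
  the algebra generated by S and the element of infinite order whose powers drive mixing and
  averaging.\<close>

lemma cinner_minus_left: "cinner (f - g) h = cinner f h - cinner (g :: 'g ell2) h"
  by (metis add_diff_cancel cinner_add_left diff_add_cancel)

lemma cinner_minus_right: "cinner h (f - g) = cinner h f - cinner h (g :: 'g ell2)"
  by (metis add_diff_cancel cinner_add_right diff_add_cancel)

lemma cscale_add: "cscale c (f + g) = cscale c f + cscale c g"
  by (rule linear_add[OF bounded_linear.linear[OF bounded_linear_cscale]])

lemma cscale_cscale: "cscale c (cscale d f) = cscale (c * d) f"
  by transfer (simp add: mult.assoc)

lemma cscale_one [simp]: "cscale 1 f = f"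
  by transfer simp

lemma cscale_of_real: "cscale (of_real r) f = r *\<^sub>R f"
  by (simp add: scaleR_ell2_def)

lemma bounded_opsD: "T \<in> bounded_ops \<Longrightarrow> T (cscale c f) = cscale c (T f)"
  by (simp add: bounded_ops_def)

lemma bounded_ops_compose: "S \<in> bounded_ops \<Longrightarrow> T \<in> bounded_ops \<Longrightarrow> S o\<^sub>L T \<in> bounded_ops"
  by (simp add: bounded_ops_def)

lemma bounded_ops_id: "id_blinfun \<in> bounded_ops"
  by (simp add: bounded_ops_def)

lemma closed_bounded_ops: "closed (bounded_ops :: 'g op set)"
proof -
  have "closed {T :: 'g op. T (cscale c f) = cscale c (T f)}" for c f
    by (intro closed_Collect_eq continuous_intros
        bounded_linear.continuous_on[OF bounded_linear_cscale])
  then have "closed (\<Inter>c f. {T :: 'g op. T (cscale c f) = cscale c (T f)})"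
    by blast
  moreover have "(\<Inter>c f. {T :: 'g op. T (cscale c f) = cscale c (T f)}) = bounded_ops"
    by (auto simp: bounded_ops_def)
  ultimately show ?thesis by simp
qed

lemma op_cscale_add: "op_cscale c (S + T) = op_cscale c S + op_cscale c T"
  by (rule blinfun_eqI) (simp add: op_cscale_apply blinfun.add_left cscale_add)

lemma op_cscale_op_cscale: "op_cscale c (op_cscale d T) = op_cscale (c * d) T"
  by (rule blinfun_eqI) (simp add: op_cscale_apply cscale_cscale)

lemma op_cscale_of_real: "op_cscale (of_real r) T = r *\<^sub>R T"
  by (rule blinfun_eqI) (simp add: op_cscale_apply cscale_of_real blinfun.scaleR_left)

lemma op_cscale_one [simp]: "op_cscale 1 T = T"
  by (rule blinfun_eqI) (simp add: op_cscale_apply)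

lemma op_cscale_minus_one: "op_cscale (-1) T = - T"
  using op_cscale_of_real[of "-1" T] by simp

lemma op_cscale_zero [simp]: "op_cscale 0 T = 0"
  using op_cscale_of_real[of 0 T] by simp

lemma op_cscale_compose_left: "op_cscale c S o\<^sub>L T = op_cscale c (S o\<^sub>L T)"
  by (rule blinfun_eqI) (simp add: op_cscale_apply)

lemma op_cscale_compose_right: "S \<in> bounded_ops \<Longrightarrow> S o\<^sub>L op_cscale c T = op_cscale c (S o\<^sub>L T)"
  by (rule blinfun_eqI) (simp add: op_cscale_apply bounded_opsD)

lemma norm_op_cscale: "norm (op_cscale c T) \<le> cmod c * norm T"
proof (rule norm_blinfun_bound)
  fix f
  show "norm (op_cscale c T f) \<le> cmod c * norm T * norm f"
    using mult_left_mono[OF norm_blinfun[of T f], of "cmod c"]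
    by (simp add: op_cscale_apply norm_cscale mult.assoc)
qed simp

lemma bounded_ops_add: "S \<in> bounded_ops \<Longrightarrow> T \<in> bounded_ops \<Longrightarrow> S + T \<in> bounded_ops"
  by (simp add: bounded_ops_def blinfun.add_left cscale_add)

lemma bounded_ops_op_cscale: "T \<in> bounded_ops \<Longrightarrow> op_cscale c T \<in> bounded_ops"
  by (simp add: bounded_ops_def op_cscale_apply cscale_cscale mult.commute)

lemma bounded_ops_zero: "0 \<in> bounded_ops"
  using bounded_ops_op_cscale[OF bounded_ops_id, of 0] by simp

lemma cinner_adj_left:
  assumes "T \<in> bounded_ops" shows "cinner (adj T f) g = cinner f (T g)"
  using cinner_adj[OF assms, of g f] by (metis cinner_commute)

lemma bounded_ops_adj:
  assumes "T \<in> bounded_ops" shows "adj T \<in> bounded_ops"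
  unfolding bounded_ops_def
proof (intro CollectI allI)
  fix c f
  show "adj T (cscale c f) = cscale c (adj T f)"
    by (rule cinner_eqI) (simp add: cinner_adj[OF assms, symmetric] cinner_cscale_right)
qed

lemma adj_adj [simp]: "T \<in> bounded_ops \<Longrightarrow> adj (adj T) = T"
  by (rule adj_eqI) (simp add: cinner_adj_left)

lemma adj_add: "S \<in> bounded_ops \<Longrightarrow> T \<in> bounded_ops \<Longrightarrow> adj (S + T) = adj S + adj T"
  by (rule adj_eqI) (simp add: blinfun.add_left cinner_add_left cinner_add_right cinner_adj)

lemma adj_op_cscale: "T \<in> bounded_ops \<Longrightarrow> adj (op_cscale c T) = op_cscale (cnj c) (adj T)"
  by (rule adj_eqI) (simp add: op_cscale_apply cinner_cscale_left cinner_cscale_right cinner_adj)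

lemma adj_compose: "S \<in> bounded_ops \<Longrightarrow> T \<in> bounded_ops \<Longrightarrow> adj (S o\<^sub>L T) = adj T o\<^sub>L adj S"
  by (rule adj_eqI) (simp add: cinner_adj)

lemma adj_id [simp]: "adj id_blinfun = id_blinfun"
  by (rule adj_eqI) simp

lemma adj_zero [simp]: "adj 0 = 0"
  using adj_op_cscale[OF bounded_ops_id, of 0] by simp

lemma bounded_ops_minus: "S \<in> bounded_ops \<Longrightarrow> T \<in> bounded_ops \<Longrightarrow> S - T \<in> bounded_ops"
  using bounded_ops_add[of S "op_cscale (-1) T"] bounded_ops_op_cscale[of T "-1"]
  by (simp add: op_cscale_minus_one)

lemma adj_minus: "S \<in> bounded_ops \<Longrightarrow> T \<in> bounded_ops \<Longrightarrow> adj (S - T) = adj S - adj T"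
  using adj_add[of S "op_cscale (-1) T"] bounded_ops_op_cscale[of T "-1"] adj_op_cscale[of T "-1"]
  by (simp add: op_cscale_minus_one)

lemma inner_adj: "T \<in> bounded_ops \<Longrightarrow> inner (T f) g = inner f (adj T g)"
  by (simp add: inner_ell2_def cinner_adj)

lemma norm_adj_le:
  assumes "T \<in> bounded_ops" shows "norm (adj T) \<le> norm T"
proof (rule norm_blinfun_bound)
  fix f
  have "norm (adj T f) * norm (adj T f) = inner (T (adj T f)) f"
    by (simp add: inner_adj[OF assms] flip: power2_eq_square power2_norm_eq_inner)
  also have "\<dots> \<le> norm (T (adj T f)) * norm f"
    by (rule norm_cauchy_schwarz)
  also have "\<dots> \<le> norm T * norm (adj T f) * norm f"
    by (intro mult_right_mono norm_blinfun) simp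
  finally have "norm (adj T f) * norm (adj T f) \<le> norm (adj T f) * (norm T * norm f)"
    by (simp add: mult_ac)
  then show "norm (adj T f) \<le> norm T * norm f"
    by (cases "adj T f = 0") simp_all
qed simp

lemma norm_compose_le: "norm S \<le> s \<Longrightarrow> norm T \<le> t \<Longrightarrow> norm (S o\<^sub>L T) \<le> s * t"
  for S :: "'b::real_normed_vector \<Rightarrow>\<^sub>L 'c::real_normed_vector" and T :: "'a::real_normed_vector \<Rightarrow>\<^sub>L 'b"
  by (rule order_trans[OF norm_blinfun_compose])
    (auto intro!: mult_mono intro: order_trans[OF norm_ge_zero])

lemma blinfun_compose_diff_right: "S o\<^sub>L (T - U) = (S o\<^sub>L T) - (S o\<^sub>L U)"
  by (rule blinfun_eqI) (simp add: blinfun.diff_left blinfun.diff_right)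

lemma blinfun_compose_diff_left: "(S - T) o\<^sub>L U = (S o\<^sub>L U) - (T o\<^sub>L U)"
  by (rule blinfun_eqI) (simp add: blinfun.diff_left)

lemma blinfun_compose_add_right: "S o\<^sub>L (T + U) = (S o\<^sub>L T) + (S o\<^sub>L U)"
  by (rule blinfun_eqI) (simp add: blinfun.add_left blinfun.add_right)

lemma blinfun_compose_add_left: "(S + T) o\<^sub>L U = (S o\<^sub>L U) + (T o\<^sub>L U)"
  by (rule blinfun_eqI) (simp add: blinfun.add_left)

lemma blinfun_compose_assoc: "(S o\<^sub>L T) o\<^sub>L U = S o\<^sub>L (T o\<^sub>L U)"
  by (rule blinfun_eqI) simp

lemma blinfun_compose_id_left [simp]: "id_blinfun o\<^sub>L T = T"
  by (rule blinfun_eqI) simp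

lemma blinfun_compose_id_right [simp]: "T o\<^sub>L id_blinfun = T"
  by (rule blinfun_eqI) simp

text \<open>Positivity as a quadratic form does not mention an algebra, unlike
  \<open>positive_elements\<close>. The real inner product suffices because self-adjointness makes
  \<open>cinner f (T f)\<close> real.\<close>

definition op_nonneg :: "'g op \<Rightarrow> bool" where
  "op_nonneg T \<longleftrightarrow> T \<in> bounded_ops \<and> adj T = T \<and> (\<forall>f. 0 \<le> inner f (T f))"

lemma op_nonneg_adj_compose: "T \<in> bounded_ops \<Longrightarrow> op_nonneg (adj T o\<^sub>L T)"
  by (simp add: op_nonneg_def bounded_ops_compose bounded_ops_adj adj_compose flip: inner_adj)

text \<open>Expand \<open>\<langle>T (f - T f), f - T f\<rangle> \<ge> 0\<close>.\<close>

lemma op_nonneg_norm_le: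
  assumes "op_nonneg T" "norm T \<le> 1"
  shows "(norm (T f))\<^sup>2 \<le> inner f (T f)"
proof -
  have T: "T \<in> bounded_ops" "adj T = T" using assms by (auto simp: op_nonneg_def)
  have sym: "inner (T g) h = inner g (T h)" for g h
    using inner_adj[OF T(1)] T(2) by simp
  have "inner (T f) (T (T f)) \<le> norm (T f) * norm (T (T f))"
    by (rule norm_cauchy_schwarz)
  also have "\<dots> \<le> norm (T f) * (norm T * norm (T f))"
    by (intro mult_left_mono norm_blinfun) simp
  also have "\<dots> \<le> norm (T f) * (1 * norm (T f))"
    by (intro mult_left_mono mult_right_mono assms) simp_all
  finally have le: "inner (T f) (T (T f)) \<le> (norm (T f))\<^sup>2"
    by (simp add: power2_eq_square)
  have "0 \<le> inner (f - T f) (T (f - T f))"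
    using assms(1) by (simp add: op_nonneg_def)
  also have "\<dots> = inner f (T f) - 2 * (norm (T f))\<^sup>2 + inner (T f) (T (T f))"
    by (simp add: blinfun.diff_right inner_diff_left inner_diff_right power2_norm_eq_inner
        flip: sym)
  finally show ?thesis using le by linarith
qed

text \<open>Expand the square and absorb the last term by the preceding bound. This turns positivity
  into a norm condition, the form needed by the square root iteration and by the positivity proof
  for \<open>block\<close>.\<close>

lemma op_nonneg_norm_id_minus:
  assumes "op_nonneg T" "norm T \<le> 1"
  shows "norm (id_blinfun - T) \<le> 1"
proof (rule norm_blinfun_bound)
  fix f
  have "(norm ((id_blinfun - T) f))\<^sup>2 = (norm f)\<^sup>2 - 2 * inner f (T f) + (norm (T f))\<^sup>2"
    by (simp add: blinfun.diff_left power2_norm_eq_inner inner_diff_left inner_diff_right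
        inner_commute)
  also have "\<dots> \<le> (norm f)\<^sup>2"
    using op_nonneg_norm_le[OF assms, of f] zero_le_power2[of "norm (T f)"] by linarith
  finally show "norm ((id_blinfun - T) f) \<le> 1 * norm f"
    by (simp add: power2_le_iff_abs_le)
qed simp

section \<open>Completeness of the space of square summable functions\<close>

lemma Rep_ell2_diff: "Rep_ell2 (f - g) x = Rep_ell2 f x - Rep_ell2 g x"
  unfolding minus_ell2_def plus_ell2.rep_eq uminus_ell2.rep_eq by simp

lemma norm_ell2_le_finite:
  assumes "\<And>F. finite F \<Longrightarrow> (\<Sum>x\<in>F. (cmod (Rep_ell2 f x))\<^sup>2) \<le> C\<^sup>2" "0 \<le> C"
  shows "norm f \<le> C"
proof -
  have "(\<Sum>\<^sub>\<infinity>x. (cmod (Rep_ell2 f x))\<^sup>2) \<le> C\<^sup>2"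
    by (rule infsum_le_finite_sums) (use Rep_ell2[of f] assms in auto)
  then have "norm f \<le> sqrt (C\<^sup>2)" unfolding norm_ell2_eq by (rule real_sqrt_le_mono)
  then show ?thesis using assms(2) by simp
qed

lemma sum_Rep_le_norm:
  assumes "finite F" shows "(\<Sum>x\<in>F. (cmod (Rep_ell2 f x))\<^sup>2) \<le> (norm f)\<^sup>2"
  unfolding norm_ell2_eq
  using finite_sum_le_infsum[of "\<lambda>x. (cmod (Rep_ell2 f x))\<^sup>2" UNIV F] Rep_ell2[of f] assms
  by (simp add: infsum_nonneg)

lemma cmod_Rep_le_norm: "cmod (Rep_ell2 f x) \<le> norm f"
  by (rule power2_le_imp_le) (use sum_Rep_le_norm[of "{x}" f] in simp_all)

text \<open>Limits are taken coordinatewise; bounds on finite partial sums, uniform in the finite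
  set, survive the limit. Completeness makes the operator space complete, so the square root
  iteration converges, and it provides the limit of a minimising sequence of vectors.\<close>

instance ell2 :: (type) banach
proof
  fix X :: "nat \<Rightarrow> 'a ell2"
  assume X: "Cauchy X"
  have "Cauchy (\<lambda>n. Rep_ell2 (X n) x)" for x
  proof (rule metric_CauchyI)
    fix e :: real assume "0 < e"
    then obtain M where M: "\<And>m n. m \<ge> M \<Longrightarrow> n \<ge> M \<Longrightarrow> dist (X m) (X n) < e"
      using metric_CauchyD[OF X] by blast
    have "dist (Rep_ell2 (X m) x) (Rep_ell2 (X n) x) < e" if "m \<ge> M" "n \<ge> M" for m n
      using M[OF that] cmod_Rep_le_norm[of "X m - X n" x] by (simp add: dist_norm Rep_ell2_diff)
    then show "\<exists>M. \<forall>m\<ge>M. \<forall>n\<ge>M. dist (Rep_ell2 (X m) x) (Rep_ell2 (X n) x) < e" by blast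
  qed
  then have "\<exists>l. \<forall>x. (\<lambda>n. Rep_ell2 (X n) x) \<longlonglongrightarrow> l x"
    unfolding Cauchy_convergent_iff convergent_def by metis
  then obtain l where l: "\<And>x. (\<lambda>n. Rep_ell2 (X n) x) \<longlonglongrightarrow> l x" by blast
  have fin: "\<exists>M. \<forall>n\<ge>M. \<forall>F. finite F \<longrightarrow> (\<Sum>x\<in>F. (cmod (l x - Rep_ell2 (X n) x))\<^sup>2) \<le> e\<^sup>2"
    if e: "0 < e" for e
  proof -
    obtain M where M: "\<And>m n. m \<ge> M \<Longrightarrow> n \<ge> M \<Longrightarrow> norm (X m - X n) < e"
      using metric_CauchyD[OF X e] by (auto simp: dist_norm)
    have "(\<Sum>x\<in>F. (cmod (l x - Rep_ell2 (X n) x))\<^sup>2) \<le> e\<^sup>2" if "n \<ge> M" "finite F" for n F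
    proof (rule tendsto_upperbound)
      show "(\<lambda>m. \<Sum>x\<in>F. (cmod (Rep_ell2 (X m) x - Rep_ell2 (X n) x))\<^sup>2)
          \<longlonglongrightarrow> (\<Sum>x\<in>F. (cmod (l x - Rep_ell2 (X n) x))\<^sup>2)"
        by (intro tendsto_intros l)
      have "(\<Sum>x\<in>F. (cmod (Rep_ell2 (X m) x - Rep_ell2 (X n) x))\<^sup>2) \<le> e\<^sup>2" if "m \<ge> M" for m
      proof -
        have "(\<Sum>x\<in>F. (cmod (Rep_ell2 (X m - X n) x))\<^sup>2) \<le> (norm (X m - X n))\<^sup>2"
          using \<open>finite F\<close> by (rule sum_Rep_le_norm)
        also have "\<dots> \<le> e\<^sup>2"
          using M[OF that \<open>n \<ge> M\<close>] by (intro power_mono) simp_all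
        finally show ?thesis by (simp add: Rep_ell2_diff)
      qed
      then show "\<forall>\<^sub>F m in sequentially. (\<Sum>x\<in>F. (cmod (Rep_ell2 (X m) x - Rep_ell2 (X n) x))\<^sup>2) \<le> e\<^sup>2"
        by (rule eventually_sequentiallyI)
    qed simp
    then show ?thesis by blast
  qed
  obtain M where M: "\<And>F. finite F \<Longrightarrow> (\<Sum>x\<in>F. (cmod (l x - Rep_ell2 (X M) x))\<^sup>2) \<le> 1"
    using fin[of 1] by auto
  have "(\<lambda>x. (cmod (l x - Rep_ell2 (X M) x))\<^sup>2) summable_on UNIV"
    by (rule nonneg_bdd_above_summable_on) (auto intro!: bdd_aboveI2 M)
  from square_summable_add[OF this, of "Rep_ell2 (X M)"]
  have sq: "(\<lambda>x. (cmod (l x))\<^sup>2) summable_on UNIV"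
    using Rep_ell2[of "X M"] by simp
  define L where "L = Abs_ell2 l"
  have RepL: "Rep_ell2 L = l"
    unfolding L_def by (rule Abs_ell2_inverse) (simp add: sq)
  have "X \<longlonglongrightarrow> L"
  proof (rule LIMSEQ_I)
    fix e :: real assume e: "0 < e"
    obtain M where M: "\<And>n F. n \<ge> M \<Longrightarrow> finite F \<Longrightarrow>
        (\<Sum>x\<in>F. (cmod (l x - Rep_ell2 (X n) x))\<^sup>2) \<le> (e/2)\<^sup>2"
      using fin[of "e/2"] e by auto
    have "norm (X n - L) < e" if "n \<ge> M" for n
    proof -
      have "norm (L - X n) \<le> e / 2"
        using M[OF that] e by (intro norm_ell2_le_finite) (simp_all add: Rep_ell2_diff RepL)
      then show ?thesis using e by (simp add: norm_minus_commute)
    qed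
    then show "\<exists>no. \<forall>n\<ge>no. norm (X n - L) < e" by blast
  qed
  then show "convergent X" by (auto simp: convergent_def)
qed

text \<open>Contractivity of \<open>adj\<close> gives continuity, but only on
  \<open>bounded_ops\<close>, where the definite description in \<open>adj\<close> is known to
  denote the adjoint.\<close>

lemma tendsto_adj:
  fixes X :: "nat \<Rightarrow> 'g op"
  assumes "\<And>n. X n \<in> bounded_ops" "X \<longlonglongrightarrow> T"
  shows "(\<lambda>n. adj (X n)) \<longlonglongrightarrow> adj T"
proof -
  have T: "T \<in> bounded_ops"
    using closed_sequentially[OF closed_bounded_ops] assms by blast
  show ?thesis
  proof (rule Lim_transform_bound[where g = "\<lambda>n. X n - T", THEN LIM_zero_cancel])
    show "(\<lambda>n. X n - T) \<longlonglongrightarrow> 0" using assms(2) by (rule LIM_zero)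
    show "\<forall>\<^sub>F n in sequentially. norm (adj (X n) - adj T) \<le> norm (X n - T)"
      using assms(1) T by (intro always_eventually allI)
        (simp add: norm_adj_le bounded_ops_minus flip: adj_minus)
  qed
qed

lemmas tendsto_blinfun_compose = bounded_bilinear.tendsto[OF bounded_bilinear_blinfun_compose]

lemma op_nonneg_scaleR:
  assumes "op_nonneg T" "0 \<le> r"
  shows "op_nonneg (r *\<^sub>R T)"
  using assms bounded_ops_op_cscale[of T "of_real r"] adj_op_cscale[of T "of_real r"]
  by (simp add: op_nonneg_def op_cscale_of_real blinfun.scaleR_left)

text \<open>A discriminant argument with optimal parameter t = 1 / q. In its uses w is the squared
  modulus of a pairing and the test direction has already been rotated to the right phase, which
  puts w into the quadratic coefficient as well.\<close>

lemma discriminant_bound: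
  fixes p q w :: real
  assumes "\<And>t. 0 \<le> p - 2 * t * w + t\<^sup>2 * w * q" "0 \<le> q" "0 \<le> w"
  shows "w \<le> p * q"
proof (cases "q = 0")
  case True
  have "w = 0"
  proof (rule ccontr)
    assume "w \<noteq> 0"
    \<comment> \<open>At this t the expression equals -1 when \<open>q = 0\<close>.\<close>
    then show False using assms(1)[of "(p + 1) / (2 * w)"] True by simp
  qed
  then show ?thesis using True by simp
next
  case False
  then have "0 \<le> p - w / q"
    using assms(1)[of "1 / q"] by (simp add: power2_eq_square field_simps)
  then show ?thesis using False assms by (simp add: field_simps)
qed

subsection \<open>Square roots and positive elements\<close>

text \<open>A fixed point b of b = (y + b b) / 2 satisfies (1 - b)(1 - b) = 1 - y, so the iteration
  computes 1 minus a square root of 1 - y.\<close>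

fun sqrt_iter :: "'g op \<Rightarrow> nat \<Rightarrow> 'g op" where
  "sqrt_iter y 0 = 0"
| "sqrt_iter y (Suc n) = (1/2) *\<^sub>R (y + (sqrt_iter y n o\<^sub>L sqrt_iter y n))"

fun sqrt_iter_bound :: "nat \<Rightarrow> real" where
  "sqrt_iter_bound 0 = 0"
| "sqrt_iter_bound (Suc n) = (1 + (sqrt_iter_bound n)\<^sup>2) / 2"

lemma sqrt_iter_bound:
  "0 \<le> sqrt_iter_bound n" "sqrt_iter_bound n \<le> 1" "sqrt_iter_bound n \<le> sqrt_iter_bound (Suc n)"
proof -
  show p: "0 \<le> sqrt_iter_bound n" for n by (induction n) simp_all
  show "sqrt_iter_bound n \<le> 1"
  proof (induction n)
    case (Suc n)
    then have "(sqrt_iter_bound n)\<^sup>2 \<le> 1" using p[of n] by (simp add: power_le_one)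
    then show ?case by simp
  qed simp
  have "0 \<le> (1 - sqrt_iter_bound n)\<^sup>2" by simp
  then show "sqrt_iter_bound n \<le> sqrt_iter_bound (Suc n)"
    by (simp add: power2_eq_square algebra_simps)
qed

lemma norm_sqrt_iter:
  assumes "norm y \<le> 1"
  shows "norm (sqrt_iter y n) \<le> sqrt_iter_bound n"
proof (induction n)
  case (Suc n)
  have "norm (y + (sqrt_iter y n o\<^sub>L sqrt_iter y n)) \<le> 1 + sqrt_iter_bound n * sqrt_iter_bound n"
    by (intro norm_triangle_mono assms norm_compose_le Suc)
  then show ?case by (simp add: power2_eq_square)
qed simp

text \<open>The coefficients of the iterates are nonnegative, so the scalar sequence for \<open>y = 1\<close>
  dominates the increments. This also works at the boundary \<open>norm y = 1\<close>.\<close>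

lemma norm_sqrt_iter_diff:
  assumes "norm y \<le> 1"
  shows "norm (sqrt_iter y (Suc n) - sqrt_iter y n) \<le> sqrt_iter_bound (Suc n) - sqrt_iter_bound n"
proof (induction n)
  case 0
  then show ?case using assms by simp
next
  case (Suc n)
  let ?b = "sqrt_iter y" and ?r = sqrt_iter_bound
  let ?D = "?b (Suc n) - ?b n"
  \<comment> \<open>The difference of squares is split as c (c - b) + (c - b) b, which holds without
    commutativity.\<close>
  have "?b (Suc (Suc n)) - ?b (Suc n)
      = (1/2) *\<^sub>R ((?b (Suc n) o\<^sub>L ?D) + (?D o\<^sub>L ?b n))"
  proof -
    have *: "(1/2) *\<^sub>R (y + (c o\<^sub>L c)) - (1/2) *\<^sub>R (y + (b o\<^sub>L b))
        = (1/2) *\<^sub>R ((c o\<^sub>L (c - b)) + ((c - b) o\<^sub>L b))" for b c :: "'a op"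
      by (simp add: blinfun_compose_diff_left blinfun_compose_diff_right flip: scaleR_right_diff_distrib)
    show ?thesis using *[of "?b (Suc n)" "?b n"] by (metis sqrt_iter.simps(2))
  qed
  moreover have "norm ((?b (Suc n) o\<^sub>L ?D) + (?D o\<^sub>L ?b n))
      \<le> ?r (Suc n) * (?r (Suc n) - ?r n) + (?r (Suc n) - ?r n) * ?r n"
    by (intro norm_triangle_mono norm_compose_le Suc norm_sqrt_iter assms)
  moreover have "?r (Suc n) * (?r (Suc n) - ?r n) + (?r (Suc n) - ?r n) * ?r n
      = (?r (Suc n))\<^sup>2 - (?r n)\<^sup>2"
    by (simp add: power2_eq_square algebra_simps)
  moreover have "?r (Suc (Suc n)) - ?r (Suc n) = ((?r (Suc n))\<^sup>2 - (?r n)\<^sup>2) / 2"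
    by (subst (1 2) sqrt_iter_bound.simps(2)) (simp add: field_simps)
  ultimately show ?case by simp
qed

locale unital_cstar =
  fixes A :: "'g op set"
  assumes cstar: "cstar_subalgebra A" and one: "id_blinfun \<in> A"
begin

lemma bounded_opsI: "a \<in> A \<Longrightarrow> a \<in> bounded_ops"
  and zero: "0 \<in> A"
  and add: "a \<in> A \<Longrightarrow> b \<in> A \<Longrightarrow> a + b \<in> A"
  and scale: "a \<in> A \<Longrightarrow> op_cscale c a \<in> A"
  and compose: "a \<in> A \<Longrightarrow> b \<in> A \<Longrightarrow> a o\<^sub>L b \<in> A"
  and adj_closed: "a \<in> A \<Longrightarrow> adj a \<in> A"
  and closed: "closed A"
  using cstar by (auto simp: cstar_subalgebra_def)

lemma scaleR: "a \<in> A \<Longrightarrow> r *\<^sub>R a \<in> A"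
  using scale[of a "of_real r"] by (simp add: op_cscale_of_real)

lemma minus: "a \<in> A \<Longrightarrow> b \<in> A \<Longrightarrow> a - b \<in> A"
  using add[of a "op_cscale (-1) b"] scale[of b "-1"] by (simp add: op_cscale_minus_one)

lemmas mem = one zero add scale compose adj_closed scaleR minus

text \<open>The increments are dominated by those of a convergent monotone scalar sequence, hence
  summable. The limit lies in the closed set \<open>A\<close>, is self-adjoint, and solves the fixed
  point equation.\<close>

lemma square_root_id_minus:
  assumes y: "y \<in> A" "adj y = y" "norm y \<le> 1"
  shows "\<exists>b\<in>A. adj b = b \<and> (id_blinfun - b) o\<^sub>L (id_blinfun - b) = id_blinfun - y"
proof -
  let ?b = "sqrt_iter y" and ?r = sqrt_iter_bound
  have inA: "?b n \<in> A" for n by (induction n) (simp_all add: mem y)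
  have sa: "adj (?b n) = ?b n" for n
  proof (induction n)
    case (Suc n)
    have "adj (op_cscale (of_real (1/2)) (y + (?b n o\<^sub>L ?b n)))
        = op_cscale (of_real (1/2)) (y + (?b n o\<^sub>L ?b n))"
      using inA[of n] y Suc
      by (simp add: adj_op_cscale adj_add adj_compose bounded_opsI mem)
    then show ?case by (simp only: op_cscale_of_real sqrt_iter.simps)
  qed simp
  have "convergent ?r"
  proof (rule Bseq_mono_convergent)
    show "Bseq ?r"
      using sqrt_iter_bound by (intro BseqI'[where K = 1]) simp
    show "\<forall>m. \<forall>n\<ge>m. ?r m \<le> ?r n"
      using lift_Suc_mono_le[of ?r] sqrt_iter_bound(3) by blast
  qed
  then have "summable (\<lambda>n. ?r (Suc n) - ?r n)"
    using telescope_summable convergent_LIMSEQ_iff by blast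
  then have "summable (\<lambda>n. ?b (Suc n) - ?b n)"
    by (rule summable_comparison_test') (rule norm_sqrt_iter_diff[OF y(3)])
  then have "(\<lambda>n. \<Sum>k<n. ?b (Suc k) - ?b k) \<longlonglongrightarrow> (\<Sum>n. ?b (Suc n) - ?b n)"
    by (rule summable_LIMSEQ)
  then obtain b where lim: "?b \<longlonglongrightarrow> b"
    unfolding sum_lessThan_telescope by auto
  have "b \<in> A" using closed_sequentially[OF closed] inA lim by blast
  moreover have "adj b = b"
    using LIMSEQ_unique[OF tendsto_adj[OF _ lim]] lim inA by (simp add: sa bounded_opsI)
  moreover have eq: "b = (1/2) *\<^sub>R (y + (b o\<^sub>L b))"
  proof (rule LIMSEQ_unique)
    show "(\<lambda>n. ?b (Suc n)) \<longlonglongrightarrow> b" by (rule LIMSEQ_Suc[OF lim])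
    show "(\<lambda>n. ?b (Suc n)) \<longlonglongrightarrow> (1/2) *\<^sub>R (y + (b o\<^sub>L b))"
      unfolding sqrt_iter.simps by (intro tendsto_intros tendsto_blinfun_compose lim)
  qed
  moreover have "(id_blinfun - b) o\<^sub>L (id_blinfun - b) = id_blinfun - y"
  proof -
    have "2 *\<^sub>R b = y + (b o\<^sub>L b)" by (subst eq) simp
    then show ?thesis
      by (simp add: blinfun_compose_diff_left blinfun_compose_diff_right scaleR_2 algebra_simps)
  qed
  ultimately show ?thesis by blast
qed

text \<open>A square root taken inside the algebra turns a nonnegative form into a product
  \<open>adj a o\<^sub>L a\<close>. Positivity thereby becomes independent of the algebra, so states
  restrict to subalgebras and positivity can be tested on vectors.\<close>

lemma positive_elements_iff: "T \<in> positive_elements A \<longleftrightarrow> T \<in> A \<and> op_nonneg T"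
proof
  assume "T \<in> positive_elements A"
  then show "T \<in> A \<and> op_nonneg T"
    by (auto simp: positive_elements_def mem bounded_opsI intro!: op_nonneg_adj_compose)
next
  assume T: "T \<in> A \<and> op_nonneg T"
  show "T \<in> positive_elements A"
  proof (cases "T = 0")
    case True
    have "T = adj 0 o\<^sub>L 0" using True by simp
    then show ?thesis unfolding positive_elements_def using zero by blast
  next
    case False
    \<comment> \<open>After rescaling, S and 1 - S both lie in the unit ball; the iteration applied
      to y = 1 - S yields a square root of S.\<close>
    define S where "S = (1 / norm T) *\<^sub>R T"
    have S: "op_nonneg S" "norm S \<le> 1" "S \<in> A"
      using T False by (auto simp: S_def op_nonneg_scaleR scaleR)
    have "adj (id_blinfun - S) = id_blinfun - S"
      using S by (simp add: adj_minus bounded_ops_id op_nonneg_def)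
    then obtain b where b: "b \<in> A" "adj b = b"
      "(id_blinfun - b) o\<^sub>L (id_blinfun - b) = id_blinfun - (id_blinfun - S)"
      using square_root_id_minus[of "id_blinfun - S"] S op_nonneg_norm_id_minus[OF S(1,2)]
      by (auto simp: mem)
    define a where "a = op_cscale (of_real (sqrt (norm T))) (id_blinfun - b)"
    have a: "a \<in> A" using b by (simp add: a_def mem)
    have "adj a o\<^sub>L a = op_cscale (of_real (sqrt (norm T) * sqrt (norm T))) S"
      using b by (simp add: a_def adj_op_cscale bounded_opsI mem adj_minus op_cscale_compose_left
          op_cscale_compose_right op_cscale_op_cscale del: real_sqrt_mult_self)
    also have "\<dots> = T" by (simp add: op_cscale_of_real S_def)
    finally show ?thesis using a unfolding positive_elements_def by auto
  qed
qed

subsection \<open>Positive functionals and pure states\<close>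

text \<open>Neither normalised nor extensional, so that multiples, differences and vector
  functionals arising in decompositions qualify directly.\<close>

definition positive_functional :: "('g op \<Rightarrow> complex) \<Rightarrow> bool" where
  "positive_functional \<omega> \<longleftrightarrow>
     (\<forall>a\<in>A. \<forall>b\<in>A. \<omega> (a + b) = \<omega> a + \<omega> b) \<and>
     (\<forall>c. \<forall>a\<in>A. \<omega> (op_cscale c a) = c * \<omega> a) \<and>
     (\<forall>a\<in>positive_elements A. \<omega> a \<in> \<real>\<^sub>\<ge>\<^sub>0)"

lemma states_iff:
  "\<phi> \<in> states A \<longleftrightarrow> \<phi> \<in> extensional A \<and> positive_functional \<phi> \<and> \<phi> id_blinfun = 1"
  by (auto simp: states_def positive_functional_def)

context
  fixes \<omega> :: "'g op \<Rightarrow> complex"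
  assumes pf: "positive_functional \<omega>"
begin

lemma pf_add: "a \<in> A \<Longrightarrow> b \<in> A \<Longrightarrow> \<omega> (a + b) = \<omega> a + \<omega> b"
  and pf_scale: "a \<in> A \<Longrightarrow> \<omega> (op_cscale c a) = c * \<omega> a"
  and pf_nonneg: "a \<in> A \<Longrightarrow> op_nonneg a \<Longrightarrow> \<omega> a \<in> \<real>\<^sub>\<ge>\<^sub>0"
  using pf by (auto simp: positive_functional_def positive_elements_iff)

lemma pf_minus: "a \<in> A \<Longrightarrow> b \<in> A \<Longrightarrow> \<omega> (a - b) = \<omega> a - \<omega> b"
  using pf_add[of a "op_cscale (-1) b"] pf_scale[of b "-1"] scale[of b "-1"]
  by (simp add: op_cscale_minus_one)

lemma pf_scaleR: "a \<in> A \<Longrightarrow> \<omega> (r *\<^sub>R a) = of_real r * \<omega> a"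
  using pf_scale[of a "of_real r"] by (simp add: op_cscale_of_real)

lemma pf_square: "a \<in> A \<Longrightarrow> \<omega> (adj a o\<^sub>L a) \<in> \<real>\<^sub>\<ge>\<^sub>0"
  by (simp add: pf_nonneg mem op_nonneg_adj_compose bounded_opsI)

text \<open>Polarisation against the identity: the value at \<open>adj b o\<^sub>L b\<close> with b
  = a + c is real for every scalar c. Taking c = 1 compares the imaginary parts, c = \<i> the real
  parts.\<close>

lemma pf_adj:
  assumes a: "a \<in> A" shows "\<omega> (adj a) = cnj (\<omega> a)"
proof -
  have *: "Im (c * \<omega> (adj a) + cnj c * \<omega> a) = 0" for c
  proof -
    define b where "b = a + op_cscale c id_blinfun"
    have b: "b \<in> A" using a by (simp add: b_def mem)
    have "adj b o\<^sub>L b = (adj a o\<^sub>L a) + (op_cscale c (adj a) + (op_cscale (cnj c) a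
        + (op_cscale c (op_cscale (cnj c) id_blinfun))))"
      using a by (simp add: b_def adj_add adj_op_cscale bounded_opsI mem op_cscale_compose_left
          op_cscale_compose_right blinfun_compose_add_left blinfun_compose_add_right
          op_cscale_op_cscale mult.commute)
    then have "\<omega> (adj b o\<^sub>L b) = \<omega> (adj a o\<^sub>L a) + (c * \<omega> (adj a) + (cnj c * \<omega> a
        + c * (cnj c * \<omega> id_blinfun)))"
      using a by (simp add: pf_add pf_scale mem)
    then show ?thesis
      using pf_square[OF b] pf_square[OF a] pf_square[OF one]
      by (simp add: complex_nonneg_Reals_iff)
  qed
  show ?thesis using *[of 1] *[of \<i>] by (simp add: complex_eq_iff)
qed

lemma pf_expand:
  assumes "a \<in> A" "b \<in> A"
  shows "\<omega> (adj (a + op_cscale c b) o\<^sub>L (a + op_cscale c b))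
    = \<omega> (adj a o\<^sub>L a) + c * \<omega> (adj a o\<^sub>L b) + cnj (c * \<omega> (adj a o\<^sub>L b))
      + of_real ((cmod c)\<^sup>2) * \<omega> (adj b o\<^sub>L b)"
proof -
  have "adj (a + op_cscale c b) o\<^sub>L (a + op_cscale c b)
      = (adj a o\<^sub>L a) + (op_cscale c (adj a o\<^sub>L b) + (op_cscale (cnj c) (adj (adj a o\<^sub>L b))
        + op_cscale (of_real ((cmod c)\<^sup>2)) (adj b o\<^sub>L b)))"
    using assms by (simp add: adj_add adj_op_cscale adj_compose bounded_opsI mem op_cscale_compose_left
          op_cscale_compose_right blinfun_compose_add_left blinfun_compose_add_right
          op_cscale_op_cscale complex_norm_square mult.commute del: of_real_power)
  then show ?thesis
    using assms pf_adj[of "adj a o\<^sub>L b"] by (simp add: pf_add pf_scale mem del: of_real_power)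
qed

lemma pf_Cauchy_Schwarz:
  assumes "a \<in> A" "b \<in> A"
  shows "(cmod (\<omega> (adj a o\<^sub>L b)))\<^sup>2 \<le> Re (\<omega> (adj a o\<^sub>L a)) * Re (\<omega> (adj b o\<^sub>L b))"
proof -
  define z p q where "z = \<omega> (adj a o\<^sub>L b)" and "p = Re (\<omega> (adj a o\<^sub>L a))"
    and "q = Re (\<omega> (adj b o\<^sub>L b))"
  have q: "0 \<le> q"
    using pf_square[OF assms(2)] by (simp add: q_def complex_nonneg_Reals_iff)
  have *: "0 \<le> p - 2 * t * (cmod z)\<^sup>2 + t\<^sup>2 * (cmod z)\<^sup>2 * q" for t :: real
  proof -
    \<comment> \<open>This phase makes the cross term c z real and negative for positive t, as
      \<open>discriminant_bound\<close> requires with w the squared modulus of z.\<close>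
    define c where "c = - of_real t * cnj z"
    have cz: "c * z = of_real (- t * (cmod z)\<^sup>2)"
      by (simp add: c_def mult.commute flip: complex_norm_square)
    have nc: "(cmod c)\<^sup>2 = t\<^sup>2 * (cmod z)\<^sup>2"
      by (simp add: c_def norm_mult power_mult_distrib)
    have "0 \<le> Re (\<omega> (adj (a + op_cscale c b) o\<^sub>L (a + op_cscale c b)))"
      using pf_square[of "a + op_cscale c b"] assms by (simp add: mem complex_nonneg_Reals_iff)
    also have "\<dots> = p + Re (c * z) + Re (cnj (c * z)) + Re (of_real ((cmod c)\<^sup>2) * \<omega> (adj b o\<^sub>L b))"
      by (subst pf_expand[OF assms]) (simp add: p_def z_def)
    also have "\<dots> = p - 2 * t * (cmod z)\<^sup>2 + t\<^sup>2 * (cmod z)\<^sup>2 * q"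
      unfolding cz nc by (simp add: q_def)
    finally show ?thesis .
  qed
  show ?thesis
    using discriminant_bound[of p "(cmod z)\<^sup>2" q, OF * q] by (simp add: z_def p_def q_def)
qed

text \<open>The difference \<open>?T\<close> of the two products is a nonnegative form, because the
  norm of a (b f) is at most \<open>norm a\<close> times that of b f.\<close>

lemma pf_compose_le:
  assumes "a \<in> A" "b \<in> A"
  shows "Re (\<omega> (adj (a o\<^sub>L b) o\<^sub>L (a o\<^sub>L b))) \<le> (norm a)\<^sup>2 * Re (\<omega> (adj b o\<^sub>L b))"
proof -
  let ?T = "(norm a)\<^sup>2 *\<^sub>R (adj b o\<^sub>L b) - (adj (a o\<^sub>L b) o\<^sub>L (a o\<^sub>L b))"
  have "op_nonneg ?T"
    unfolding op_nonneg_def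
  proof (intro conjI allI)
    show "?T \<in> bounded_ops" using assms by (simp add: bounded_opsI mem)
    show "adj ?T = ?T"
      using assms adj_op_cscale[of "adj b o\<^sub>L b" "of_real ((norm a)\<^sup>2)"]
      by (simp add: adj_minus adj_compose bounded_opsI mem op_cscale_of_real del: of_real_power)
    fix f
    have "norm (a (b f)) \<le> norm a * norm (b f)" by (rule norm_blinfun)
    then have "(norm (a (b f)))\<^sup>2 \<le> (norm a * norm (b f))\<^sup>2" by (intro power_mono) simp_all
    moreover have "inner f (?T f) = (norm a * norm (b f))\<^sup>2 - (norm (a (b f)))\<^sup>2"
      using assms by (simp add: blinfun.diff_left blinfun.scaleR_left inner_diff_right bounded_opsI
          adj_compose power_mult_distrib power2_norm_eq_inner flip: inner_adj)
    ultimately show "0 \<le> inner f (?T f)" by simp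
  qed
  then have "\<omega> ?T \<in> \<real>\<^sub>\<ge>\<^sub>0" using assms by (intro pf_nonneg) (simp_all add: mem)
  then show ?thesis
    using assms by (simp add: pf_minus pf_scaleR mem complex_nonneg_Reals_iff del: of_real_power)
qed

lemma pf_norm_le:
  assumes "a \<in> A" shows "cmod (\<omega> a) \<le> Re (\<omega> id_blinfun) * norm a"
proof -
  have p: "0 \<le> Re (\<omega> id_blinfun)"
    using pf_square[OF one] by (simp add: complex_nonneg_Reals_iff)
  have "(cmod (\<omega> a))\<^sup>2 \<le> Re (\<omega> id_blinfun) * Re (\<omega> (adj a o\<^sub>L a))"
    using pf_Cauchy_Schwarz[OF one assms] by simp
  also have "\<dots> \<le> Re (\<omega> id_blinfun) * ((norm a)\<^sup>2 * Re (\<omega> id_blinfun))"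
    using pf_compose_le[OF assms one] p by (intro mult_left_mono) simp_all
  also have "\<dots> = (Re (\<omega> id_blinfun) * norm a)\<^sup>2" by (simp add: power2_eq_square)
  finally show ?thesis
    by (rule power2_le_imp_le) (simp add: p)
qed

end

lemma positive_functional_scale:
  "positive_functional \<omega> \<Longrightarrow> 0 \<le> r \<Longrightarrow> positive_functional (\<lambda>a. of_real r * \<omega> a)"
  by (auto simp: positive_functional_def distrib_left mult.left_commute complex_nonneg_Reals_iff)

lemma positive_functional_restrict:
  "positive_functional (restrict \<omega> A) \<longleftrightarrow> positive_functional \<omega>"
  by (auto simp: positive_functional_def mem positive_elements_iff)

text \<open>Dividing both summands by their values at the identity exhibits \<open>\<phi>\<close> as
  a convex combination of states, to which extremality applies. If one of these values is zero,
  \<open>pf_norm_le\<close> makes that summand vanish.\<close>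

lemma pure_state_dominates:
  assumes \<phi>: "\<phi> \<in> pure_states A" and \<omega>: "positive_functional \<omega>"
    and \<theta>: "positive_functional \<theta>"
    and sum: "\<And>a. a \<in> A \<Longrightarrow> \<phi> a = \<omega> a + \<theta> a"
    and a: "a \<in> A"
  shows "\<omega> a = \<omega> id_blinfun * \<phi> a"
proof -
  define s where "s = Re (\<omega> id_blinfun)"
  define t where "t = Re (\<theta> id_blinfun)"
  have s: "0 \<le> s" "\<omega> id_blinfun = of_real s"
    using pf_square[OF \<omega> one] by (simp_all add: s_def complex_nonneg_Reals_iff complex_eq_iff)
  have t: "0 \<le> t" "\<theta> id_blinfun = of_real t"
    using pf_square[OF \<theta> one] by (simp_all add: t_def complex_nonneg_Reals_iff complex_eq_iff)
  have "\<phi> id_blinfun = 1" using \<phi> by (simp add: pure_states_def states_def)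
  with sum[OF one] s t have st: "s + t = 1" by (metis of_real_add of_real_eq_1_iff)
  then have s_eq: "1 - t = s" by simp
  consider "s = 0" | "t = 0" | "0 < s" "0 < t" using s t by linarith
  then show ?thesis
  proof cases
    case 1
    then show ?thesis using pf_norm_le[OF \<omega> a] s by simp
  next
    case 2
    then show ?thesis using pf_norm_le[OF \<theta> a] t sum[OF a] st s by simp
  next
    case 3
    define \<omega>' where "\<omega>' = restrict (\<lambda>a. of_real (1 / s) * \<omega> a) A"
    define \<theta>' where "\<theta>' = restrict (\<lambda>a. of_real (1 / t) * \<theta> a) A"
    have "\<omega>' \<in> states A" "\<theta>' \<in> states A"
      using positive_functional_scale[OF \<omega>, of "1/s"] positive_functional_scale[OF \<theta>, of "1/t"] s t 3
      by (simp_all add: states_iff \<omega>'_def \<theta>'_def positive_functional_restrict one)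
    moreover have "\<forall>a\<in>A. \<phi> a = of_real (1 - t) * \<omega>' a + of_real t * \<theta>' a"
    proof
      fix a assume "a \<in> A"
      then show "\<phi> a = of_real (1 - t) * \<omega>' a + of_real t * \<theta>' a"
        using 3 sum s_eq by (simp add: \<omega>'_def \<theta>'_def del: of_real_diff)
    qed
    moreover have "t < 1" using st 3 by simp
    ultimately have "\<omega>' = \<phi>"
      using \<phi> 3 unfolding pure_states_def by blast
    then have "\<phi> a = of_real (1 / s) * \<omega> a" using a by (auto simp: \<omega>'_def)
    then show ?thesis using 3 s by simp
  qed
qed

end

section \<open>Lebesgue decomposition of a pure state relative to a vector\<close>

lemma bounded_bilinear_cinner: "bounded_bilinear (cinner :: 'g ell2 \<Rightarrow> 'g ell2 \<Rightarrow> complex)"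
proof
  show "\<exists>K. \<forall>a b :: 'g ell2. norm (cinner a b) \<le> norm a * norm b * K"
    by (rule exI[of _ 1]) (simp add: cinner_bound)
qed (simp_all add: cinner_add_left cinner_add_right cinner_cscale_left cinner_cscale_right
    scaleR_ell2_def scaleR_conv_of_real)

lemmas tendsto_cinner = bounded_bilinear.tendsto[OF bounded_bilinear_cinner]

lemma norm_add_cscale_sq:
  "(norm (f + cscale c g))\<^sup>2 = (norm f)\<^sup>2 + 2 * Re (c * cinner f g) + (cmod c)\<^sup>2 * (norm g)\<^sup>2"
proof -
  have "inner f (cscale c g) = Re (c * cinner f g)"
    by (simp add: inner_ell2_def cinner_cscale_right)
  moreover have "(norm (f + h))\<^sup>2 = (norm f)\<^sup>2 + 2 * inner f h + (norm h)\<^sup>2" for h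
    by (simp add: power2_norm_eq_inner inner_add_left inner_add_right inner_commute)
  ultimately show ?thesis by (simp add: norm_cscale power_mult_distrib)
qed

lemma op_nonneg_cinner:
  assumes "op_nonneg T" shows "cinner f (T f) \<in> \<real>\<^sub>\<ge>\<^sub>0"
proof -
  have "cnj (cinner f (T f)) = cinner f (T f)"
    using assms by (metis cinner_adj cinner_commute op_nonneg_def)
  then have "Im (cinner f (T f)) = 0" by (simp add: complex_eq_iff)
  then show ?thesis
    using assms by (simp add: complex_nonneg_Reals_iff op_nonneg_def inner_ell2_def)
qed

lemma op_nonneg_conjugate:
  assumes "op_nonneg T" "S \<in> bounded_ops" shows "op_nonneg (adj S o\<^sub>L (T o\<^sub>L S))"
proof -
  have "T \<in> bounded_ops" "adj T = T" "\<And>f. 0 \<le> inner f (T f)"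
    using assms by (auto simp: op_nonneg_def)
  then show ?thesis
    using assms(2) by (simp add: op_nonneg_def bounded_ops_compose bounded_ops_adj adj_compose
        blinfun_compose_assoc flip: inner_adj)
qed

context unital_cstar
begin

lemma positive_functional_vector: "positive_functional (\<lambda>a. cinner \<eta> (a \<eta>))"
  unfolding positive_functional_def
  by (auto simp: blinfun.add_left cinner_add_right op_cscale_apply cinner_cscale_right
      positive_elements_iff op_nonneg_cinner)

text \<open>This is von Neumann's proof of the Lebesgue decomposition: minimise
  \<open>\<phi> ((1 - a)\<^sup>* (1 - a)) + \<parallel>a d\<parallel>\<^sup>2\<close> over \<open>a \<in> A\<close>. For a minimising sequence \<open>a\<^sub>n\<close> with
  \<open>a\<^sub>n d \<longlonglongrightarrow> \<eta>\<close>, twice the vector functional of \<open>\<eta>\<close> is dominated by \<open>\<phi>\<close>, hence a multiple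
  of \<open>\<phi>\<close>; if \<open>\<eta> = 0\<close>, then the minimum is \<open>0\<close>.\<close>

lemma pure_state_vector_or_singular:
  assumes \<phi>: "\<phi> \<in> pure_states A"
  shows "(\<exists>\<eta>. \<forall>x\<in>A. \<phi> x = cinner \<eta> (x \<eta>)) \<or>
    (\<forall>e>0. \<exists>a\<in>A. Re (\<phi> (adj (id_blinfun - a) o\<^sub>L (id_blinfun - a))) < e \<and> (norm (a d))\<^sup>2 < e)"
proof -
  have pf: "positive_functional \<phi>" and \<phi>1: "\<phi> id_blinfun = 1"
    using \<phi> by (auto simp: pure_states_def states_iff)
  \<comment> \<open>Under the seminorm given by P x plus the squared norm of v on pairs (x, v),
    \<open>Q b\<close> is the squared distance from (1, 0) to (b, - b d), and \<open>q b\<close> is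
    the squared length of the latter. Minimising Q thus projects onto a subspace.\<close>
  define P where "P a = Re (\<phi> (adj a o\<^sub>L a))" for a
  define q where "q a = P a + (norm (a d))\<^sup>2" for a
  define Q where "Q a = P (id_blinfun - a) + (norm (a d))\<^sup>2" for a
  have P0: "0 \<le> P a" if "a \<in> A" for a
    using pf_square[OF pf that] by (simp add: P_def complex_nonneg_Reals_iff)
  have q0: "0 \<le> q a" if "a \<in> A" for a
    using P0[OF that] by (simp add: q_def)
  have Q0: "0 \<le> Q a" if "a \<in> A" for a
    using P0[of "id_blinfun - a"] that by (simp add: Q_def mem)
  have P_expand: "P (a + op_cscale c b)
      = P a + 2 * Re (c * \<phi> (adj a o\<^sub>L b)) + (cmod c)\<^sup>2 * P b"
    if "a \<in> A" "b \<in> A" for a b c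
    unfolding P_def pf_expand[OF pf that] by (simp del: of_real_power)
  have P_par: "P (a + b) + P (a - b) = 2 * P a + 2 * P b" if "a \<in> A" "b \<in> A" for a b
    using P_expand[OF that, of 1] P_expand[OF that, of "-1"] by (simp add: op_cscale_minus_one)
  have P_half: "P ((1/2) *\<^sub>R a) = P a / 4" if "a \<in> A" for a
    using P_expand[OF zero that, of "of_real (1/2)"] pf_scaleR[OF pf zero, of 0]
    unfolding op_cscale_of_real by (simp add: P_def power2_eq_square)
  define m where "m = Inf (Q ` A)"
  have bdd: "bdd_below (Q ` A)" using Q0 by (intro bdd_belowI2[of _ 0])
  have m_le: "m \<le> Q a" if "a \<in> A" for a
    unfolding m_def using bdd that by (intro cInf_lower) auto
  have "\<exists>a\<in>A. Q a < m + 1 / real (Suc n)" for n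
  proof -
    have "Inf (Q ` A) < m + 1 / real (Suc n)" unfolding m_def by simp
    then show ?thesis using cInf_less_iff[OF _ bdd] one by blast
  qed
  then obtain a where a: "\<And>n. a n \<in> A" "\<And>n. Q (a n) < m + 1 / real (Suc n)"
    by metis
  \<comment> \<open>The parallelogram law at the midpoint of b and c, where Q is at least m; only
    the vector component is kept.\<close>
  have par: "(norm (b d - c d))\<^sup>2 \<le> 2 * (Q b + Q c - 2 * m)" if "b \<in> A" "c \<in> A" for b c
  proof -
    let ?h = "(1/2) *\<^sub>R (b + c)"
    have h: "?h \<in> A" using that by (simp add: mem)
    have "id_blinfun - ?h = (1/2) *\<^sub>R ((id_blinfun - b) + (id_blinfun - c))"
    proof -
      have "id_blinfun = (1/2) *\<^sub>R (id_blinfun + id_blinfun :: 'g op)" by (simp flip: scaleR_2)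
      then show ?thesis by (metis scaleR_right_diff_distrib add_diff_add)
    qed
    then have "P (id_blinfun - ?h) = P ((id_blinfun - b) + (id_blinfun - c)) / 4"
      using P_half[of "(id_blinfun - b) + (id_blinfun - c)"] that by (simp add: mem)
    moreover have "P ((id_blinfun - b) + (id_blinfun - c)) \<le> 2 * P (id_blinfun - b) + 2 * P (id_blinfun - c)"
      using P_par[of "id_blinfun - b" "id_blinfun - c"] P0[of "(id_blinfun - b) - (id_blinfun - c)"] that
      by (simp add: mem)
    moreover have "(norm (?h d))\<^sup>2 = (norm (b d + c d))\<^sup>2 / 4"
      by (simp add: blinfun.scaleR_left blinfun.add_left power_divide)
    moreover have "(norm (b d + c d))\<^sup>2 + (norm (b d - c d))\<^sup>2 = 2 * (norm (b d))\<^sup>2 + 2 * (norm (c d))\<^sup>2"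
      by (simp add: power2_norm_eq_inner inner_add_left inner_add_right inner_diff_left
          inner_diff_right)
    moreover have "m \<le> s / 4 + t / 4 \<Longrightarrow> s \<le> 2 * x + 2 * y \<Longrightarrow> t + z = 2 * u + 2 * v \<Longrightarrow>
        z \<le> 2 * (x + u + (y + v) - 2 * m)" for s t x y z u v :: real
      by simp
    ultimately show ?thesis using m_le[OF h] unfolding Q_def by metis
  qed
  \<comment> \<open>An almost minimal residual (1 - b, b d) is almost orthogonal to every direction
    (c, - c d); the left side is the squared modulus of this pairing.\<close>
  have orth: "(cmod (\<phi> (adj (id_blinfun - b) o\<^sub>L c) - cinner (b d) (c d)))\<^sup>2 \<le> (Q b - m) * q c"
    if b: "b \<in> A" and c: "c \<in> A" for b c
  proof -
    define w where "w = \<phi> (adj (id_blinfun - b) o\<^sub>L c) - cinner (b d) (c d)"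
    have "0 \<le> Q b - m - 2 * t * (cmod w)\<^sup>2 + t\<^sup>2 * (cmod w)\<^sup>2 * q c" for t
    proof -
    define k where "k = of_real t * cnj w"
    have kw: "k * w = of_real (t * (cmod w)\<^sup>2)"
    proof -
      have "cnj w * w = of_real ((cmod w)\<^sup>2)" by (metis complex_norm_square mult.commute)
      then show ?thesis unfolding k_def by (metis mult.assoc of_real_mult)
    qed
    have nk: "(cmod k)\<^sup>2 = t\<^sup>2 * (cmod w)\<^sup>2"
      by (simp add: k_def norm_mult power_mult_distrib)
    have e: "id_blinfun - (b + op_cscale k c) = (id_blinfun - b) + op_cscale (- k) c"
      using op_cscale_op_cscale[of "-1" k c] by (simp add: op_cscale_minus_one)
    have "Q (b + op_cscale k c) = P (id_blinfun - b) - 2 * Re (k * \<phi> (adj (id_blinfun - b) o\<^sub>L c))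
        + (cmod k)\<^sup>2 * P c + ((norm (b d))\<^sup>2 + 2 * Re (k * cinner (b d) (c d)) + (cmod k)\<^sup>2 * (norm (c d))\<^sup>2)"
      using that P_expand[of "id_blinfun - b" c "- k"]
      unfolding Q_def e blinfun.add_left op_cscale_apply norm_add_cscale_sq by (simp add: mem)
    also have "\<dots> = Q b - 2 * Re (k * w) + (cmod k)\<^sup>2 * q c"
      by (simp add: Q_def q_def w_def algebra_simps)
    also have "\<dots> = Q b - 2 * t * (cmod w)\<^sup>2 + t\<^sup>2 * (cmod w)\<^sup>2 * q c"
      unfolding kw nk by simp
    finally show ?thesis
      using m_le[of "b + op_cscale k c"] that by (simp add: mem)
    qed
    then show ?thesis
      using discriminant_bound[of "Q b - m" "(cmod w)\<^sup>2" "q c"] q0[OF c] by (simp add: w_def)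
  qed
  have "Cauchy (\<lambda>n. a n d)"
  proof (rule metric_CauchyI)
    fix e :: real assume e: "0 < e"
    obtain M where M: "4 / e\<^sup>2 < real (Suc M)"
      using reals_Archimedean2 less_Suc_eq of_nat_less_iff by (metis order.strict_trans)
    have "dist (a k d) (a n d) < e" if "k \<ge> M" "n \<ge> M" for k n
    proof -
      have "(norm (a k d - a n d))\<^sup>2 \<le> 2 * (Q (a k) + Q (a n) - 2 * m)"
        by (rule par) (rule a)+
      also have "\<dots> < 2 * (1 / real (Suc k) + 1 / real (Suc n))"
        using a(2)[of k] a(2)[of n] by simp
      also have "\<dots> \<le> 2 * (1 / real (Suc M) + 1 / real (Suc M))"
        using that by (intro mult_left_mono add_mono divide_left_mono) simp_all
      also have "\<dots> < e\<^sup>2"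
        using M e by (simp add: field_simps)
      finally show ?thesis using e by (simp add: dist_norm power_less_imp_less_base)
    qed
    then show "\<exists>M. \<forall>k\<ge>M. \<forall>n\<ge>M. dist (a k d) (a n d) < e" by blast
  qed
  then obtain \<eta> where \<eta>: "(\<lambda>n. a n d) \<longlonglongrightarrow> \<eta>"
    using Cauchy_convergent_iff convergent_def by blast
  have orth_lim: "(\<lambda>n. \<phi> (adj (id_blinfun - a n) o\<^sub>L b n) - cinner (a n d) (b n d)) \<longlonglongrightarrow> 0"
    if b: "\<And>n. b n \<in> A" "\<And>n. q (b n) \<le> K" for b K
  proof (rule Lim_null_comparison)
    have "0 \<le> K" using q0[OF b(1)] b(2) order_trans by blast
    then show "\<forall>\<^sub>F n in sequentially.
        norm (\<phi> (adj (id_blinfun - a n) o\<^sub>L b n) - cinner (a n d) (b n d)) \<le> sqrt (1 / real (Suc n) * K)"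
      using orth[OF a(1) b(1)] a(2) b(2) q0[OF b(1)]
      by (intro always_eventually allI real_le_rsqrt order_trans[OF orth[OF a(1) b(1)]] mult_mono)
        (simp_all add: less_imp_le algebra_simps)
    have "(\<lambda>n. sqrt (1 / real (Suc n) * K)) \<longlonglongrightarrow> sqrt (0 * K)"
      by (intro tendsto_intros LIMSEQ_Suc[OF lim_1_over_n])
    then show "(\<lambda>n. sqrt (1 / real (Suc n) * K)) \<longlonglongrightarrow> 0" by simp
  qed
  \<comment> \<open>The norms of \<open>a n\<close> may be unbounded, but q is bounded along the
    sequence: P (a n) is at most 2 + 2 Q (a n), the vector part adds at most Q (a n), and Q (a n) is
    at most m + 1. Left multiplication by x costs only the square of \<open>norm x\<close>.\<close>
  have q_le: "q (x o\<^sub>L a n) \<le> (norm x)\<^sup>2 * (2 + 3 * (m + 1))" if x: "x \<in> A" for x n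
  proof -
    have "P (a n) \<le> 2 * P id_blinfun + 2 * P (id_blinfun - a n)"
      using P_par[of id_blinfun "id_blinfun - a n"] P0[of "id_blinfun + (id_blinfun - a n)"] a(1)[of n]
      by (simp add: mem)
    moreover have "P id_blinfun = 1" by (simp add: P_def \<phi>1)
    moreover have "P (id_blinfun - a n) \<le> Q (a n)" "(norm (a n d))\<^sup>2 \<le> Q (a n)"
      using P0[of "id_blinfun - a n"] a(1)[of n] by (simp_all add: Q_def mem)
    moreover have "Q (a n) \<le> m + 1"
      using a(2)[of n] divide_le_eq_1[of 1 "real (Suc n)"] by linarith
    ultimately have "q (a n) \<le> 2 + 3 * (m + 1)"
      unfolding q_def by (simp add: algebra_simps)
    moreover have "P (x o\<^sub>L a n) \<le> (norm x)\<^sup>2 * P (a n)"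
      unfolding P_def by (rule pf_compose_le[OF pf x a(1)])
    moreover have "(norm (x (a n d)))\<^sup>2 \<le> (norm x)\<^sup>2 * (norm (a n d))\<^sup>2"
      using power_mono[OF norm_blinfun[of x "a n d"], of 2] by (simp add: power_mult_distrib)
    ultimately have "q (x o\<^sub>L a n) \<le> (norm x)\<^sup>2 * q (a n)"
      by (simp add: q_def distrib_left)
    also have "\<dots> \<le> (norm x)\<^sup>2 * (2 + 3 * (m + 1))"
      using \<open>q (a n) \<le> _\<close> by (intro mult_left_mono) simp_all
    finally show ?thesis .
  qed
  have cross: "(\<lambda>n. \<phi> (adj (id_blinfun - a n) o\<^sub>L (x o\<^sub>L a n))) \<longlonglongrightarrow> cinner \<eta> (x \<eta>)" if x: "x \<in> A" for x
  proof -
    have "(\<lambda>n. cinner (a n d) ((x o\<^sub>L a n) d)) \<longlonglongrightarrow> cinner \<eta> (x \<eta>)"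
      by (simp, intro tendsto_cinner \<eta> tendsto_intros)
    moreover have "(\<lambda>n. \<phi> (adj (id_blinfun - a n) o\<^sub>L (x o\<^sub>L a n)) - cinner (a n d) ((x o\<^sub>L a n) d)) \<longlonglongrightarrow> 0"
      by (rule orth_lim[where K = "(norm x)\<^sup>2 * (2 + 3 * (m + 1))"])
        (rule compose[OF x a(1)], rule q_le[OF x])
    ultimately show ?thesis by (rule Lim_transform)
  qed
  \<comment> \<open>Insert 1 = (1 - a) + a on both sides of x. By \<open>cross\<close> each mixed
    term tends to \<open>cinner \<eta> (x \<eta>)\<close>, so \<open>\<theta>\<close> is the limit
    of the two remaining terms, which are positive for positive x.\<close>
  define \<theta> where "\<theta> x = \<phi> x - 2 * cinner \<eta> (x \<eta>)" for x
  have lim: "(\<lambda>n. \<phi> (adj (id_blinfun - a n) o\<^sub>L (x o\<^sub>L (id_blinfun - a n))) + \<phi> (adj (a n) o\<^sub>L (x o\<^sub>L a n)))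
      \<longlonglongrightarrow> \<theta> x" if x: "x \<in> A" for x
  proof -
    have "\<phi> (adj (id_blinfun - a n) o\<^sub>L (x o\<^sub>L (id_blinfun - a n))) + \<phi> (adj (a n) o\<^sub>L (x o\<^sub>L a n))
        = \<phi> x - \<phi> (adj (id_blinfun - a n) o\<^sub>L (x o\<^sub>L a n))
          - cnj (\<phi> (adj (id_blinfun - a n) o\<^sub>L (adj x o\<^sub>L a n)))" for n
    proof -
      let ?a = "a n" and ?b = "id_blinfun - a n"
      have ab: "?a \<in> A" "?b \<in> A" using a(1)[of n] by (simp_all add: mem)
      have "x = ((adj ?b o\<^sub>L (x o\<^sub>L ?b)) + (adj ?a o\<^sub>L (x o\<^sub>L ?a))) + ((adj ?b o\<^sub>L (x o\<^sub>L ?a)) + (adj ?a o\<^sub>L (x o\<^sub>L ?b)))"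
        using ab by (simp add: adj_minus bounded_opsI one blinfun_compose_diff_left blinfun_compose_diff_right)
      then have "\<phi> x = (\<phi> (adj ?b o\<^sub>L (x o\<^sub>L ?b)) + \<phi> (adj ?a o\<^sub>L (x o\<^sub>L ?a)))
          + (\<phi> (adj ?b o\<^sub>L (x o\<^sub>L ?a)) + \<phi> (adj ?a o\<^sub>L (x o\<^sub>L ?b)))"
        using ab x by (metis (no_types, lifting) pf_add[OF pf] add compose adj_closed)
      moreover have "\<phi> (adj ?a o\<^sub>L (x o\<^sub>L ?b)) = cnj (\<phi> (adj ?b o\<^sub>L (adj x o\<^sub>L ?a)))"
        using ab x pf_adj[OF pf, of "adj ?b o\<^sub>L (adj x o\<^sub>L ?a)"]
        by (simp add: adj_compose bounded_opsI mem blinfun_compose_assoc)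
      ultimately show ?thesis by simp
    qed
    moreover have "(\<lambda>n. \<phi> x - \<phi> (adj (id_blinfun - a n) o\<^sub>L (x o\<^sub>L a n))
          - cnj (\<phi> (adj (id_blinfun - a n) o\<^sub>L (adj x o\<^sub>L a n))))
        \<longlonglongrightarrow> \<phi> x - cinner \<eta> (x \<eta>) - cnj (cinner \<eta> (adj x \<eta>))"
      using x by (intro tendsto_intros cross) (simp_all add: mem)
    moreover have "cnj (cinner \<eta> (adj x \<eta>)) = cinner \<eta> (x \<eta>)"
      using x by (simp add: bounded_opsI cinner_adj_left flip: cinner_commute)
    ultimately show ?thesis by (simp add: \<theta>_def)
  qed
  have "positive_functional \<theta>"
    unfolding positive_functional_def
  proof (intro conjI ballI allI)
    fix x assume "x \<in> positive_elements A"
    then have x: "x \<in> A" "op_nonneg x" by (simp_all add: positive_elements_iff)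
    show "\<theta> x \<in> \<real>\<^sub>\<ge>\<^sub>0"
      by (rule closed_sequentially[OF closed_nonneg_Reals_complex _ lim[OF x(1)]])
        (use x a(1) in \<open>auto intro!: nonneg_Reals_add_I pf_nonneg[OF pf] op_nonneg_conjugate
            simp: mem bounded_opsI\<close>)
  qed (simp_all add: \<theta>_def pf_add[OF pf] pf_scale[OF pf] blinfun.add_left cinner_add_right
      op_cscale_apply cinner_cscale_right algebra_simps)
  moreover have "positive_functional (\<lambda>x. 2 * cinner \<eta> (x \<eta>))"
    using positive_functional_scale[OF positive_functional_vector, of 2 \<eta>] by simp
  ultimately have dom: "2 * cinner \<eta> (x \<eta>) = 2 * cinner \<eta> \<eta> * \<phi> x" if "x \<in> A" for x
    using pure_state_dominates[OF \<phi>, of "\<lambda>x. 2 * cinner \<eta> (x \<eta>)" \<theta>] that by (simp add: \<theta>_def)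
  show ?thesis
  proof (cases "\<eta> = 0")
    case False
    define \<zeta> where "\<zeta> = (1 / norm \<eta>) *\<^sub>R \<eta>"
    have "\<phi> x = cinner \<zeta> (x \<zeta>)" if x: "x \<in> A" for x
    proof -
      have "cinner \<zeta> (x \<zeta>) = of_real (1 / norm \<eta>) * (of_real (1 / norm \<eta>) * cinner \<eta> (x \<eta>))"
        unfolding \<zeta>_def scaleR_ell2_def
        using bounded_opsI[OF x] by (simp add: bounded_opsD cinner_cscale_left cinner_cscale_right)
      also have "cinner \<eta> (x \<eta>) = of_real ((norm \<eta>)\<^sup>2) * \<phi> x"
        using dom[OF x] by (simp add: cinner_self_norm)
      finally show ?thesis using False by (simp add: power2_eq_square)
    qed
    then show ?thesis by blast
  next
    case True
    have "(\<lambda>n. \<phi> (adj (id_blinfun - a n)) - cinner (a n d) d) \<longlonglongrightarrow> 0"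
      using orth_lim[of "\<lambda>_. id_blinfun" "q id_blinfun"] one by simp
    moreover have "(\<lambda>n. cinner (a n d) d) \<longlonglongrightarrow> cinner \<eta> d"
      by (intro tendsto_cinner \<eta> tendsto_const)
    ultimately have "(\<lambda>n. \<phi> (adj (id_blinfun - a n))) \<longlonglongrightarrow> 0 + cinner \<eta> d"
      using tendsto_add by fastforce
    moreover have "(\<lambda>n. \<phi> (adj (id_blinfun - a n) o\<^sub>L a n)) \<longlonglongrightarrow> cinner \<eta> \<eta>"
      using cross[OF one] by simp
    ultimately have "(\<lambda>n. \<phi> (adj (id_blinfun - a n)) - \<phi> (adj (id_blinfun - a n) o\<^sub>L a n))
        \<longlonglongrightarrow> 0 + cinner \<eta> d - cinner \<eta> \<eta>"
      by (rule tendsto_diff)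
    moreover have "cinner (0 :: 'g ell2) f = 0" for f
      using cinner_bound[of 0 f] by simp
    moreover have "\<phi> (adj (id_blinfun - a n)) - \<phi> (adj (id_blinfun - a n) o\<^sub>L a n)
        = \<phi> (adj (id_blinfun - a n) o\<^sub>L (id_blinfun - a n))" for n
      using a(1)[of n] by (simp add: blinfun_compose_diff_right pf_minus[OF pf] mem)
    ultimately have l1: "(\<lambda>n. P (id_blinfun - a n)) \<longlonglongrightarrow> 0"
      unfolding P_def using tendsto_Re True by fastforce
    have "(\<lambda>n. (norm (a n d))\<^sup>2) \<longlonglongrightarrow> (norm \<eta>)\<^sup>2" by (intro tendsto_intros \<eta>)
    then have l2: "(\<lambda>n. (norm (a n d))\<^sup>2) \<longlonglongrightarrow> 0" using True by simp
    have "\<exists>b\<in>A. P (id_blinfun - b) < e \<and> (norm (b d))\<^sup>2 < e" if "0 < e" for e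
    proof -
      have "\<forall>\<^sub>F n in sequentially. P (id_blinfun - a n) < e \<and> (norm (a n d))\<^sup>2 < e"
        using order_tendstoD(2)[OF l1 that] order_tendstoD(2)[OF l2 that] by (rule eventually_conj)
      then obtain n where "P (id_blinfun - a n) < e \<and> (norm (a n d))\<^sup>2 < e"
        using eventually_happens'[OF sequentially_bot] by blast
      then show ?thesis using a(1) by blast
    qed
    then show ?thesis unfolding P_def by blast
  qed
qed

end

section \<open>Quadratic form bounds and extensions of pure states\<close>

context unital_cstar
begin

text \<open>Rotate X by a phase so that its value becomes nonnegative; T minus the real part of the
  rotated X is then a nonnegative form. This compares values of a functional where operator norms
  are not under control.\<close>

lemma pf_numerical_bound:
  assumes pf: "positive_functional \<omega>" and X: "X \<in> A" and T: "T \<in> A" "op_nonneg T"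
    and le: "\<And>f. cmod (cinner f (X f)) \<le> inner f (T f)"
  shows "cmod (\<omega> X) \<le> Re (\<omega> T)"
proof -
  define c where "c = cnj (sgn (\<omega> X))"
  have c: "cmod c \<le> 1" by (simp add: c_def norm_sgn)
  have c\<omega>: "c * \<omega> X = of_real (cmod (\<omega> X))"
  proof (cases "\<omega> X = 0")
    case False
    then show ?thesis
      by (simp add: c_def sgn_eq complex_norm_square[symmetric] power2_eq_square field_simps)
  qed simp
  define Y where "Y = op_cscale c X"
  define Z where "Z = T - (1/2) *\<^sub>R (Y + adj Y)"
  have Y: "Y \<in> A" using X by (simp add: Y_def mem)
  have Z: "Z \<in> A" using Y T by (simp add: Z_def mem)
  have "op_nonneg Z"
    unfolding op_nonneg_def
  proof (intro conjI allI)
    show "Z \<in> bounded_ops" using Z by (rule bounded_opsI)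
    have "adj ((1/2) *\<^sub>R (Y + adj Y)) = (1/2) *\<^sub>R (Y + adj Y)"
      using adj_op_cscale[of "Y + adj Y" "of_real (1/2)"] Y
      by (simp add: adj_add bounded_opsI mem op_cscale_of_real add.commute del: of_real_divide)
    then show "adj Z = Z"
      using T Y by (simp add: Z_def adj_minus bounded_opsI mem op_nonneg_def)
    fix f
    have "inner f (adj Y f) = inner f (Y f)"
      using Y by (simp add: bounded_opsI inner_commute flip: inner_adj)
    then have "inner f (Z f) = inner f (T f) - inner f (Y f)"
      by (simp add: Z_def blinfun.diff_left blinfun.scaleR_left blinfun.add_left inner_diff_right
          inner_add_right)
    moreover have "inner f (Y f) \<le> cmod (cinner f (Y f))"
      by (simp add: inner_ell2_def complex_Re_le_cmod)
    moreover have "cmod (cinner f (Y f)) \<le> cmod (cinner f (X f))"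
      using mult_right_mono[OF c, of "cmod (cinner f (X f))"]
      by (simp add: Y_def op_cscale_apply cinner_cscale_right norm_mult)
    ultimately show "0 \<le> inner f (Z f)" using le[of f] by linarith
  qed
  then have "\<omega> Z \<in> \<real>\<^sub>\<ge>\<^sub>0" using Z by (intro pf_nonneg[OF pf])
  then have "0 \<le> Re (\<omega> Z)" by (simp add: complex_nonneg_Reals_iff)
  moreover have "Re (\<omega> Z) = Re (\<omega> T) - cmod (\<omega> X)"
    using T X Y by (simp add: Z_def pf_minus[OF pf] pf_add[OF pf] pf_scaleR[OF pf] mem pf_adj[OF pf])
      (simp add: Y_def pf_scale[OF pf] c\<omega>)
  ultimately show ?thesis by simp
qed

lemma restrict_state:
  assumes \<psi>: "\<psi> \<in> states A" and C: "unital_cstar C" "C \<subseteq> A"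
  shows "restrict \<psi> C \<in> states C"
proof -
  interpret C: unital_cstar C by fact
  show ?thesis
    using \<psi> C(2)
    by (auto simp: states_def C.mem C.positive_elements_iff positive_elements_iff subset_iff)
qed

text \<open>A convex decomposition of the extension restricts to one of \<open>\<phi>\<close>;
  purity makes both pieces extend \<open>\<phi>\<close>, and uniqueness among all states identifies
  them. Purity of the extension thus comes from uniqueness.\<close>

lemma pure_state_unique_extension:
  assumes C: "unital_cstar C" "C \<subseteq> A" and \<phi>: "\<phi> \<in> pure_states C"
    and \<psi>: "\<psi> \<in> states A" "restrict \<psi> C = \<phi>"
    and uniq: "\<And>\<psi>'. \<psi>' \<in> states A \<Longrightarrow> restrict \<psi>' C = \<phi> \<Longrightarrow> \<psi>' = \<psi>"
  shows "\<exists>!\<psi>. \<psi> \<in> pure_states A \<and> restrict \<psi> C = \<phi>"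
proof -
  have "\<psi> \<in> pure_states A"
    unfolding pure_states_def
  proof (intro CollectI conjI ballI allI impI, rule \<psi>(1))
    fix \<omega> \<theta> and t :: real
    assume st: "\<omega> \<in> states A" "\<theta> \<in> states A"
      and t: "0 < t \<and> t < 1 \<and> (\<forall>a\<in>A. \<psi> a = of_real (1 - t) * \<omega> a + of_real t * \<theta> a)"
    have "\<phi> a = of_real (1 - t) * restrict \<omega> C a + of_real t * restrict \<theta> C a" if "a \<in> C" for a
      using that t C(2) \<psi>(2) by auto
    then have "restrict \<omega> C = \<phi> \<and> restrict \<theta> C = \<phi>"
      using \<phi> t restrict_state[OF st(1) C] restrict_state[OF st(2) C] unfolding pure_states_def by blast
    then show "\<omega> = \<psi>" "\<theta> = \<psi>" using uniq st by blast+
  qed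
  then show ?thesis using \<psi>(2) uniq unfolding pure_states_def by blast
qed

end

subsection \<open>Operator algebras generated by translations\<close>

inductive_set group_algebra :: "'g :: group_add set \<Rightarrow> 'g op set" for H where
  zero: "0 \<in> group_algebra H"
| step: "x \<in> group_algebra H \<Longrightarrow> g \<in> H \<Longrightarrow> op_cscale c (left_reg g) + x \<in> group_algebra H"

text \<open>A closure of explicit linear combinations provides approximating sequences, which an
  intersection of subalgebras does not. Agreement with \<open>cstar_generated\<close> is established
  in \<open>cstar_generated_group_cstar\<close>.\<close>

definition group_cstar :: "'g :: group_add set \<Rightarrow> 'g op set" where
  "group_cstar H = closure (group_algebra H)"

lemma left_shift_add: "left_shift g (left_shift h f) = left_shift (g + h) f"
  by transfer (simp add: minus_add add.assoc[symmetric])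

lemma left_reg_compose: "left_reg g o\<^sub>L left_reg h = left_reg (g + h)"
  by (rule blinfun_eqI) (simp add: left_reg.rep_eq left_shift_add)

lemma left_reg_zero: "left_reg 0 = id_blinfun"
proof (rule blinfun_eqI)
  fix f :: "'a ell2"
  have "left_shift 0 f = f" by transfer simp
  then show "left_reg 0 f = id_blinfun f" by (simp add: left_reg.rep_eq)
qed

lemma left_reg_bounded_ops: "left_reg g \<in> bounded_ops"
proof -
  have "left_shift g (cscale c f) = cscale c (left_shift g f)" for c f by transfer simp
  then show ?thesis by (simp add: bounded_ops_def left_reg.rep_eq)
qed

lemma norm_left_reg_apply [simp]: "norm (left_reg g f) = norm f"
  by (simp add: left_reg.rep_eq norm_left_shift)

lemma Rep_left_reg: "Rep_ell2 (left_reg g f) x = Rep_ell2 f (- g + x)"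
  by (simp add: left_reg.rep_eq left_shift.rep_eq)

lemma cinner_left_reg: "cinner (left_reg g f) (left_reg g f') = cinner f f'"
  unfolding cinner.rep_eq Rep_left_reg
  using infsum_reindex_bij_betw[OF bij_left_translation[of g], of "\<lambda>x. cnj (Rep_ell2 f x) * Rep_ell2 f' x"]
  by simp

lemma left_reg_left_reg: "left_reg g (left_reg h f) = left_reg (g + h) f"
  by (simp add: left_reg.rep_eq left_shift_add)

lemma adj_left_reg: "adj (left_reg g) = left_reg (- g)"
proof (rule adj_eqI)
  fix f f'
  have "cinner (left_reg g f) f' = cinner (left_reg g f) (left_reg g (left_reg (- g) f'))"
    by (simp add: left_reg_left_reg left_reg_zero)
  then show "cinner (left_reg g f) f' = cinner f (left_reg (- g) f')"
    by (simp add: cinner_left_reg)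
qed

lemma group_algebra_bounded_ops: "x \<in> group_algebra H \<Longrightarrow> x \<in> bounded_ops"
  by (induction rule: group_algebra.induct)
    (simp_all add: bounded_ops_zero bounded_ops_add bounded_ops_op_cscale left_reg_bounded_ops)

lemma group_cstar_bounded_ops: "x \<in> group_cstar H \<Longrightarrow> x \<in> bounded_ops"
  unfolding group_cstar_def
  using closure_minimal[OF _ closed_bounded_ops] group_algebra_bounded_ops by blast

lemma group_algebra_generator: "g \<in> H \<Longrightarrow> left_reg g \<in> group_algebra H"
  using group_algebra.step[OF group_algebra.zero, of g H 1] by simp

lemma left_reg_group_cstar: "g \<in> H \<Longrightarrow> left_reg g \<in> group_cstar H"
  unfolding group_cstar_def using group_algebra_generator closure_subset by blast

lemma group_algebra_add: "x \<in> group_algebra H \<Longrightarrow> y \<in> group_algebra H \<Longrightarrow> x + y \<in> group_algebra H"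
  by (induction rule: group_algebra.induct) (simp_all add: add.assoc group_algebra.step)

lemma op_cscale_zero_right [simp]: "op_cscale c 0 = 0"
  using op_cscale_op_cscale[of c 0 0] by simp

lemma group_algebra_scale: "x \<in> group_algebra H \<Longrightarrow> op_cscale c x \<in> group_algebra H"
proof (induction rule: group_algebra.induct)
  case zero
  then show ?case by (simp add: group_algebra.zero)
next
  case (step x g d)
  then show ?case by (simp add: op_cscale_add op_cscale_op_cscale group_algebra.step)
qed

lemma group_cstar_seq:
  assumes "a \<in> group_cstar H"
  obtains x where "\<And>n. x n \<in> group_algebra H" "x \<longlonglongrightarrow> a"
  using assms unfolding group_cstar_def closure_sequential by blast

lemma group_cstar_limit: "(\<And>n. x n \<in> group_algebra H) \<Longrightarrow> x \<longlonglongrightarrow> a \<Longrightarrow> a \<in> group_cstar H"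
  unfolding group_cstar_def closure_sequential by blast

lemma group_cstar_add: "a \<in> group_cstar H \<Longrightarrow> b \<in> group_cstar H \<Longrightarrow> a + b \<in> group_cstar H"
  by (elim group_cstar_seq) (rule group_cstar_limit[OF group_algebra_add tendsto_add])

lemma bounded_linear_op_cscale: "bounded_linear (op_cscale c)"
  by (rule bounded_linear_intro[where K = "cmod c"])
    (simp_all add: op_cscale_add norm_op_cscale mult.commute op_cscale_op_cscale flip: op_cscale_of_real)

lemma group_cstar_scale: "a \<in> group_cstar H \<Longrightarrow> op_cscale c a \<in> group_cstar H"
  by (elim group_cstar_seq)
    (rule group_cstar_limit[OF group_algebra_scale bounded_linear.tendsto[OF bounded_linear_op_cscale]])

lemma group_cstar_zero: "0 \<in> group_cstar H"
  unfolding group_cstar_def using group_algebra.zero closure_subset by blast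

lemma group_cstar_minus: "a \<in> group_cstar H \<Longrightarrow> b \<in> group_cstar H \<Longrightarrow> a - b \<in> group_cstar H"
  using group_cstar_add[of a H "op_cscale (-1) b"] group_cstar_scale[of b H "-1"]
  by (simp add: op_cscale_minus_one)

lemma group_cstar_mono:
  assumes "H \<subseteq> K" shows "group_cstar H \<subseteq> group_cstar K"
proof -
  have "x \<in> group_algebra K" if "x \<in> group_algebra H" for x
    using that by induction (use assms in \<open>auto intro: group_algebra.intros\<close>)
  then show ?thesis unfolding group_cstar_def by (intro closure_mono) blast
qed

lemma closed_group_cstar: "closed (group_cstar H)"
  by (simp add: group_cstar_def)

text \<open>Density principle: D measures the failure of an identity and behaves like a bounded
  seminorm, so it is enough to check generators. Commutation, locality and equality of functionals
  are all proved this way.\<close>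

lemma group_cstar_vanish:
  assumes a: "a \<in> group_cstar H"
    and gen: "\<And>g. g \<in> H \<Longrightarrow> D (left_reg g) \<le> (0 :: real)"
    and add: "\<And>a b. a \<in> group_cstar H \<Longrightarrow> b \<in> group_cstar H \<Longrightarrow> D (a + b) \<le> D a + D b"
    and scale: "\<And>c a. a \<in> group_cstar H \<Longrightarrow> D (op_cscale c a) \<le> cmod c * D a"
    and bound: "\<And>a. a \<in> group_cstar H \<Longrightarrow> D a \<le> K * norm a"
  shows "D a \<le> 0"
proof -
  have sub: "x \<in> group_cstar H" if "x \<in> group_algebra H" for x
    using that unfolding group_cstar_def using closure_subset by blast
  have alg: "D x \<le> 0" if "x \<in> group_algebra H" for x
    using that
  proof induction
    case zero
    then show ?case using bound[OF group_cstar_zero] by simp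
  next
    case (step x g c)
    have "D (op_cscale c (left_reg g)) \<le> 0"
      using scale[OF left_reg_group_cstar[OF step.hyps(2)], of c]
        mult_left_mono[OF gen[OF step.hyps(2)], of "cmod c"] by simp
    then show ?case
      using add[OF group_cstar_scale[OF left_reg_group_cstar[OF step.hyps(2)]] sub[OF step.hyps(1)], of c]
        step.IH by linarith
  qed
  obtain x where x: "\<And>n. x n \<in> group_algebra H" "x \<longlonglongrightarrow> a"
    using group_cstar_seq[OF a] by blast
  show ?thesis
  proof (rule tendsto_lowerbound)
    have "(\<lambda>n. K * norm (a - x n)) \<longlonglongrightarrow> K * norm (a - a)"
      by (intro tendsto_intros x)
    then show "(\<lambda>n. K * norm (a - x n)) \<longlonglongrightarrow> 0" by simp
    have "D a \<le> K * norm (a - x n)" for n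
      using add[OF sub[OF x(1)] group_cstar_minus[OF a sub[OF x(1)]], of n n] alg[OF x(1), of n]
        bound[OF group_cstar_minus[OF a sub[OF x(1)]], of n] by simp
    then show "\<forall>\<^sub>F n in sequentially. D a \<le> K * norm (a - x n)" by simp
  qed simp
qed

section \<open>Right translations and the trace property\<close>

lemma bij_right_translation: "bij (\<lambda>x. x + s :: 'g :: group_add)"
  by (rule bij_betw_byWitness[where f' = "\<lambda>x. x + - s"]) (auto simp: add.assoc)

lift_definition right_shift :: "'g :: group_add \<Rightarrow> 'g ell2 \<Rightarrow> 'g ell2" is "\<lambda>s f x. f (x + s)"
proof -
  fix s :: 'g and f :: "'g \<Rightarrow> complex"
  assume "(\<lambda>x. (cmod (f x))\<^sup>2) summable_on UNIV"
  then show "(\<lambda>x. (cmod (f (x + s)))\<^sup>2) summable_on UNIV"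
    using summable_on_reindex_bij_betw[OF bij_right_translation[of s], of "\<lambda>x. (cmod (f x))\<^sup>2"]
    by simp
qed

lemma cinner_right_shift: "cinner (right_shift s f) (right_shift s f') = cinner f f'"
  unfolding cinner.rep_eq right_shift.rep_eq
  using infsum_reindex_bij_betw[OF bij_right_translation[of s], of "\<lambda>x. cnj (Rep_ell2 f x) * Rep_ell2 f' x"]
  by simp

lemma norm_eq_cinner: "norm f = sqrt (Re (cinner f f))"
  by (simp add: cinner_self_norm)

lemma norm_right_shift [simp]: "norm (right_shift s f) = norm f"
  by (simp add: norm_eq_cinner cinner_right_shift)

lemma right_shift_add: "right_shift s (f + f') = right_shift s f + right_shift s f'"
  by transfer simp

lemma right_shift_cscale: "right_shift s (cscale c f) = cscale c (right_shift s f)"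
  by transfer simp

lemma right_shift_delta: "right_shift s (delta x) = delta (x - s)"
proof -
  have "y + s = x \<longleftrightarrow> y = x - s" for y by (metis add_diff_cancel diff_add_cancel)
  then show ?thesis
    by (simp add: right_shift.rep_eq delta.rep_eq fun_eq_iff flip: Rep_ell2_inject)
qed

lemma left_reg_right_shift: "left_reg g (right_shift s f) = right_shift s (left_reg g f)"
  by (simp add: fun_eq_iff Rep_left_reg right_shift.rep_eq add.assoc flip: Rep_ell2_inject)

lemma group_cstar_right_shift:
  assumes "a \<in> group_cstar H" shows "a (right_shift s f) = right_shift s (a f)"
proof -
  have "norm (a (right_shift s f) - right_shift s (a f)) \<le> 0"
    using assms
  proof (rule group_cstar_vanish)
    fix a b :: "'a op"
    show "norm ((a + b) (right_shift s f) - right_shift s ((a + b) f))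
      \<le> norm (a (right_shift s f) - right_shift s (a f)) + norm (b (right_shift s f) - right_shift s (b f))"
      by (simp add: blinfun.add_left right_shift_add) (metis add_diff_add norm_triangle_ineq)
    have "norm (a (right_shift s f) - right_shift s (a f)) \<le> norm a * norm f + norm a * norm f"
      by (rule norm_triangle_le_diff)
        (metis add_mono norm_blinfun norm_right_shift)
    then show "norm (a (right_shift s f) - right_shift s (a f)) \<le> (2 * norm f) * norm a"
      by (simp add: mult_ac)
  next
    fix c and a :: "'a op"
    have "cscale c (f - g) = cscale c f - cscale c g" for f g :: "'a ell2"
      by (rule linear_diff[OF bounded_linear.linear[OF bounded_linear_cscale]])
    then show "norm (op_cscale c a (right_shift s f) - right_shift s (op_cscale c a f))
        \<le> cmod c * norm (a (right_shift s f) - right_shift s (a f))"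
      by (simp add: op_cscale_apply right_shift_cscale norm_cscale flip: norm_cscale)
  qed (simp add: left_reg_right_shift)
  then show ?thesis by simp
qed

lemma group_cstar_delta: "a \<in> group_cstar H \<Longrightarrow> a (delta x) = right_shift (- x) (a (delta 0))"
  by (simp add: right_shift_delta flip: group_cstar_right_shift)

text \<open>Traciality at the vector \<open>delta 0\<close>: commuting with right translations makes
  the coefficient of \<open>adj a (delta 0)\<close> at x the conjugate of that of
  \<open>a (delta 0)\<close> at - x.\<close>

lemma norm_adj_delta:
  assumes a: "a \<in> group_cstar H" shows "norm (adj a (delta 0)) = norm (a (delta 0))"
proof -
  have "Rep_ell2 (adj a (delta 0)) x = cnj (Rep_ell2 (a (delta 0)) (- x))" for x
  proof -
    have "Rep_ell2 (adj a (delta 0)) x = cinner (a (delta x)) (delta 0)"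
      using group_cstar_bounded_ops[OF a] by (simp add: cinner_adj flip: cinner_delta_left)
    also have "\<dots> = cnj (Rep_ell2 (a (delta x)) 0)"
      by (metis cinner_commute cinner_delta_left)
    also have "\<dots> = cnj (Rep_ell2 (a (delta 0)) (- x))"
      by (subst group_cstar_delta[OF a]) (simp add: right_shift.rep_eq)
    finally show ?thesis .
  qed
  moreover have "bij (uminus :: 'a \<Rightarrow> 'a)"
    by (rule bij_betw_byWitness[where f' = uminus]) auto
  ultimately show ?thesis
    unfolding norm_ell2_eq
    using infsum_reindex_bij_betw[of uminus UNIV UNIV "\<lambda>x. (cmod (Rep_ell2 (a (delta 0)) x))\<^sup>2"]
    by simp
qed

section \<open>Coordinate projections\<close>

lift_definition cutoff :: "'g set \<Rightarrow> 'g ell2 \<Rightarrow> 'g ell2" is "\<lambda>X f x. if x \<in> X then f x else 0"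
proof -
  fix X and f :: "'g \<Rightarrow> complex"
  assume "(\<lambda>x. (cmod (f x))\<^sup>2) summable_on UNIV"
  then show "(\<lambda>x. (cmod (if x \<in> X then f x else 0))\<^sup>2) summable_on UNIV"
    by (rule summable_on_comparison_test) auto
qed

lemma cutoff_add: "cutoff X (f + g) = cutoff X f + cutoff X g"
  by transfer auto

lemma cutoff_cscale: "cutoff X (cscale c f) = cscale c (cutoff X f)"
  by transfer auto

lemma cinner_cutoff: "cinner (cutoff X f) g = cinner f (cutoff X g)"
  unfolding cinner.rep_eq cutoff.rep_eq by (rule infsum_cong) simp

lemma cutoff_cutoff: "cutoff X (cutoff Y f) = cutoff (X \<inter> Y) f"
  by transfer auto

lemma cutoff_Un: "X \<inter> Y = {} \<Longrightarrow> cutoff (X \<union> Y) f = cutoff X f + cutoff Y f"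
  by transfer (auto simp: fun_eq_iff)

lemma cutoff_empty [simp]: "cutoff {} f = 0"
  by transfer simp

lemma cutoff_UNIV [simp]: "cutoff UNIV f = f"
  by transfer simp

lemma cinner_zero_right [simp]: "cinner f (0 :: 'g ell2) = 0"
  using cinner_bound[of f 0] by simp

lemma norm_cutoff_Un:
  assumes "X \<inter> Y = {}"
  shows "(norm (cutoff (X \<union> Y) f))\<^sup>2 = (norm (cutoff X f))\<^sup>2 + (norm (cutoff Y f))\<^sup>2"
proof -
  have "cinner (cutoff X f) (cutoff Y f) = 0"
    using assms by (simp add: cinner_cutoff cutoff_cutoff)
  then show ?thesis
    using norm_add_cscale_sq[of "cutoff X f" 1 "cutoff Y f"] assms by (simp add: cutoff_Un)
qed

lemma norm_cutoff_le: "norm (cutoff X f) \<le> norm f"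
proof -
  have "(norm f)\<^sup>2 = (norm (cutoff X f))\<^sup>2 + (norm (cutoff (- X) f))\<^sup>2"
    using norm_cutoff_Un[of X "- X" f] by simp
  then have "(norm (cutoff X f))\<^sup>2 \<le> (norm f)\<^sup>2" by simp
  then show ?thesis by (rule power2_le_imp_le) simp
qed

lemma sum_norm_cutoff_le:
  assumes "finite I" "\<And>i j. i \<in> I \<Longrightarrow> j \<in> I \<Longrightarrow> i \<noteq> j \<Longrightarrow> X i \<inter> X j = {}"
  shows "(\<Sum>i\<in>I. (norm (cutoff (X i) f))\<^sup>2) \<le> (norm f)\<^sup>2"
proof -
  have "(\<Sum>i\<in>I. (norm (cutoff (X i) f))\<^sup>2) = (norm (cutoff (\<Union>i\<in>I. X i) f))\<^sup>2"
    using assms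
  proof (induction I rule: finite_induct)
    case (insert i I)
    then have "X i \<inter> (\<Union>j\<in>I. X j) = {}" by blast
    then show ?case using insert by (simp add: norm_cutoff_Un)
  qed simp
  also have "\<dots> \<le> (norm f)\<^sup>2" by (intro power_mono norm_cutoff_le) simp
  finally show ?thesis .
qed

lemma left_reg_cutoff: "left_reg g (cutoff X f) = cutoff ((+) g ` X) (left_reg g f)"
proof -
  have "- g + x \<in> X \<longleftrightarrow> x \<in> (+) g ` X" for x
    by (metis (no_types, lifting) add_minus_cancel image_iff minus_add_cancel)
  then show ?thesis
    by (simp add: fun_eq_iff Rep_left_reg cutoff.rep_eq flip: Rep_ell2_inject)
qed

section \<open>Subgroups, right cosets and wandering sets\<close>

locale add_subgroup =
  fixes H :: "'g :: group_add set"
  assumes zero_mem: "0 \<in> H"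
    and add_mem: "g \<in> H \<Longrightarrow> h \<in> H \<Longrightarrow> g + h \<in> H"
    and uminus_mem: "g \<in> H \<Longrightarrow> - g \<in> H"
begin

lemma group_algebra_compose:
  assumes "x \<in> group_algebra H" "y \<in> group_algebra H"
  shows "x o\<^sub>L y \<in> group_algebra H"
proof -
  have gen: "left_reg g o\<^sub>L y \<in> group_algebra H" if "g \<in> H" "y \<in> group_algebra H" for g y
    using that(2)
  proof induction
    case zero
    have "left_reg g o\<^sub>L 0 = 0" by (rule blinfun_eqI) simp
    then show ?case by (simp add: group_algebra.zero)
  next
    case (step x h c)
    then show ?case
      using group_algebra.step[OF step.IH add_mem[OF \<open>g \<in> H\<close> step.hyps(2)], of c]
      by (simp add: blinfun_compose_add_right op_cscale_compose_right left_reg_bounded_ops left_reg_compose)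
  qed
  show ?thesis using assms(1)
  proof induction
    case zero
    have "0 o\<^sub>L y = 0" by (rule blinfun_eqI) simp
    then show ?case by (simp add: group_algebra.zero)
  next
    case (step x g c)
    then show ?case
      by (simp add: blinfun_compose_add_left op_cscale_compose_left group_algebra_add
          group_algebra_scale gen assms)
  qed
qed

lemma group_algebra_adj: "x \<in> group_algebra H \<Longrightarrow> adj x \<in> group_algebra H"
proof (induction rule: group_algebra.induct)
  case (step x g c)
  then show ?case
    using group_algebra.step[OF step.IH uminus_mem[OF step.hyps(2)], of "cnj c"]
    by (simp add: adj_add adj_op_cscale adj_left_reg left_reg_bounded_ops bounded_ops_op_cscale
        group_algebra_bounded_ops)
qed (simp add: group_algebra.zero)

lemma group_cstar_compose:
  "a \<in> group_cstar H \<Longrightarrow> b \<in> group_cstar H \<Longrightarrow> a o\<^sub>L b \<in> group_cstar H"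
  by (elim group_cstar_seq) (rule group_cstar_limit[OF group_algebra_compose tendsto_blinfun_compose])

lemma group_cstar_adj: "a \<in> group_cstar H \<Longrightarrow> adj a \<in> group_cstar H"
  by (elim group_cstar_seq)
    (rule group_cstar_limit[OF group_algebra_adj tendsto_adj[OF group_algebra_bounded_ops]])

sublocale A: unital_cstar "group_cstar H"
proof
  show "cstar_subalgebra (group_cstar H)"
    unfolding cstar_subalgebra_def
    by (auto simp: group_cstar_bounded_ops group_cstar_zero group_cstar_add group_cstar_scale
        group_cstar_compose group_cstar_adj closed_group_cstar)
  show "id_blinfun \<in> group_cstar H"
    using left_reg_group_cstar[OF zero_mem] by (simp add: left_reg_zero)
qed

end

lemma add_subgroup_UNIV: "add_subgroup UNIV"
  by unfold_locales simp_all

text \<open>Treating the whole group as a subgroup makes every result on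
  \<open>group_cstar H\<close> available for the ambient algebra under the prefix
  \<open>B.A\<close>; the rewrite discharges the membership premises.\<close>

global_interpretation B: add_subgroup UNIV
  rewrites "(x \<in> UNIV) = True" by (rule add_subgroup_UNIV) simp

context add_subgroup
begin

abbreviation coset :: "'g \<Rightarrow> 'g set" where
  "coset x \<equiv> (\<lambda>k. k + x) ` H"

lemma coset_self: "x \<in> coset x"
  using zero_mem image_eqI[of x "\<lambda>k. k + x" 0 H] by simp

lemma coset_eqI:
  assumes "y \<in> coset x" shows "coset y = coset x"
proof -
  obtain k where k: "k \<in> H" "y = k + x" using assms by blast
  have x: "x = - k + y" using k by (simp add: add.assoc[symmetric])
  show ?thesis
  proof (intro equalityI image_subsetI)
    fix l assume l: "l \<in> H"
    have "l + y = (l + k) + x" by (simp only: k(2) add.assoc)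
    moreover have "l + x = (l + - k) + y" unfolding x by (simp only: add.assoc)
    ultimately show "l + y \<in> coset x" "l + x \<in> coset y"
      using l k(1) add_mem uminus_mem by blast+
  qed
qed

lemma coset_disjoint: "coset x \<noteq> coset y \<Longrightarrow> coset x \<inter> coset y = {}"
  using coset_eqI by blast

text \<open>A generator with g in H evaluates f at - g + y, which stays in the coset of y. So
  functions on a fixed coset form an invariant subspace.\<close>

lemma group_cstar_local:
  assumes a: "a \<in> group_cstar H" and f: "\<And>x. x \<in> coset y \<Longrightarrow> Rep_ell2 f x = 0"
  shows "Rep_ell2 (a f) y = 0"
proof -
  have "cmod (Rep_ell2 (a f) y) \<le> 0"
    using a
  proof (rule group_cstar_vanish)
    fix g assume "g \<in> H"
    then have "- g + y \<in> coset y" using uminus_mem by blast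
    then show "cmod (Rep_ell2 (left_reg g f) y) \<le> 0" by (simp add: Rep_left_reg f)
  next
    fix a b :: "'g op"
    show "cmod (Rep_ell2 ((a + b) f) y) \<le> cmod (Rep_ell2 (a f) y) + cmod (Rep_ell2 (b f) y)"
      by (simp add: blinfun.add_left plus_ell2.rep_eq norm_triangle_ineq)
    show "cmod (Rep_ell2 (a f) y) \<le> norm f * norm a"
      using order_trans[OF cmod_Rep_le_norm norm_blinfun] by (simp add: mult.commute)
  qed (simp add: op_cscale_apply cscale.rep_eq norm_mult)
  then show ?thesis by simp
qed

lemma group_cstar_coset:
  assumes "a \<in> group_cstar H"
  shows "Rep_ell2 (a f) y = Rep_ell2 (a (cutoff (coset y) f)) y"
  using group_cstar_local[OF assms, of y "f - cutoff (coset y) f"]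
  by (simp add: Rep_ell2_diff cutoff.rep_eq blinfun.diff_right)

text \<open>The value at y pairs f, restricted to the coset of y, with the row
  \<open>adj a (delta y)\<close>. By right translation and the trace property every row has the norm
  of \<open>a (delta 0)\<close>.\<close>

lemma group_cstar_pointwise:
  assumes a: "a \<in> group_cstar H"
  shows "cmod (Rep_ell2 (a f) y) \<le> norm (a (delta 0)) * norm (cutoff (coset y) f)"
proof -
  have bo: "a \<in> bounded_ops" using a by (rule group_cstar_bounded_ops)
  have "Rep_ell2 (a f) y = cinner (delta y) (a (cutoff (coset y) f))"
    by (simp add: cinner_delta_left flip: group_cstar_coset[OF a])
  also have "\<dots> = cinner (adj a (delta y)) (cutoff (coset y) f)"
    using bo by (simp add: cinner_adj_left)
  also have "cmod \<dots> \<le> norm (adj a (delta y)) * norm (cutoff (coset y) f)"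
    by (rule cinner_bound)
  also have "norm (adj a (delta y)) = norm (a (delta 0))"
    by (subst group_cstar_delta[OF group_cstar_adj[OF a]]) (simp add: norm_adj_delta[OF a])
  finally show ?thesis .
qed

text \<open>Equivalent to meeting every coset at most once. The coset form serves
  \<open>norm_cutoff_wandering\<close>, the form with disjoint translates serves
  \<open>norm_average_le\<close>.\<close>

definition wandering :: "'g set \<Rightarrow> bool" where
  "wandering Y \<longleftrightarrow> (\<forall>k\<in>H. k \<noteq> 0 \<longrightarrow> (+) k ` Y \<inter> Y = {})"

lemma wandering_coset:
  assumes Y: "wandering Y" and "x \<in> Y" "y \<in> Y" "x \<noteq> y"
  shows "coset x \<inter> coset y = {}"
proof (rule coset_disjoint, rule)
  assume "coset x = coset y"
  then obtain k where k: "k \<in> H" "x = k + y" using coset_self[of x] by auto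
  then have "k \<noteq> 0" using \<open>x \<noteq> y\<close> by auto
  then show False using Y k assms unfolding wandering_def by blast
qed

text \<open>Square and sum the pointwise bound over Y: distinct points of Y lie in disjoint cosets,
  so the restricted norms of f sum to at most that of f. The operator norm of a does not enter the
  bound.\<close>

lemma norm_cutoff_wandering:
  assumes a: "a \<in> group_cstar H" and Y: "wandering Y"
  shows "norm (cutoff Y (a f)) \<le> norm (a (delta 0)) * norm f"
proof (rule norm_ell2_le_finite)
  fix F :: "'g set" assume F: "finite F"
  have "(\<Sum>x\<in>F. (cmod (Rep_ell2 (cutoff Y (a f)) x))\<^sup>2) = (\<Sum>x\<in>F \<inter> Y. (cmod (Rep_ell2 (a f) x))\<^sup>2)"
    using F by (intro sum.mono_neutral_cong_right) (auto simp: cutoff.rep_eq)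
  also have "\<dots> \<le> (\<Sum>x\<in>F \<inter> Y. (norm (a (delta 0)))\<^sup>2 * (norm (cutoff (coset x) f))\<^sup>2)"
    using group_cstar_pointwise[OF a] by (intro sum_mono) (simp flip: power_mult_distrib)
  also have "\<dots> = (norm (a (delta 0)))\<^sup>2 * (\<Sum>x\<in>F \<inter> Y. (norm (cutoff (coset x) f))\<^sup>2)"
    by (simp add: sum_distrib_left)
  also have "\<dots> \<le> (norm (a (delta 0)))\<^sup>2 * (norm f)\<^sup>2"
    using F wandering_coset[OF Y] by (intro mult_left_mono sum_norm_cutoff_le) auto
  finally show "(\<Sum>x\<in>F. (cmod (Rep_ell2 (cutoff Y (a f)) x))\<^sup>2) \<le> (norm (a (delta 0)) * norm f)\<^sup>2"
    by (simp add: power_mult_distrib)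
qed simp

text \<open>Split f along Y; the part off Y is carried by h into h + (- Y), where the projection can
  be moved to \<open>f'\<close>.\<close>

lemma cinner_left_reg_wandering:
  "cmod (cinner f' (left_reg h f))
    \<le> norm f' * norm (cutoff Y f) + norm (cutoff ((+) h ` (- Y)) f') * norm f"
proof -
  have "left_reg h f = left_reg h (cutoff Y f) + cutoff ((+) h ` (- Y)) (left_reg h f)"
    using cutoff_Un[of Y "- Y" f] by (simp flip: left_reg_cutoff blinfun.add_right)
  then have "cinner f' (left_reg h f) = cinner f' (left_reg h (cutoff Y f))
      + cinner (cutoff ((+) h ` (- Y)) f') (left_reg h f)"
    by (metis cinner_add_right cinner_cutoff)
  also have "cmod \<dots> \<le> norm f' * norm (left_reg h (cutoff Y f))
      + norm (cutoff ((+) h ` (- Y)) f') * norm (left_reg h f)"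
    by (intro norm_triangle_mono cinner_bound)
  finally show ?thesis by simp
qed

end

subsection \<open>The block diagonal conditional expectation\<close>

context add_subgroup
begin

text \<open>Compression to the diagonal blocks indexed by cosets: a matrix entry survives exactly
  when its row and column lie in the same coset. \<open>block_sum_le\<close> justifies the use of
  \<open>Abs_ell2\<close>.\<close>

definition block_fun :: "'g op \<Rightarrow> 'g ell2 \<Rightarrow> 'g ell2" where
  "block_fun T f = Abs_ell2 (\<lambda>x. Rep_ell2 (T (cutoff (coset x) f)) x)"

text \<open>This extends the canonical conditional expectation onto \<open>group_cstar H\<close> to all bounded
  operators.\<close>

definition block :: "'g op \<Rightarrow> 'g op" where
  "block T = Blinfun (block_fun T)"

text \<open>Group the points of F by coset. Inside one coset C the operator acts on a single vector
  \<open>cutoff C f\<close>, and these vectors are mutually orthogonal for different C.\<close>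

lemma block_sum_le:
  fixes T :: "'g op"
  assumes "finite F"
  shows "(\<Sum>x\<in>F. (cmod (Rep_ell2 (T (cutoff (coset x) f)) x))\<^sup>2) \<le> (norm T * norm f)\<^sup>2"
proof -
  have "(\<Sum>x\<in>F. (cmod (Rep_ell2 (T (cutoff (coset x) f)) x))\<^sup>2)
      = (\<Sum>C\<in>coset ` F. \<Sum>x | x \<in> F \<and> coset x = C. (cmod (Rep_ell2 (T (cutoff (coset x) f)) x))\<^sup>2)"
    by (rule sum.image_gen[OF assms])
  also have "\<dots> \<le> (\<Sum>C\<in>coset ` F. (norm T)\<^sup>2 * (norm (cutoff C f))\<^sup>2)"
  proof (rule sum_mono)
    fix C
    have "(\<Sum>x | x \<in> F \<and> coset x = C. (cmod (Rep_ell2 (T (cutoff (coset x) f)) x))\<^sup>2)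
        = (\<Sum>x | x \<in> F \<and> coset x = C. (cmod (Rep_ell2 (T (cutoff C f)) x))\<^sup>2)"
      by (rule sum.cong) auto
    also have "\<dots> \<le> (norm (T (cutoff C f)))\<^sup>2"
      using assms by (intro sum_Rep_le_norm) simp
    also have "\<dots> \<le> (norm T * norm (cutoff C f))\<^sup>2"
      by (intro power_mono norm_blinfun) simp
    finally show "(\<Sum>x | x \<in> F \<and> coset x = C. (cmod (Rep_ell2 (T (cutoff (coset x) f)) x))\<^sup>2)
        \<le> (norm T)\<^sup>2 * (norm (cutoff C f))\<^sup>2"
      by (simp add: power_mult_distrib)
  qed
  also have "\<dots> = (norm T)\<^sup>2 * (\<Sum>C\<in>coset ` F. (norm (cutoff C f))\<^sup>2)"
    by (simp add: sum_distrib_left)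
  also have "\<dots> \<le> (norm T)\<^sup>2 * (norm f)\<^sup>2"
    using assms coset_disjoint by (intro mult_left_mono sum_norm_cutoff_le) auto
  finally show ?thesis by (simp add: power_mult_distrib)
qed

lemma Rep_block_fun: "Rep_ell2 (block_fun T f) x = Rep_ell2 (T (cutoff (coset x) f)) x"
proof -
  have "(\<lambda>x. (cmod (Rep_ell2 (T (cutoff (coset x) f)) x))\<^sup>2) summable_on UNIV"
    by (rule nonneg_bdd_above_summable_on) (auto intro!: bdd_aboveI2 block_sum_le)
  then show ?thesis unfolding block_fun_def by (subst Abs_ell2_inverse) simp_all
qed

lemma norm_block_fun: "norm (block_fun T f) \<le> norm T * norm f"
  by (rule norm_ell2_le_finite) (simp_all add: Rep_block_fun block_sum_le)

lemma cutoff_scaleR: "cutoff X (r *\<^sub>R f) = r *\<^sub>R cutoff X f"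
  by (simp add: scaleR_ell2_def cutoff_cscale)

lemma block_apply: "block T f = block_fun T f"
proof -
  have "bounded_linear (block_fun T)"
  proof (rule bounded_linear_intro[where K = "norm T"])
    fix f g :: "'g ell2" and r :: real
    show "block_fun T (f + g) = block_fun T f + block_fun T g"
      by (simp add: fun_eq_iff Rep_block_fun plus_ell2.rep_eq cutoff_add blinfun.add_right
          flip: Rep_ell2_inject)
    have "block_fun T (r *\<^sub>R f) = cscale (of_real r) (block_fun T f)"
      by (simp add: fun_eq_iff Rep_block_fun cscale.rep_eq cutoff_scaleR blinfun.scaleR_right
          scaleR_ell2_def[of r "T _"] flip: Rep_ell2_inject)
    then show "block_fun T (r *\<^sub>R f) = r *\<^sub>R block_fun T f"
      by (simp add: scaleR_ell2_def)
    show "norm (block_fun T f) \<le> norm f * norm T"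
      using norm_block_fun[of T f] by (simp add: mult.commute)
  qed
  then show ?thesis by (simp add: block_def bounded_linear_Blinfun_apply)
qed

lemma Rep_block: "Rep_ell2 (block T f) x = Rep_ell2 (T (cutoff (coset x) f)) x"
  by (simp add: block_apply Rep_block_fun)

lemma norm_block_le: "norm (block T) \<le> norm T"
  by (rule norm_blinfun_bound) (simp_all add: block_apply norm_block_fun)

lemma block_eqI:
  fixes T T' :: "'g op"
  shows "(\<And>f x. Rep_ell2 (T (cutoff (coset x) f)) x = Rep_ell2 (T' f) x) \<Longrightarrow> block T = T'"
  by (intro blinfun_eqI) (simp add: fun_eq_iff Rep_block flip: Rep_ell2_inject)

lemma block_add: "block (S + T) = block S + block T"
  by (rule block_eqI) (simp add: blinfun.add_left plus_ell2.rep_eq Rep_block)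

lemma block_scale: "block (op_cscale c T) = op_cscale c (block T)"
  by (rule block_eqI) (simp add: op_cscale_apply cscale.rep_eq Rep_block)

lemma block_scaleR: "block (r *\<^sub>R T) = r *\<^sub>R block T"
  using block_scale[of "of_real r" T] by (simp add: op_cscale_of_real)

lemma bounded_linear_block: "bounded_linear block"
  by (rule bounded_linear_intro[where K = 1]) (simp_all add: block_add block_scaleR norm_block_le)

lemma block_minus: "block (S - T) = block S - block T"
  by (rule linear_diff[OF bounded_linear.linear[OF bounded_linear_block]])

lemma block_bounded_ops: "T \<in> bounded_ops \<Longrightarrow> block T \<in> bounded_ops"
  unfolding bounded_ops_def
  by (simp add: fun_eq_iff Rep_block cutoff_cscale cscale.rep_eq flip: Rep_ell2_inject)

lemma block_left_reg: "block (left_reg g) = (if g \<in> H then left_reg g else 0)"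
proof (rule block_eqI)
  fix f x
  have "- g + x \<in> coset x \<longleftrightarrow> g \<in> H"
    using uminus_mem by (metis (no_types, lifting) add_right_cancel image_iff minus_minus)
  then show "Rep_ell2 (left_reg g (cutoff (coset x) f)) x
      = Rep_ell2 ((if g \<in> H then left_reg g else 0) f) x"
    by (simp add: Rep_left_reg cutoff.rep_eq zero_ell2.rep_eq)
qed

lemma block_group_cstar:
  assumes "a \<in> group_cstar UNIV" shows "block a \<in> group_cstar H"
proof -
  have alg: "block x \<in> group_algebra H" if "x \<in> group_algebra UNIV" for x
    using that
  proof induction
    case zero
    have "block 0 = 0" using block_scaleR[of 0 0] by simp
    then show ?case by (simp add: group_algebra.zero)
  next
    case (step x g c)
    then show ?case
      by (auto simp: block_add block_scale block_left_reg intro: group_algebra.step)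
  qed
  obtain x where x: "\<And>n. x n \<in> group_algebra UNIV" "x \<longlonglongrightarrow> a"
    using group_cstar_seq[OF assms] by blast
  show ?thesis
    by (rule group_cstar_limit[OF alg[OF x(1)] bounded_linear.tendsto[OF bounded_linear_block x(2)]])
qed

lemma block_ident: "b \<in> group_cstar H \<Longrightarrow> block b = b"
  by (rule block_eqI) (rule group_cstar_coset[symmetric])

lemma group_cstar_cutoff_coset:
  assumes "b \<in> group_cstar H"
  shows "b (cutoff (coset x) f) = cutoff (coset x) (b f)"
proof -
  have "Rep_ell2 (b (cutoff (coset x) f)) y = Rep_ell2 (cutoff (coset x) (b f)) y" for y
  proof (cases "y \<in> coset x")
    case True
    then show ?thesis
      using coset_eqI[OF True] group_cstar_coset[OF assms, of f y] by (simp add: cutoff.rep_eq)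
  next
    case False
    then have "coset y \<inter> coset x = {}" using coset_disjoint coset_self by metis
    then have "Rep_ell2 (cutoff (coset x) f) z = 0" if "z \<in> coset y" for z
      using that by (auto simp: cutoff.rep_eq)
    then have "Rep_ell2 (b (cutoff (coset x) f)) y = 0"
      by (rule group_cstar_local[OF assms])
    then show ?thesis using False by (simp add: cutoff.rep_eq)
  qed
  then show ?thesis by (simp add: fun_eq_iff flip: Rep_ell2_inject)
qed

lemma cutoff_block: "cutoff (coset x) (block T f) = cutoff (coset x) (T (cutoff (coset x) f))"
proof -
  have "Rep_ell2 (block T f) y = Rep_ell2 (T (cutoff (coset x) f)) y" if "y \<in> coset x" for y
    using coset_eqI[OF that] by (simp add: Rep_block)
  then show ?thesis by (simp add: fun_eq_iff cutoff.rep_eq flip: Rep_ell2_inject)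
qed

text \<open>Elements of \<open>group_cstar H\<close> commute with the coset projections and
  therefore pass through the compression on either side.\<close>

lemma block_bimodule:
  assumes b: "b \<in> group_cstar H" and b': "b' \<in> group_cstar H"
  shows "block (b o\<^sub>L a o\<^sub>L b') = b o\<^sub>L block a o\<^sub>L b'"
proof (rule block_eqI)
  fix f x
  have "Rep_ell2 (b (a (b' (cutoff (coset x) f)))) x
      = Rep_ell2 (cutoff (coset x) (b (a (cutoff (coset x) (b' f))))) x"
    using coset_self by (simp add: group_cstar_cutoff_coset[OF b'] cutoff.rep_eq)
  also have "\<dots> = Rep_ell2 (b (cutoff (coset x) (block a (b' f)))) x"
    by (simp add: group_cstar_cutoff_coset[OF b, symmetric] cutoff_block)
  also have "\<dots> = Rep_ell2 (b (block a (b' f))) x"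
    using coset_self by (simp add: group_cstar_cutoff_coset[OF b] cutoff.rep_eq)
  finally show "Rep_ell2 ((b o\<^sub>L a o\<^sub>L b') (cutoff (coset x) f)) x = Rep_ell2 ((b o\<^sub>L block a o\<^sub>L b') f) x"
    by simp
qed

lemma block_adj:
  assumes "a \<in> group_cstar UNIV" shows "adj (block a) = block (adj a)"
proof -
  have "norm (adj (block a) - block (adj a)) \<le> 0"
    using assms
  proof (rule group_cstar_vanish)
    fix g :: 'g
    show "norm (adj (block (left_reg g)) - block (adj (left_reg g))) \<le> 0"
      using uminus_mem[of g] uminus_mem[of "- g"] by (auto simp: adj_left_reg block_left_reg)
  next
    fix a b :: "'g op" and c
    assume a: "a \<in> group_cstar UNIV"
    have ba: "a \<in> bounded_ops" "block a \<in> bounded_ops"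
      using a by (simp_all add: group_cstar_bounded_ops block_bounded_ops)
    show "norm (adj (block (op_cscale c a)) - block (adj (op_cscale c a)))
        \<le> cmod c * norm (adj (block a) - block (adj a))"
    proof -
      have "adj (block (op_cscale c a)) - block (adj (op_cscale c a))
          = op_cscale (cnj c) (adj (block a) - block (adj a))"
        using ba by (simp add: block_scale adj_op_cscale
            linear_diff[OF bounded_linear.linear[OF bounded_linear_op_cscale]])
      then show ?thesis using norm_op_cscale[of "cnj c"] by simp
    qed
    have "norm (adj (block a) - block (adj a)) \<le> norm a + norm a"
      using ba by (intro norm_triangle_le_diff add_mono order_trans[OF norm_adj_le]
          order_trans[OF norm_block_le] norm_adj_le norm_block_le)
    then show "norm (adj (block a) - block (adj a)) \<le> 2 * norm a" by simp
    assume "b \<in> group_cstar UNIV"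
    then have "b \<in> bounded_ops" "block b \<in> bounded_ops"
      by (simp_all add: group_cstar_bounded_ops block_bounded_ops)
    then have "adj (block (a + b)) - block (adj (a + b))
        = (adj (block a) - block (adj a)) + (adj (block b) - block (adj b))"
      using ba by (simp add: block_add adj_add)
    then show "norm (adj (block (a + b)) - block (adj (a + b)))
        \<le> norm (adj (block a) - block (adj a)) + norm (adj (block b) - block (adj b))"
      by (simp only: norm_triangle_ineq)
  qed
  then show ?thesis by simp
qed

lemma block_id: "block id_blinfun = id_blinfun"
  using block_left_reg[of 0] zero_mem by (simp add: left_reg_zero)

text \<open>A unital contraction is positive: \<open>0 \<le> T \<le> 1\<close> gives \<open>\<parallel>1 - block T\<parallel> \<le> \<parallel>1 - T\<parallel> \<le> 1\<close>.\<close>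

lemma block_nonneg:
  assumes a: "a \<in> group_cstar UNIV" "op_nonneg a"
  shows "op_nonneg (block a)"
  unfolding op_nonneg_def
proof (intro conjI allI)
  show "block a \<in> bounded_ops" using a by (simp add: block_bounded_ops group_cstar_bounded_ops)
  show "adj (block a) = block a" using a by (simp add: block_adj op_nonneg_def)
  fix f
  define S where "S = (1 / norm a) *\<^sub>R a"
  have S: "op_nonneg S" "norm S \<le> 1"
    using a by (auto simp: S_def op_nonneg_scaleR)
  have "inner f (block (id_blinfun - S) f) \<le> norm f * norm (block (id_blinfun - S) f)"
    by (rule norm_cauchy_schwarz)
  also have "\<dots> \<le> norm f * (1 * norm f)"
    by (intro mult_left_mono order_trans[OF norm_blinfun] mult_right_mono
        order_trans[OF norm_block_le] op_nonneg_norm_id_minus S) simp_all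
  finally have "0 \<le> inner f (block S f)"
    by (simp add: block_minus block_id blinfun.diff_left inner_diff_right dot_square_norm power2_eq_square)
  moreover have "block a = norm a *\<^sub>R block S"
    unfolding S_def block_scaleR[symmetric] by simp
  ultimately show "0 \<le> inner f (block a f)"
    by (simp add: blinfun.scaleR_left)
qed

lemma group_cstar_subset: "group_cstar H \<subseteq> group_cstar UNIV"
  by (rule group_cstar_mono) simp

lemma conditional_expectation_block:
  "conditional_expectation (group_cstar UNIV) (group_cstar H) (restrict block (group_cstar UNIV))"
  unfolding conditional_expectation_def
  using group_cstar_subset
  by (auto simp: block_group_cstar block_add block_scale block_ident block_bimodule block_nonneg
      A.positive_elements_iff B.A.positive_elements_iff B.A.mem subset_iff)

lemma canonical_trace_block: "canonical_trace (block a) = canonical_trace a"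
proof -
  have "cutoff (coset 0) (delta 0) = delta (0 :: 'g)"
    using coset_self[of 0]
    by (auto simp: fun_eq_iff cutoff.rep_eq delta.rep_eq simp flip: Rep_ell2_inject)
  then show ?thesis by (simp add: canonical_trace_def cinner_delta_left Rep_block)
qed

end

subsection \<open>Vector states are not pure\<close>

lemma cutoff_finite_approx:
  assumes "0 < e" shows "\<exists>F. finite F \<and> norm (f - cutoff F f) < e"
proof -
  have "((\<lambda>F. \<Sum>x\<in>F. cscale (Rep_ell2 f x) (delta x)) \<longlongrightarrow> f) (finite_subsets_at_top UNIV)"
    using has_sum_delta[of f] by (simp add: has_sum_def)
  from tendstoD[OF this assms]
  have "\<forall>\<^sub>F F in finite_subsets_at_top UNIV. dist (\<Sum>x\<in>F. cscale (Rep_ell2 f x) (delta x)) f < e \<and> finite F"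
    by (rule eventually_conj) (rule eventually_finite_subsets_at_top_weakI)
  then obtain F where F: "dist (\<Sum>x\<in>F. cscale (Rep_ell2 f x) (delta x)) f < e" "finite F"
    using eventually_happens'[OF finite_subsets_at_top_neq_bot] by blast
  moreover have "(\<Sum>x\<in>F. cscale (Rep_ell2 f x) (delta x)) = cutoff F f"
    using F(2) by (simp add: fun_eq_iff sum_delta_rep cutoff.rep_eq flip: Rep_ell2_inject)
  ultimately show ?thesis by (auto simp: dist_norm norm_minus_commute)
qed

text \<open>Up to a small error f has finite support F. Only finitely many group elements translate
  F to a set meeting F, and an injective sequence eventually avoids them.\<close>

lemma left_reg_mixing:
  fixes v :: "nat \<Rightarrow> 'g :: group_add"
  assumes v: "inj v" and e: "0 < e"
  shows "\<exists>K. \<forall>k\<ge>K. cmod (cinner f (left_reg (v k) f)) \<le> e"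
proof -
  \<comment> \<open>Two error terms of size d times \<open>norm f\<close> must stay below e; the
    summand 1 covers \<open>norm f = 0\<close>.\<close>
  define d where "d = e / (2 * norm f + 1)"
  have pos: "0 < 2 * norm f + 1" by (simp add: add_nonneg_pos)
  then have d: "0 < d" using e by (simp add: d_def)
  obtain F where F: "finite F" "norm (f - cutoff F f) < d"
    using cutoff_finite_approx[OF d] by blast
  define D where "D = (\<lambda>(x, y). y - x) ` (F \<times> F)"
  have "finite (v -` D)"
    using F(1) v by (intro finite_vimageI) (simp_all add: D_def)
  then obtain K where K: "\<And>k. v k \<in> D \<Longrightarrow> k < K"
    by (metis finite_nat_set_iff_bounded vimageI2)
  have "cmod (cinner f (left_reg (v k) f)) \<le> e" if k: "k \<ge> K" for k
  proof -
    let ?g = "cutoff F f" and ?L = "left_reg (v k)"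
    have "F \<inter> (+) (v k) ` F = {}"
    proof (rule ccontr)
      assume "F \<inter> (+) (v k) ` F \<noteq> {}"
      then obtain x where x: "x \<in> F" "v k + x \<in> F" by blast
      then have "v k \<in> D" unfolding D_def by (intro image_eqI[of _ _ "(x, v k + x)"]) auto
      then show False using K k by (meson leD)
    qed
    then have "cinner ?g (?L ?g) = 0"
      by (simp add: left_reg_cutoff cinner_cutoff cutoff_cutoff)
    then have "cinner f (?L f) = cinner (f - ?g) (?L f) + cinner ?g (?L (f - ?g))"
      by (simp add: cinner_minus_left cinner_minus_right blinfun.diff_right)
    also have "cmod \<dots> \<le> norm (f - ?g) * norm (?L f) + norm ?g * norm (?L (f - ?g))"
      by (intro norm_triangle_mono cinner_bound)
    also have "\<dots> \<le> d * norm f + norm f * d"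
      using F(2) norm_cutoff_le[of F f] d by (intro add_mono mult_mono) simp_all
    also have "\<dots> = d * (2 * norm f)" by (simp add: algebra_simps)
    also have "\<dots> \<le> d * (2 * norm f + 1)" using d by (intro mult_left_mono) simp_all
    also have "\<dots> = e" using pos by (simp add: d_def)
    finally show ?thesis .
  qed
  then show ?thesis by blast
qed

text \<open>The sequence \<open>u\<close> stands for the powers of an element of infinite order in
  H, and additivity makes inner products of translates depend on index differences only.\<close>

locale infinite_subgroup = add_subgroup +
  fixes u :: "nat \<Rightarrow> 'a"
  assumes u_mem: "u n \<in> H" and u_add: "u (m + n) = u m + u n" and u_inj: "inj u"
begin

text \<open>Right translations commute with \<open>A\<close> and therefore decompose the vector state of \<open>\<eta>\<close>.\<close>

lemma pure_vector_state_right_shift: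
  assumes \<phi>: "\<phi> \<in> pure_states (group_cstar H)"
    and \<eta>: "\<And>x. x \<in> group_cstar H \<Longrightarrow> \<phi> x = cinner \<eta> (x \<eta>)"
    and x: "x \<in> group_cstar H"
  shows "cinner \<eta> (x (right_shift s \<eta>)) = cinner \<eta> (right_shift s \<eta>) * \<phi> x"
proof -
  define \<rho> where "\<rho> = right_shift s \<eta>"
  have \<rho>: "cinner \<rho> (y \<rho>) = \<phi> y" if "y \<in> group_cstar H" for y
    using that by (simp add: \<rho>_def group_cstar_right_shift cinner_right_shift \<eta>)
  \<comment> \<open>Since \<rho> induces the same state as \<eta>, the functionals for c and - c add
    up to \<open>\<phi>\<close>, the cross terms cancelling; this is the decomposition to which
    purity applies.\<close>
  define \<omega> where "\<omega> c y = of_real (1/4) * cinner (\<eta> + cscale c \<rho>) (y (\<eta> + cscale c \<rho>))" for c and y :: "'a op"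
  have pf: "A.positive_functional (\<omega> c)" for c
    unfolding \<omega>_def by (intro A.positive_functional_scale A.positive_functional_vector) simp
  have \<omega>: "\<omega> c y = (2 * \<phi> y + (c * cinner \<eta> (y \<rho>) + cnj c * cinner \<rho> (y \<eta>))) / 4"
    if "y \<in> group_cstar H" "cmod c = 1" for c y
  proof -
    have "c * cnj c = 1" using that(2) by (simp add: complex_norm_square[symmetric])
    then have "cnj c * (c * z) = z" for z
      by (metis mult.assoc mult.commute mult_1)
    then show ?thesis
      using that(1) \<rho>[OF that(1)] \<eta>[OF that(1)]
      by (simp add: \<omega>_def blinfun.add_right cinner_add_left cinner_add_right cinner_cscale_left
          cinner_cscale_right bounded_opsD[OF A.bounded_opsI] algebra_simps)
  qed
  have dom: "\<omega> c x = \<omega> c id_blinfun * \<phi> x" if "cmod c = 1" for c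
  proof (rule A.pure_state_dominates[OF \<phi> pf pf[of "- c"] _ x])
    fix y assume "y \<in> group_cstar H"
    then show "\<phi> y = \<omega> c y + \<omega> (- c) y" using that by (simp add: \<omega> field_simps)
  qed
  have \<phi>1: "\<phi> id_blinfun = 1" using \<phi> by (simp add: pure_states_def states_def)
  have eq: "c * cinner \<eta> (x \<rho>) + cnj c * cinner \<rho> (x \<eta>)
      = (c * cinner \<eta> \<rho> + cnj c * cinner \<rho> \<eta>) * \<phi> x" if "cmod c = 1" for c
  proof -
    have *: "(2 * a + P) / 4 = (2 * 1 + Q) / 4 * a \<Longrightarrow> P = Q * a" for a P Q :: complex
      by (simp add: field_simps)
    show ?thesis
      by (rule *) (use dom[OF that] \<phi>1 in \<open>simp add: \<omega> x A.one that\<close>)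
  qed
  \<comment> \<open>The cases c = \<i> and c = 1 give the difference and the sum of the cross
    terms.\<close>
  have "cinner \<eta> (x \<rho>) - cinner \<rho> (x \<eta>) = (cinner \<eta> \<rho> - cinner \<rho> \<eta>) * \<phi> x"
  proof -
    have "\<i> * (cinner \<eta> (x \<rho>) - cinner \<rho> (x \<eta>)) = \<i> * ((cinner \<eta> \<rho> - cinner \<rho> \<eta>) * \<phi> x)"
      using eq[of \<i>] by (simp add: algebra_simps)
    then show ?thesis by simp
  qed
  with eq[of 1] have "cinner \<eta> (x \<rho>) = cinner \<eta> \<rho> * \<phi> x"
    by (simp add: algebra_simps) (algebra)
  then show ?thesis by (simp add: \<rho>_def)
qed

text \<open>The operators \<open>V k\<close> below fix \<open>delta p\<close>, where \<open>\<eta>\<close> does not vanish, although by purity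
  and mixing the vectors \<open>V k \<eta>\<close> are asymptotically orthogonal.\<close>

lemma vector_state_not_pure:
  assumes \<phi>: "\<phi> \<in> pure_states (group_cstar H)"
    and \<eta>: "\<And>x. x \<in> group_cstar H \<Longrightarrow> \<phi> x = cinner \<eta> (x \<eta>)"
  shows False
proof -
  have "\<phi> id_blinfun = 1" using \<phi> by (simp add: pure_states_def states_def)
  then have "cinner \<eta> \<eta> = 1" using \<eta>[OF A.one] by simp
  then have n\<eta>: "norm \<eta> = 1" by (simp add: norm_eq_cinner)
  obtain p where p: "Rep_ell2 \<eta> p \<noteq> 0"
  proof (rule ccontr)
    assume "\<not> thesis"
    then have "Rep_ell2 \<eta> = Rep_ell2 0" using that by (auto simp: fun_eq_iff zero_ell2.rep_eq)
    then show False using n\<eta> by (simp add: Rep_ell2_inject)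
  qed
  define c where "c = (cmod (Rep_ell2 \<eta> p))\<^sup>2"
  have c: "0 < c" using p by (simp add: c_def)
  obtain K where K: "\<And>k. k \<ge> K \<Longrightarrow> cmod (cinner \<eta> (left_reg (u k) \<eta>)) \<le> c / 2"
    using left_reg_mixing[OF u_inj, of "c/2" \<eta>] c by auto
  \<comment> \<open>Conjugation by p makes the two translations cancel at p, since - u k + p + s k =
    p; hence \<open>V k\<close> keeps the value of \<eta> there.\<close>
  define s where "s k = - p + u k + p" for k
  have s_add: "s (k + l) = s k + s l" for k l
    by (simp add: s_def u_add add.assoc)
  define V where "V k = left_reg (u k) (right_shift (s k) \<eta>)" for k
  have nV: "norm (V k) = 1" for k by (simp add: V_def n\<eta>)
  have RepV: "Rep_ell2 (V k) p = Rep_ell2 \<eta> p" for k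
    by (simp add: V_def Rep_left_reg right_shift.rep_eq s_def add.assoc)
  \<comment> \<open>Both translations are isometric and additive in the index, so only l matters.
    Purity then factors out the value at \<open>left_reg (u l)\<close>, which mixing makes
    small.\<close>
  have "inner (V k) (V (k + l)) \<le> c / 2" if "l \<ge> K" for k l
  proof -
    have "right_shift (s (k + l)) \<eta> = right_shift (s k) (right_shift (s l) \<eta>)"
      by (simp add: fun_eq_iff right_shift.rep_eq s_add add.assoc flip: Rep_ell2_inject)
    then have "V (k + l) = left_reg (u k) (right_shift (s k) (V l))"
      by (simp add: V_def u_add left_reg_right_shift left_reg_left_reg)
    then have "cinner (V k) (V (k + l)) = cinner \<eta> (left_reg (u l) (right_shift (s l) \<eta>))"
      by (simp add: V_def[of k] V_def[of l] cinner_left_reg cinner_right_shift)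
    also have "\<dots> = cinner \<eta> (right_shift (s l) \<eta>) * cinner \<eta> (left_reg (u l) \<eta>)"
      using pure_vector_state_right_shift[OF \<phi> \<eta> left_reg_group_cstar[OF u_mem]]
        \<eta>[OF left_reg_group_cstar[OF u_mem]] by simp
    also have "cmod \<dots> \<le> 1 * (c / 2)"
      unfolding norm_mult using cinner_bound[of \<eta> "right_shift (s l) \<eta>"] n\<eta> K[OF that]
      by (intro mult_mono) simp_all
    finally show ?thesis using complex_Re_le_cmod[of "cinner (V k) (V (k + l))"]
      by (simp add: inner_ell2_def)
  qed
  \<comment> \<open>Multiples of K are used so that distinct indices differ by at least K.\<close>
  then have inner_le: "inner (V (i * K)) (V (j * K)) \<le> c / 2 + (if i = j then 1 else 0)" for i j
  proof (induction i j rule: linorder_wlog)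
    case (le i j)
    show ?case
    proof (cases "i = j")
      case True
      then show ?thesis using c nV[of "j * K"] by (simp flip: power2_norm_eq_inner)
    next
      case False
      then obtain m where m: "j = i + Suc m" using le(1) less_imp_Suc_add[of i j] by auto
      have "inner (V (i * K)) (V (i * K + Suc m * K)) \<le> c / 2" by (rule le(2)) simp
      then show ?thesis using False m by (simp add: algebra_simps)
    qed
  next
    case (sym i j)
    then show ?case by (simp add: inner_commute eq_commute)
  qed
  \<comment> \<open>The sum of N such vectors has squared modulus N^2 c at p, but squared norm at
    most N^2 c / 2 + N; this forces N c / 2 to be at most 1.\<close>
  obtain N where N: "2 / c < real N" using reals_Archimedean2 by blast
  let ?W = "\<Sum>i<N. V (i * K)"
  have Rep_sum: "Rep_ell2 (sum g I) p = (\<Sum>i\<in>I. Rep_ell2 (g i) p)" for g :: "nat \<Rightarrow> 'a ell2" and I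
    by (induction I rule: infinite_finite_induct) (simp_all add: zero_ell2.rep_eq plus_ell2.rep_eq)
  have "cmod (Rep_ell2 ?W p) = real N * cmod (Rep_ell2 \<eta> p)"
    by (simp add: Rep_sum RepV norm_mult)
  then have "(real N)\<^sup>2 * c \<le> (norm ?W)\<^sup>2"
    using cmod_Rep_le_norm[of ?W p] by (metis c_def norm_ge_zero power_mono power_mult_distrib)
  also have "\<dots> = (\<Sum>i<N. \<Sum>j<N. inner (V (i * K)) (V (j * K)))"
    by (simp add: power2_norm_eq_inner inner_sum_left inner_sum_right)
      (subst sum.swap, rule refl)
  also have "\<dots> \<le> (\<Sum>i<N. \<Sum>j<N. c / 2 + (if i = j then 1 else 0))"
    by (intro sum_mono inner_le)
  also have "\<dots> = (real N)\<^sup>2 * (c / 2) + real N"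
    by (simp add: sum.distrib power2_eq_square algebra_simps)
  finally have "real N * (real N * (c / 2)) \<le> real N * 1"
    by (simp add: power2_eq_square algebra_simps)
  moreover have "0 < real N" using N c by (meson divide_pos_pos less_trans zero_less_numeral)
  ultimately have "real N * (c / 2) \<le> 1" by (rule mult_left_le_imp_le)
  then show False using N c by (simp add: field_simps)
qed

lemma pure_state_singular:
  assumes "\<phi> \<in> pure_states (group_cstar H)" "0 < e"
  obtains a where "a \<in> group_cstar H"
    "Re (\<phi> (adj (id_blinfun - a) o\<^sub>L (id_blinfun - a))) < e" "(norm (a (delta 0)))\<^sup>2 < e"
  using A.pure_state_vector_or_singular[OF assms(1), of "delta 0"] vector_state_not_pure[OF assms(1)]
    assms(2) by metis

end

subsection \<open>Subgroups with wandering decompositions\<close>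

context add_subgroup
begin

lemma wandering_subset: "wandering Y \<Longrightarrow> X \<subseteq> Y \<Longrightarrow> wandering X"
  unfolding wandering_def by blast

text \<open>Translation by s turns k into its conjugate by s, again a nonzero element of H.\<close>

lemma wandering_translate:
  assumes "wandering Y" "s \<in> H" shows "wandering ((+) s ` Y)"
  unfolding wandering_def
proof (intro ballI impI)
  fix k assume k: "k \<in> H" "k \<noteq> 0"
  have "- s + (k + s) \<noteq> 0"
    using k(2) by (metis add.right_neutral add_minus_cancel add_right_cancel add_0)
  moreover have "- s + (k + s) \<in> H" using k assms add_mem uminus_mem by blast
  ultimately have disj: "(+) (- s + (k + s)) ` Y \<inter> Y = {}"
    using assms(1) unfolding wandering_def by blast
  show "(+) k ` (+) s ` Y \<inter> (+) s ` Y = {}"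
  proof (rule ccontr)
    assume "(+) k ` (+) s ` Y \<inter> (+) s ` Y \<noteq> {}"
    then obtain x y where xy: "x \<in> Y" "y \<in> Y" "k + (s + x) = s + y" by auto
    then have "(- s + (k + s)) + x = y"
      by (metis add.assoc minus_add_cancel)
    then show False using disj xy(1,2) by blast
  qed
qed

end

text \<open>An abstract ping-pong condition on the position of H in the group;
  \<open>free_subgroup_wandering\<close> supplies it for free groups.\<close>

locale wandering_subgroup = infinite_subgroup +
  assumes wander: "h \<notin> H \<Longrightarrow> \<exists>Y. wandering Y \<and> wandering ((+) h ` (- Y))"
begin

text \<open>For \<open>a\<close> as in \<open>pure_state_singular\<close>, the operator \<open>a\<^sup>* (left_reg h) a\<close> is small compared to
  \<open>1 + a\<^sup>* a\<close>; no bound on the norm of \<open>a\<close> is needed.\<close>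

lemma state_extension_vanishes:
  assumes \<psi>: "\<psi> \<in> states (group_cstar UNIV)"
    and \<phi>: "restrict \<psi> (group_cstar H) \<in> pure_states (group_cstar H)"
    and h: "h \<notin> H"
  shows "\<psi> (left_reg h) = 0"
proof -
  have pf: "B.A.positive_functional \<psi>" and \<psi>1: "\<psi> id_blinfun = 1"
    using \<psi> by (auto simp: B.A.states_iff)
  have B: "x \<in> group_cstar UNIV" if "x \<in> group_cstar H" for x
    using that group_cstar_subset by blast
  obtain Y where Y: "wandering Y" "wandering ((+) h ` (- Y))"
    using wander[OF h] by blast
  let ?L = "left_reg h"
  have L: "?L \<in> group_cstar UNIV" by (simp add: left_reg_group_cstar)
  have nL: "norm ?L \<le> 1" by (rule norm_blinfun_bound) simp_all
  \<comment> \<open>With b = 1 - a, the translation L splits as b^* L + a^* L b + a^* L a, and the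
    terms contribute e, 2 e and 5 e.\<close>
  have bound: "cmod (\<psi> ?L) \<le> 8 * e" if e: "0 < e" "e \<le> 1" for e
  proof -
    obtain a where a: "a \<in> group_cstar H"
      "Re (\<psi> (adj (id_blinfun - a) o\<^sub>L (id_blinfun - a))) < e\<^sup>2" "(norm (a (delta 0)))\<^sup>2 < e\<^sup>2"
    proof (rule pure_state_singular[OF \<phi>, of "e\<^sup>2"])
      fix a assume "a \<in> group_cstar H"
        "Re (restrict \<psi> (group_cstar H) (adj (id_blinfun - a) o\<^sub>L (id_blinfun - a))) < e\<^sup>2"
        "(norm (a (delta 0)))\<^sup>2 < e\<^sup>2"
      then show thesis using that by (simp add: A.mem)
    qed (use e in simp)
    define b where "b = id_blinfun - a"
    define q where "q = Re (\<psi> (adj a o\<^sub>L a))"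
    have aB: "a \<in> group_cstar UNIV" and bB: "b \<in> group_cstar UNIV"
      using a(1) by (simp_all add: B b_def B.A.mem)
    have pb: "Re (\<psi> (adj b o\<^sub>L b)) \<le> e\<^sup>2" using a(2) by (simp add: b_def)
    have na: "norm (a (delta 0)) \<le> e"
      using a(3) e by (simp add: power2_less_imp_less less_imp_le)
    have q0: "0 \<le> q"
      using B.A.pf_square[OF pf aB] by (simp add: q_def complex_nonneg_Reals_iff)
    \<comment> \<open>Since a = 1 - b and b is small for \<psi>, this is at most (1 + e)^2. It
      replaces a bound on the norm of a.\<close>
    have q4: "q \<le> 4"
    proof -
      have "(cmod (\<psi> b))\<^sup>2 \<le> e\<^sup>2"
        using B.A.pf_Cauchy_Schwarz[OF pf B.A.one bB] pb by (simp add: \<psi>1)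
      then have "cmod (\<psi> b) \<le> e" using e by (simp add: power2_le_iff_abs_le)
      then have "- Re (\<psi> b) \<le> e" using abs_Re_le_cmod[of "\<psi> b"] by linarith
      moreover have "q = 1 - 2 * Re (\<psi> b) + Re (\<psi> (adj b o\<^sub>L b))"
        using B.A.pf_expand[OF pf B.A.one bB, of "-1"]
        by (simp add: q_def b_def \<psi>1 op_cscale_minus_one)
      moreover have "e\<^sup>2 \<le> 1" using e by (simp add: power_le_one)
      ultimately show ?thesis using pb e by simp
    qed
    have t1: "cmod (\<psi> (adj b o\<^sub>L ?L)) \<le> e"
    proof -
      have "(cmod (\<psi> (adj b o\<^sub>L ?L)))\<^sup>2 \<le> Re (\<psi> (adj b o\<^sub>L b)) * Re (\<psi> (adj ?L o\<^sub>L ?L))"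
        by (rule B.A.pf_Cauchy_Schwarz[OF pf bB L])
      also have "adj ?L o\<^sub>L ?L = id_blinfun"
        by (simp add: adj_left_reg left_reg_compose left_reg_zero)
      finally have "(cmod (\<psi> (adj b o\<^sub>L ?L)))\<^sup>2 \<le> e\<^sup>2" using pb by (simp add: \<psi>1)
      then show ?thesis using e by (simp add: power2_le_iff_abs_le)
    qed
    have t2: "cmod (\<psi> (adj a o\<^sub>L (?L o\<^sub>L b))) \<le> 2 * e"
    proof -
      have "Re (\<psi> (adj (?L o\<^sub>L b) o\<^sub>L (?L o\<^sub>L b))) \<le> (norm ?L)\<^sup>2 * Re (\<psi> (adj b o\<^sub>L b))"
        by (rule B.A.pf_compose_le[OF pf L bB])
      also have "\<dots> \<le> 1 * e\<^sup>2"
        using nL pb B.A.pf_square[OF pf bB]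
        by (intro mult_mono) (simp_all add: power_le_one complex_nonneg_Reals_iff)
      finally have *: "Re (\<psi> (adj (?L o\<^sub>L b) o\<^sub>L (?L o\<^sub>L b))) \<le> e\<^sup>2" by simp
      have "(cmod (\<psi> (adj a o\<^sub>L (?L o\<^sub>L b))))\<^sup>2 \<le> q * Re (\<psi> (adj (?L o\<^sub>L b) o\<^sub>L (?L o\<^sub>L b)))"
        unfolding q_def by (rule B.A.pf_Cauchy_Schwarz[OF pf aB]) (simp add: B.A.mem L bB)
      also have "\<dots> \<le> 4 * e\<^sup>2"
        by (rule mult_mono[OF q4 *])
          (use B.A.pf_square[OF pf B.A.compose[OF L bB]] in \<open>simp_all add: complex_nonneg_Reals_iff\<close>)
      finally have "(cmod (\<psi> (adj a o\<^sub>L (?L o\<^sub>L b))))\<^sup>2 \<le> (2 * e)\<^sup>2"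
        by (simp add: power_mult_distrib)
      then show ?thesis by (rule power2_le_imp_le) (use e in simp)
    qed
    \<comment> \<open>The wandering sets give the bound 2 e \<open>norm f\<close>
      \<open>norm (a f)\<close>, which the arithmetic-geometric mean inequality turns into the
      quadratic form of e (1 + a^* a).\<close>
    have t3: "cmod (\<psi> (adj a o\<^sub>L (?L o\<^sub>L a))) \<le> 5 * e"
    proof -
      let ?T = "e *\<^sub>R (id_blinfun + (adj a o\<^sub>L a))"
      have bo: "a \<in> bounded_ops" using aB by (rule group_cstar_bounded_ops)
      have T: "inner f (?T f) = e * ((norm f)\<^sup>2 + (norm (a f))\<^sup>2)" for f
        using bo by (simp add: blinfun.scaleR_left blinfun.add_left inner_add_right
            power2_norm_eq_inner flip: inner_adj)
      have "cmod (\<psi> (adj a o\<^sub>L (?L o\<^sub>L a))) \<le> Re (\<psi> ?T)"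
      proof (rule B.A.pf_numerical_bound[OF pf])
        show "op_nonneg ?T"
        proof (rule op_nonneg_scaleR)
          show "op_nonneg (id_blinfun + (adj a o\<^sub>L a))"
            using op_nonneg_adj_compose[OF bo]
            by (simp add: op_nonneg_def bounded_ops_add bounded_ops_id adj_add blinfun.add_left
                inner_add_right)
        qed (use e in simp)
        fix f
        have "cmod (cinner f ((adj a o\<^sub>L (?L o\<^sub>L a)) f)) = cmod (cinner (a f) (?L (a f)))"
          using bo by (simp flip: cinner_adj)
        also have "\<dots> \<le> norm (a f) * norm (cutoff Y (a f)) + norm (cutoff ((+) h ` (- Y)) (a f)) * norm (a f)"
          by (rule cinner_left_reg_wandering)
        also have "\<dots> \<le> norm (a f) * (e * norm f) + (e * norm f) * norm (a f)"
          using na Y by (intro add_mono mult_left_mono mult_right_mono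
              order_trans[OF norm_cutoff_wandering[OF a(1)]]) simp_all
        also have "\<dots> = e * (2 * norm f * norm (a f))" by simp
        also have "\<dots> \<le> e * ((norm f)\<^sup>2 + (norm (a f))\<^sup>2)"
          using e by (intro mult_left_mono sum_squares_bound) simp
        finally show "cmod (cinner f ((adj a o\<^sub>L (?L o\<^sub>L a)) f)) \<le> inner f (?T f)"
          by (simp only: T)
      qed (simp_all add: B.A.mem aB L)
      also have "\<dots> = e * (1 + q)"
        using aB by (simp add: B.A.pf_scaleR[OF pf] B.A.pf_add[OF pf] B.A.mem \<psi>1 q_def)
      also have "\<dots> \<le> e * 5" using q4 e by (intro mult_left_mono) simp_all
      finally show ?thesis by simp
    qed
    have bo: "b \<in> bounded_ops" "a \<in> bounded_ops"
      using aB bB by (simp_all add: group_cstar_bounded_ops)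
    have "id_blinfun = adj b + adj a"
      using adj_add[OF bo] by (simp add: b_def)
    then have "?L = (adj b + adj a) o\<^sub>L ?L" by (metis blinfun_compose_id_left)
    also have "\<dots> = (adj b o\<^sub>L ?L) + ((adj a o\<^sub>L (?L o\<^sub>L b)) + (adj a o\<^sub>L (?L o\<^sub>L a)))"
      by (simp add: blinfun_compose_add_left b_def flip: blinfun_compose_add_right)
    finally have "?L = (adj b o\<^sub>L ?L) + ((adj a o\<^sub>L (?L o\<^sub>L b)) + (adj a o\<^sub>L (?L o\<^sub>L a)))" .
    then have "\<psi> ?L = \<psi> (adj b o\<^sub>L ?L) + (\<psi> (adj a o\<^sub>L (?L o\<^sub>L b)) + \<psi> (adj a o\<^sub>L (?L o\<^sub>L a)))"
      using aB bB L by (metis (no_types, lifting) B.A.pf_add[OF pf] B.A.add B.A.compose B.A.adj_closed)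
    also have "cmod \<dots> \<le> e + (2 * e + 5 * e)"
      by (intro norm_triangle_mono t1 t2 t3)
    finally show ?thesis by simp
  qed
  have "cmod (\<psi> ?L) \<le> 0"
  proof (rule field_le_epsilon)
    fix e :: real assume "0 < e"
    then have "cmod (\<psi> ?L) \<le> 8 * min 1 (e / 8)" by (intro bound) simp_all
    also have "\<dots> \<le> 0 + e" by simp
    finally show "cmod (\<psi> ?L) \<le> 0 + e" .
  qed
  then show ?thesis by simp
qed

text \<open>Composition with \<open>block\<close> gives one extension. Any other state extension
  agrees with it on translations by H and, like it, vanishes on the others, so density gives
  equality.\<close>

lemma pure_state_unique_extension_group:
  assumes \<phi>: "\<phi> \<in> pure_states (group_cstar H)"
  shows "\<exists>!\<psi>. \<psi> \<in> pure_states (group_cstar UNIV) \<and> restrict \<psi> (group_cstar H) = \<phi>"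
proof -
  define \<psi> where "\<psi> = restrict (\<lambda>a. \<phi> (block a)) (group_cstar UNIV)"
  have \<phi>s: "\<phi> \<in> states (group_cstar H)" using \<phi> by (simp add: pure_states_def)
  have \<psi>: "\<psi> \<in> states (group_cstar UNIV)"
    using \<phi>s by (auto simp: states_def \<psi>_def block_add block_scale block_id block_group_cstar
        block_nonneg B.A.mem A.positive_elements_iff B.A.positive_elements_iff)
  have res: "restrict \<psi> (group_cstar H) = \<phi>"
  proof
    fix x show "restrict \<psi> (group_cstar H) x = \<phi> x"
      using \<phi>s group_cstar_subset
      by (auto simp: \<psi>_def states_def block_ident extensional_def restrict_def)
  qed
  show ?thesis
  proof (rule B.A.pure_state_unique_extension[OF A.unital_cstar_axioms group_cstar_subset \<phi> \<psi> res])
    fix \<psi>' assume \<psi>': "\<psi>' \<in> states (group_cstar UNIV)" "restrict \<psi>' (group_cstar H) = \<phi>"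
    have pf: "B.A.positive_functional \<psi>" "B.A.positive_functional \<psi>'"
      using \<psi> \<psi>' by (auto simp: B.A.states_iff)
    have "\<psi>' a = \<psi> a" if a: "a \<in> group_cstar UNIV" for a
    proof -
      have "cmod (\<psi>' a - \<psi> a) \<le> 0"
        using a
      proof (rule group_cstar_vanish)
        fix g :: 'a
        show "cmod (\<psi>' (left_reg g) - \<psi> (left_reg g)) \<le> 0"
        proof (cases "g \<in> H")
          case True
          then have "\<psi>' (left_reg g) = \<phi> (left_reg g)" "\<psi> (left_reg g) = \<phi> (left_reg g)"
            using \<psi>'(2) res left_reg_group_cstar[OF True] by (metis restrict_apply')+
          then show ?thesis by simp
        next
          case False
          then show ?thesis
            using state_extension_vanishes[OF \<psi>'(1)] state_extension_vanishes[OF \<psi>] \<psi>'(2) res \<phi>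
            by simp
        qed
      next
        fix a b :: "'a op" and c
        assume a: "a \<in> group_cstar UNIV"
        show "cmod (\<psi>' (op_cscale c a) - \<psi> (op_cscale c a)) \<le> cmod c * cmod (\<psi>' a - \<psi> a)"
          using a by (simp add: B.A.pf_scale[OF pf(1)] B.A.pf_scale[OF pf(2)]
              flip: right_diff_distrib norm_mult)
        show "cmod (\<psi>' a - \<psi> a) \<le> 2 * norm a"
          using norm_triangle_le_diff[OF add_mono[OF B.A.pf_norm_le[OF pf(2) a] B.A.pf_norm_le[OF pf(1) a]]]
            \<psi> \<psi>' by (simp add: states_def)
        assume b: "b \<in> group_cstar UNIV"
        show "cmod (\<psi>' (a + b) - \<psi> (a + b)) \<le> cmod (\<psi>' a - \<psi> a) + cmod (\<psi>' b - \<psi> b)"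
          using a b by (simp add: B.A.pf_add[OF pf(1)] B.A.pf_add[OF pf(2)])
            (metis add_diff_add norm_triangle_ineq)
      qed
      then show ?thesis by simp
    qed
    then show "\<psi>' = \<psi>"
      using \<psi> \<psi>' by (intro extensionalityI[of _ "group_cstar UNIV"]) (auto simp: states_def)
  qed
qed

text \<open>For wandering X the sets u i + X are disjoint, so Cauchy-Schwarz bounds the sum of N
  restricted norms by sqrt N times the full norm. Growth slower than N makes the averages tend to
  0.\<close>

lemma norm_average_le:
  assumes h: "h \<notin> H"
  shows "norm (\<Sum>i<N. left_reg (u i) o\<^sub>L left_reg h o\<^sub>L left_reg (- u i)) \<le> 2 * sqrt (real N)"
    (is "norm ?S \<le> _")
proof (rule norm_blinfun_bound)
  obtain Y where Y: "wandering Y" "wandering ((+) h ` (- Y))"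
    using wander[OF h] by blast
  have sum_le: "(\<Sum>i<N. norm (cutoff X (left_reg (- u i) f))) \<le> sqrt (real N) * norm f"
    if X: "wandering X" for X f
  proof -
    have *: "norm (cutoff X (left_reg (- u i) f)) = norm (cutoff ((+) (u i) ` X) f)" for i
      using norm_left_reg_apply[of "u i" "cutoff X (left_reg (- u i) f)"]
      by (simp add: left_reg_cutoff left_reg_left_reg left_reg_zero del: norm_left_reg_apply)
    have disj: "(+) (u i) ` X \<inter> (+) (u j) ` X = {}" if "i \<noteq> j" for i j
    proof (rule ccontr)
      assume "(+) (u i) ` X \<inter> (+) (u j) ` X \<noteq> {}"
      then obtain x y where xy: "x \<in> X" "y \<in> X" "u i + x = u j + y" by auto
      then have "(- u j + u i) + x = y" by (metis add.assoc minus_add_cancel)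
      moreover have "- u j + u i \<noteq> 0"
        using that u_inj by (metis add_minus_cancel add.right_neutral injD)
      moreover have "- u j + u i \<in> H" by (simp add: add_mem uminus_mem u_mem)
      ultimately show False using X xy unfolding wandering_def by blast
    qed
    have "(\<Sum>i<N. norm (cutoff ((+) (u i) ` X) f))\<^sup>2
        \<le> (\<Sum>i<N. (norm (cutoff ((+) (u i) ` X) f))\<^sup>2) * real (card {..<N})"
      by (rule sum_squared_le_sum_of_squares)
    also have "\<dots> \<le> (norm f)\<^sup>2 * real N"
      unfolding card_lessThan by (intro mult_right_mono sum_norm_cutoff_le disj) simp_all
    also have "\<dots> = (sqrt (real N) * norm f)\<^sup>2" by (simp add: power_mult_distrib)
    finally show ?thesis unfolding * by (rule power2_le_imp_le) simp
  qed
  fix f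
  \<comment> \<open>The sum is tested against its own value, so that one factor of
    \<open>norm G\<close> cancels at the end.\<close>
  define G where "G = ?S f"
  let ?g = G
  let ?f = "\<lambda>i. left_reg (- u i) f" and ?g' = "\<lambda>i. left_reg (- u i) ?g"
  have "G = (\<Sum>i<N. left_reg (u i) (left_reg h (?f i)))"
    by (simp add: G_def blinfun.sum_left)
  then have "cinner ?g ?g = cinner ?g (\<Sum>i<N. left_reg (u i) (left_reg h (?f i)))"
    by (rule arg_cong)
  also have "\<dots> = (\<Sum>i<N. cinner ?g (left_reg (u i) (left_reg h (?f i))))"
    by (rule bounded_bilinear.sum_right[OF bounded_bilinear_cinner])
  also have "\<dots> = (\<Sum>i<N. cinner (?g' i) (left_reg h (?f i)))"
    by (intro sum.cong refl) (simp add: cinner_adj_left[OF left_reg_bounded_ops] flip: adj_left_reg)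
  finally have "cmod (cinner ?g ?g) \<le> (\<Sum>i<N. cmod (cinner (?g' i) (left_reg h (?f i))))"
    using norm_sum[of "\<lambda>i. cinner (?g' i) (left_reg h (?f i))" "{..<N}"] by (simp only:)
  then have "(norm ?g)\<^sup>2 \<le> (\<Sum>i<N. cmod (cinner (?g' i) (left_reg h (?f i))))"
    by (simp add: cinner_self_norm norm_power)
  also have "\<dots> \<le> (\<Sum>i<N. norm ?g * norm (cutoff Y (?f i)) + norm (cutoff ((+) h ` (- Y)) (?g' i)) * norm f)"
    using cinner_left_reg_wandering[of "?g' i" h "?f i" Y for i] by (intro sum_mono) simp
  also have "\<dots> = norm ?g * (\<Sum>i<N. norm (cutoff Y (?f i))) + (\<Sum>i<N. norm (cutoff ((+) h ` (- Y)) (?g' i))) * norm f"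
    by (simp add: sum.distrib sum_distrib_left sum_distrib_right)
  also have "\<dots> \<le> norm ?g * (sqrt (real N) * norm f) + (sqrt (real N) * norm ?g) * norm f"
    by (intro add_mono mult_left_mono mult_right_mono sum_le Y) simp_all
  finally have "norm ?g * norm ?g \<le> norm ?g * (2 * sqrt (real N) * norm f)"
    by (simp add: power2_eq_square mult_ac)
  then show "norm (?S f) \<le> 2 * sqrt (real N) * norm f"
    unfolding G_def[symmetric] by (cases "norm G = 0") (simp_all add: mult_le_cancel_left)
qed simp

lemma conditional_expectation_trace:
  assumes E: "conditional_expectation (group_cstar UNIV) (group_cstar H) E"
    and x: "x \<in> group_cstar UNIV"
  shows "canonical_trace (E x) = canonical_trace x"
proof -
  define \<psi> where "\<psi> x = canonical_trace (E x)" for x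
  have EH: "E x \<in> group_cstar H" if "x \<in> group_cstar UNIV" for x
    using E that by (auto simp: conditional_expectation_def)
  have Eb: "E b = b" if "b \<in> group_cstar H" for b
    using E that by (auto simp: conditional_expectation_def)
  have pf: "B.A.positive_functional \<psi>"
    using E unfolding B.A.positive_functional_def conditional_expectation_def
    by (auto simp: \<psi>_def canonical_trace_def blinfun.add_left cinner_add_right op_cscale_apply
        cinner_cscale_right A.positive_elements_iff intro!: op_nonneg_cinner)
  have \<psi>1: "\<psi> id_blinfun = 1"
    by (simp add: \<psi>_def Eb[OF A.one] canonical_trace_def cinner_delta_left delta.rep_eq)
  \<comment> \<open>The bimodule property moves the conjugation outside E. Since \<open>E y\<close>
    commutes with right translations, its diagonal entry at - k equals that at 0.\<close>
  have central: "\<psi> (left_reg k o\<^sub>L y o\<^sub>L left_reg (- k)) = \<psi> y"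
    if k: "k \<in> H" and y: "y \<in> group_cstar UNIV" for k y
  proof -
    have "E (left_reg k o\<^sub>L y o\<^sub>L left_reg (- k)) = left_reg k o\<^sub>L E y o\<^sub>L left_reg (- k)"
      using E left_reg_group_cstar[OF k] left_reg_group_cstar[OF uminus_mem[OF k]] y
      unfolding conditional_expectation_def by blast
    then have "\<psi> (left_reg k o\<^sub>L y o\<^sub>L left_reg (- k)) = cinner (delta 0) (left_reg k (E y (delta (- k))))"
      by (simp add: \<psi>_def canonical_trace_def left_reg_delta)
    also have "\<dots> = cinner (delta (- k)) (E y (delta (- k)))"
      using cinner_left_reg[of k "delta (- k)"] by (simp add: left_reg_delta)
    also have "\<dots> = cinner (right_shift k (delta 0)) (right_shift k (E y (delta 0)))"
      by (simp add: group_cstar_delta[OF EH[OF y], of "- k"] right_shift_delta)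
    also have "\<dots> = \<psi> y" by (simp add: cinner_right_shift \<psi>_def canonical_trace_def)
    finally show ?thesis .
  qed
  have vanish: "\<psi> (left_reg h) = 0" if h: "h \<notin> H" for h
  proof -
    have L: "left_reg g \<in> group_cstar UNIV" for g :: 'a by (simp add: left_reg_group_cstar)
    have bound: "real N * cmod (\<psi> (left_reg h)) \<le> 2 * sqrt (real N)" for N
    proof -
      have mem: "(\<Sum>i<n. left_reg (u i) o\<^sub>L left_reg h o\<^sub>L left_reg (- u i)) \<in> group_cstar UNIV" for n
        by (induction n) (simp_all add: B.A.mem L)
      have "\<psi> (\<Sum>i<n. left_reg (u i) o\<^sub>L left_reg h o\<^sub>L left_reg (- u i)) = of_nat n * \<psi> (left_reg h)" for n
      proof (induction n)
        case 0
        then show ?case using B.A.pf_scaleR[OF pf B.A.zero, of 0] by simp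
      next
        case (Suc n)
        then show ?case
          using mem[of n] by (simp add: B.A.pf_add[OF pf] B.A.mem L central u_mem algebra_simps)
      qed
      then have "cmod (of_nat N * \<psi> (left_reg h))
          \<le> norm (\<Sum>i<N. left_reg (u i) o\<^sub>L left_reg h o\<^sub>L left_reg (- u i))"
        using B.A.pf_norm_le[OF pf mem[of N]] by (simp add: \<psi>1)
      then show ?thesis using norm_average_le[OF h, of N] by (simp add: norm_mult)
    qed
    show ?thesis
    proof (rule ccontr)
      assume "\<psi> (left_reg h) \<noteq> 0"
      then have c: "0 < cmod (\<psi> (left_reg h))" by simp
      \<comment> \<open>Invariance and the averaging bound give N^2 times the squared modulus at
        most 4 N, which fails for this N.\<close>
      obtain N where N: "4 / (cmod (\<psi> (left_reg h)))\<^sup>2 < real N" using reals_Archimedean2 by blast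
      have N0: "0 < real N" using N c by (meson divide_pos_pos less_trans zero_less_numeral zero_less_power)
      have "(real N * cmod (\<psi> (left_reg h)))\<^sup>2 \<le> (2 * sqrt (real N))\<^sup>2"
        by (intro power_mono bound) simp
      also have "\<dots> = real N * 4" by (simp add: power_mult_distrib)
      finally have "real N * (real N * (cmod (\<psi> (left_reg h)))\<^sup>2) \<le> real N * 4"
        by (simp add: power_mult_distrib power2_eq_square mult_ac)
      then have "real N * (cmod (\<psi> (left_reg h)))\<^sup>2 \<le> 4"
        using N0 by (rule mult_left_le_imp_le)
      then show False using N c by (simp add: field_simps)
    qed
  qed
  have "cmod (\<psi> x - canonical_trace x) \<le> 0"
    using x
  proof (rule group_cstar_vanish)
    fix g :: 'a
    show "cmod (\<psi> (left_reg g) - canonical_trace (left_reg g)) \<le> 0"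
    proof (cases "g \<in> H")
      case True
      then show ?thesis by (simp add: \<psi>_def Eb left_reg_group_cstar)
    next
      case False
      then have "g \<noteq> 0" using zero_mem by auto
      then show ?thesis
        using vanish[OF False] by (simp add: canonical_trace_def left_reg_delta cinner_delta_left delta.rep_eq)
    qed
  next
    fix a b :: "'a op" and c
    have tr: "cmod (canonical_trace a) \<le> norm a"
    proof -
      have "norm (delta (0 :: 'a)) = 1"
        by (simp add: norm_eq_cinner cinner_delta_left delta.rep_eq)
      then show ?thesis
        using cinner_bound[of "delta 0" "a (delta 0)"] norm_blinfun[of a "delta 0"]
        by (simp add: canonical_trace_def)
    qed
    assume a: "a \<in> group_cstar UNIV"
    show "cmod (\<psi> (op_cscale c a) - canonical_trace (op_cscale c a)) \<le> cmod c * cmod (\<psi> a - canonical_trace a)"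
      using a by (simp add: B.A.pf_scale[OF pf] canonical_trace_def op_cscale_apply cinner_cscale_right
              flip: right_diff_distrib norm_mult)
    show "cmod (\<psi> a - canonical_trace a) \<le> 2 * norm a"
      using norm_triangle_le_diff[OF add_mono[OF B.A.pf_norm_le[OF pf a] tr]] by (simp add: \<psi>1)
    assume b: "b \<in> group_cstar UNIV"
    have "canonical_trace (a + b) = canonical_trace a + canonical_trace b"
      by (simp add: canonical_trace_def blinfun.add_left cinner_add_right)
    then show "cmod (\<psi> (a + b) - canonical_trace (a + b))
        \<le> cmod (\<psi> a - canonical_trace a) + cmod (\<psi> b - canonical_trace b)"
      using a b by (simp add: B.A.pf_add[OF pf])
        (metis add_diff_add norm_triangle_ineq)
  qed
  then show ?thesis by (simp add: \<psi>_def)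
qed

text \<open>The bimodule property and preservation of the trace determine the trace of b E(x) for
  every b in the subalgebra. Testing with the adjoint of the difference y kills
  \<open>y (delta 0)\<close>, and then every row of y by right translation: the trace is
  faithful.\<close>

lemma conditional_expectation_eq_block:
  assumes E: "conditional_expectation (group_cstar UNIV) (group_cstar H) E"
  shows "E = restrict block (group_cstar UNIV)"
proof (rule extensionalityI)
  show "E \<in> extensional (group_cstar UNIV)"
    using E by (auto simp: conditional_expectation_def PiE_def)
  fix x :: "'a op" assume x: "x \<in> group_cstar UNIV"
  have tr: "canonical_trace (b o\<^sub>L E' x) = canonical_trace (b o\<^sub>L x)"
    if "conditional_expectation (group_cstar UNIV) (group_cstar H) E'" "b \<in> group_cstar H" for E' b
  proof -
    have "E' (b o\<^sub>L x o\<^sub>L id_blinfun) = b o\<^sub>L E' x o\<^sub>L id_blinfun"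
      using that x A.one unfolding conditional_expectation_def by blast
    moreover have "b o\<^sub>L x \<in> group_cstar UNIV"
      using that(2) x group_cstar_subset by (blast intro: B.A.compose)
    ultimately show ?thesis using conditional_expectation_trace[OF that(1), of "b o\<^sub>L x"] by simp
  qed
  define y where "y = E x - block x"
  have Ex: "E x \<in> group_cstar H" using E x by (auto simp: conditional_expectation_def)
  have y: "y \<in> group_cstar H" using Ex x by (simp add: y_def A.mem block_group_cstar)
  have "canonical_trace (adj y o\<^sub>L E x) = canonical_trace (adj y o\<^sub>L block x)"
    using tr[OF E A.adj_closed[OF y]] tr[OF conditional_expectation_block A.adj_closed[OF y]] x by simp
  then have "canonical_trace (adj y o\<^sub>L y) = 0"
    by (simp add: y_def canonical_trace_def blinfun_compose_diff_right blinfun.diff_left cinner_minus_right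
        blinfun.diff_right)
  then have "cinner (y (delta 0)) (y (delta 0)) = 0"
    using y by (simp add: canonical_trace_def cinner_adj A.bounded_opsI)
  then have y0: "y (delta 0) = 0" by (simp add: cinner_self_norm)
  have "Rep_ell2 (y f) z = 0" for f z
  proof -
    have "norm (adj y (delta z)) = 0"
      by (subst group_cstar_delta[OF A.adj_closed[OF y]]) (simp add: norm_adj_delta[OF y] y0)
    then have "cinner (adj y (delta z)) f = 0" using cinner_bound[of "adj y (delta z)" f] by simp
    then show ?thesis using y by (simp add: cinner_adj_left A.bounded_opsI cinner_delta_left)
  qed
  then have "y = 0" by (intro blinfun_eqI) (simp add: fun_eq_iff zero_ell2.rep_eq flip: Rep_ell2_inject)
  then show "E x = restrict block (group_cstar UNIV) x" using x by (simp add: y_def)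
qed simp

end

subsection \<open>Free groups\<close>

lemma mult_red_append: "reduced (v @ w) \<Longrightarrow> mult_red v w = v @ w"
proof (induction v)
  case (Cons x v)
  then have "mult_red v w = v @ w" by (auto dest: reduced_tl)
  then show ?case using Cons.prems by (cases "v @ w") (auto simp: mult_red_def)
qed (simp add: mult_red_def)

lemma reduced_append:
  "reduced (v @ w) \<longleftrightarrow> reduced v \<and> reduced w \<and>
    (v \<noteq> [] \<longrightarrow> w \<noteq> [] \<longrightarrow> hd w \<noteq> inv_letter (last v))"
proof (induction v rule: reduced.induct)
  case (2 x)
  then show ?case by (cases w) auto
qed auto

lemma set_mult_red: "set (mult_red v w) \<subseteq> set v \<union> set w"
proof -
  have "set (cons_red x w) \<subseteq> insert x (set w)" for x :: "'r letter" and w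
    by (cases w) auto
  then show ?thesis unfolding mult_red_def by (induction v) fastforce+
qed

lemma reduced_Rep: "reduced (Rep_free_group g)"
  using Rep_free_group by auto

lemma Rep_Abs: "reduced w \<Longrightarrow> Rep_free_group (Abs_free_group w) = w"
  by (simp add: Abs_free_group_inverse)

lemma Rep_plus_append:
  "reduced (Rep_free_group g @ Rep_free_group h) \<Longrightarrow>
    Rep_free_group (g + h) = Rep_free_group g @ Rep_free_group h"
  by (simp add: plus_free_group.rep_eq mult_red_append)

text \<open>This is the subgroup generated by the generators indexed by S; reduced words make
  membership a condition on letters.\<close>

definition free_subgroup :: "'r set \<Rightarrow> 'r free_group set" where
  "free_subgroup S = {g. fst ` set (Rep_free_group g) \<subseteq> S}"

definition gen_power :: "'r \<Rightarrow> nat \<Rightarrow> 'r free_group" where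
  "gen_power r n = Abs_free_group (replicate n (r, True))"

lemma reduced_replicate: "reduced (replicate n (r, True))"
proof (induction n)
  case (Suc n)
  then show ?case by (cases n) (auto simp: inv_letter_def)
qed simp

lemma Rep_gen_power: "Rep_free_group (gen_power r n) = replicate n (r, True)"
  by (simp add: gen_power_def Rep_Abs reduced_replicate)

lemma add_subgroup_free_subgroup: "add_subgroup (free_subgroup S)"
proof
  show "0 \<in> free_subgroup S" by (simp add: free_subgroup_def zero_free_group.rep_eq)
  fix g h
  assume g: "g \<in> free_subgroup S"
  show "- g \<in> free_subgroup S"
    using g by (auto simp: free_subgroup_def uminus_free_group.rep_eq inv_red_def inv_letter_def)
  assume "h \<in> free_subgroup S"
  with g show "g + h \<in> free_subgroup S"
    using image_mono[OF set_mult_red[of "Rep_free_group g" "Rep_free_group h"], of fst]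
    by (simp add: free_subgroup_def plus_free_group.rep_eq image_Un) blast
qed

text \<open>The words that start with a letter outside \<open>S\<close> wander under \<open>free_subgroup S\<close>. If \<open>g\<close>
  starts and ends with such letters, then \<open>g\<close> moves the complement of this set into it.\<close>

lemma free_subgroup_wandering:
  assumes h: "h \<notin> free_subgroup S"
  shows "\<exists>Y. add_subgroup.wandering (free_subgroup S) Y \<and>
    add_subgroup.wandering (free_subgroup S) ((+) h ` (- Y))"
proof -
  interpret add_subgroup "free_subgroup S" by (rule add_subgroup_free_subgroup)
  define X where "X = {v. Rep_free_group v \<noteq> [] \<and> fst (hd (Rep_free_group v)) \<notin> S}"
  have fst_inv: "fst (inv_letter x) = fst x" for x :: "'a letter" by (simp add: inv_letter_def)
  have X: "wandering X"
    unfolding wandering_def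
  proof (intro ballI impI, rule ccontr)
    fix k assume k: "k \<in> free_subgroup S" "k \<noteq> 0" "(+) k ` X \<inter> X \<noteq> {}"
    then obtain v where v: "v \<in> X" "k + v \<in> X" by blast
    have k0: "Rep_free_group k \<noteq> []"
      using k(2) by (simp add: zero_free_group.rep_eq flip: Rep_free_group_inject)
    then have kS: "fst (last (Rep_free_group k)) \<in> S" "fst (hd (Rep_free_group k)) \<in> S"
      using k(1) by (auto simp: free_subgroup_def)
    \<comment> \<open>No cancellation occurs at the junction: the last letter of k is indexed in S,
      the first letter of v is not.\<close>
    have "Rep_free_group (k + v) = Rep_free_group k @ Rep_free_group v"
      using kS v(1) by (intro Rep_plus_append) (auto simp: reduced_append reduced_Rep X_def fst_inv)
    then show False using v(2) kS k0 by (simp add: X_def)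
  qed
  let ?P = "\<lambda>x. fst x \<notin> S"
  let ?w = "Rep_free_group h"
  have "\<exists>x\<in>set ?w. ?P x" using h by (auto simp: free_subgroup_def)
  \<comment> \<open>Cutting at the first and last letters outside S, which may coincide, writes the
    word as p c q with p and q over S.\<close>
  then obtain p x zs where w1: "?w = p @ x # zs" "?P x" "\<forall>y\<in>set p. \<not> ?P y"
    using split_list_first_prop[of ?w ?P] by blast
  obtain m y q where w2: "x # zs = m @ y # q" "?P y" "\<forall>z\<in>set q. \<not> ?P z"
    using split_list_last_prop[of "x # zs" ?P] w1(2) by auto
  define c where "c = m @ [y]"
  have last_c: "last c = y" by (simp add: c_def)
  have hd_c: "hd c = x" using w2(1) by (cases m) (auto simp: c_def)
  have w: "?w = p @ c @ q" using w1(1) w2(1) by (simp add: c_def)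
  have "reduced (p @ c @ q)" using reduced_Rep[of h] by (simp add: w)
  then have red: "reduced p" "reduced c" "reduced q" "reduced (c @ q)"
    by (simp_all add: reduced_append)
  define s g t where "s = Abs_free_group p" and "g = Abs_free_group c" and "t = Abs_free_group q"
  have Rep: "Rep_free_group s = p" "Rep_free_group g = c" "Rep_free_group t = q"
    using red by (simp_all add: s_def g_def t_def Rep_Abs)
  have "Rep_free_group (g + t) = c @ q" using red Rep by (simp add: Rep_plus_append)
  then have "Rep_free_group (s + (g + t)) = ?w"
    using reduced_Rep[of h] by (simp add: Rep_plus_append Rep w)
  then have h_eq: "h = s + (g + t)" by (simp add: Rep_free_group_inject)
  have st: "s \<in> free_subgroup S" "t \<in> free_subgroup S"
    using w1(3) w2(3) by (auto simp: free_subgroup_def Rep)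
  \<comment> \<open>Such a v is empty or starts with a letter indexed in S, so it cannot cancel the
    last letter of g; the sum still starts with x.\<close>
  have gX: "g + v \<in> X" if "v \<notin> X" for v
  proof -
    have "Rep_free_group (g + v) = c @ Rep_free_group v"
    proof (subst Rep_plus_append)
      show "reduced (Rep_free_group g @ Rep_free_group v)"
        using that w2(2) red(2) last_c by (auto simp: reduced_append reduced_Rep X_def Rep fst_inv)
    qed (simp add: Rep)
    moreover have "c \<noteq> []" by (simp add: c_def)
    ultimately show ?thesis using hd_c w1(2) by (simp add: X_def)
  qed
  \<comment> \<open>With h = s + g + t, the part t maps the complement of \<open>?Y\<close> onto the
    complement of X, g maps that into X, and s yields a translate of X.\<close>
  let ?Y = "(+) (- t) ` X"
  have "wandering ?Y" using X st uminus_mem by (intro wandering_translate) auto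
  moreover have "(+) h ` (- ?Y) \<subseteq> (+) s ` X"
  proof (intro image_subsetI)
    fix y assume "y \<in> - ?Y"
    then have "t + y \<notin> X" using image_eqI[of y "(+) (- t)" "t + y" X] by (auto simp: add.assoc[symmetric])
    then have "g + (t + y) \<in> X" by (rule gX)
    then show "h + y \<in> (+) s ` X" by (simp add: h_eq add.assoc)
  qed
  then have "wandering ((+) h ` (- ?Y))"
    using wandering_subset[OF wandering_translate[OF X st(1)]] by blast
  ultimately show ?thesis by blast
qed

lemma wandering_free_subgroup:
  assumes "r \<in> S" shows "wandering_subgroup (free_subgroup S) (gen_power r)"
proof -
  interpret add_subgroup "free_subgroup S" by (rule add_subgroup_free_subgroup)
  show ?thesis
  proof
    fix m n
    show "gen_power r n \<in> free_subgroup S"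
      using assms by (auto simp: free_subgroup_def Rep_gen_power)
    have "Rep_free_group (gen_power r m + gen_power r n) = Rep_free_group (gen_power r (m + n))"
      by (simp add: Rep_plus_append Rep_gen_power reduced_replicate flip: replicate_add)
    then show "gen_power r (m + n) = gen_power r m + gen_power r n"
      by (simp add: Rep_free_group_inject)
    show "inj (gen_power r)"
      by (rule injI) (metis Rep_gen_power length_replicate)
  qed (rule free_subgroup_wandering)
qed

section \<open>Generated algebras as closures of group algebras\<close>

lemma cstar_generated_group_cstar:
  assumes "add_subgroup H" "X \<subseteq> left_reg ` H"
    and gen: "\<And>C. cstar_subalgebra C \<Longrightarrow> X \<subseteq> C \<Longrightarrow> left_reg ` H \<subseteq> C"
  shows "cstar_generated X = group_cstar H"
proof -
  interpret add_subgroup H by fact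
  have "X \<subseteq> group_cstar H" using assms(2) left_reg_group_cstar by blast
  then have "cstar_generated X \<subseteq> group_cstar H"
    using A.cstar unfolding cstar_generated_def by blast
  moreover have "group_cstar H \<subseteq> C" if C: "cstar_subalgebra C" "X \<subseteq> C" for C
  proof -
    have "x \<in> C" if "x \<in> group_algebra H" for x
      using that
    proof induction
      case (step x g c)
      then have "left_reg g \<in> C" using gen[OF C] by blast
      then show ?case using step.IH C(1) unfolding cstar_subalgebra_def by blast
    qed (use C in \<open>simp add: cstar_subalgebra_def\<close>)
    then show ?thesis
      unfolding group_cstar_def using C(1) by (intro closure_minimal) (auto simp: cstar_subalgebra_def)
  qed
  ultimately show ?thesis unfolding cstar_generated_def by blast
qed

lemma reduced_cstar_eq: "reduced_cstar = group_cstar UNIV"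
  unfolding reduced_cstar_def by (rule cstar_generated_group_cstar[OF add_subgroup_UNIV]) auto

text \<open>A \<open>cstar_subalgebra\<close> need not contain the identity; here it arises as the
  adjoint of the unitary of index r times that unitary. All other translations follow by induction
  on reduced words.\<close>

lemma free_cstar_sub_eq:
  assumes "r \<in> S" shows "free_cstar_sub S = group_cstar (free_subgroup S)"
  unfolding free_cstar_sub_def
proof (rule cstar_generated_group_cstar[OF add_subgroup_free_subgroup])
  show "(\<lambda>s. left_reg (free_gen s)) ` S \<subseteq> left_reg ` free_subgroup S"
    by (auto simp: free_subgroup_def free_gen.rep_eq)
  fix C :: "'a free_group op set"
  assume C: "cstar_subalgebra C" "(\<lambda>s. left_reg (free_gen s)) ` S \<subseteq> C"
  have compose: "left_reg (g + h) \<in> C" if "left_reg g \<in> C" "left_reg h \<in> C" for g h :: "'a free_group"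
    using that C(1) unfolding cstar_subalgebra_def left_reg_compose[symmetric] by blast
  have inv: "left_reg (- g) \<in> C" if "left_reg g \<in> C" for g :: "'a free_group"
    using that C(1) unfolding cstar_subalgebra_def adj_left_reg[symmetric] by blast
  have gen: "left_reg (free_gen s) \<in> C" if "s \<in> S" for s using C(2) that by blast
  have zero: "left_reg (0 :: 'a free_group) \<in> C"
    using compose[OF inv[OF gen[OF assms]] gen[OF assms]] by simp
  have "left_reg (Abs_free_group w) \<in> C" if "reduced w" "fst ` set w \<subseteq> S" for w
    using that
  proof (induction w)
    case Nil
    then show ?case using zero by (simp add: zero_free_group_def)
  next
    case (Cons x w)
    have w: "reduced w" using Cons.prems(1) by (rule reduced_tl)
    define l where "l = (if snd x then free_gen (fst x) else - free_gen (fst x))"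
    have Rep_l: "Rep_free_group l = [x]"
      by (cases x) (auto simp: l_def free_gen.rep_eq uminus_free_group.rep_eq inv_red_def inv_letter_def)
    have "left_reg l \<in> C" using Cons.prems(2) gen inv by (auto simp: l_def)
    moreover have "Rep_free_group (l + Abs_free_group w) = x # w"
      using Cons.prems(1) w by (simp add: Rep_plus_append Rep_l Rep_Abs)
    then have "l + Abs_free_group w = Abs_free_group (x # w)"
      using Cons.prems(1) by (metis Rep_Abs Rep_free_group_inject)
    ultimately show ?case using compose Cons.IH w Cons.prems(2) by fastforce
  qed
  from this[OF reduced_Rep] show "left_reg ` free_subgroup S \<subseteq> C"
    by (auto simp: free_subgroup_def Rep_free_group_inverse)
qed

theorem theorem0p6:
  fixes r0 :: 'r and S :: "'r set"
  assumes "\<exists>x y :: 'r. x \<noteq> y"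
    and "r0 \<in> S"
  shows "(\<forall>\<phi>\<in>pure_states (free_cstar_sub S).
            \<exists>!\<psi>. \<psi> \<in> pure_states reduced_cstar \<and> restrict \<psi> (free_cstar_sub S) = \<phi>) \<and>
         (conditional_expectation reduced_cstar (free_cstar_sub S) (cond_exp_free S) \<and>
          (\<forall>E. conditional_expectation reduced_cstar (free_cstar_sub S) E \<longrightarrow> E = cond_exp_free S))"
proof -
  interpret wandering_subgroup "free_subgroup S" "gen_power r0"
    by (rule wandering_free_subgroup[OF assms(2)])
  note eqs = free_cstar_sub_eq[OF assms(2)] reduced_cstar_eq
  \<comment> \<open>The definite description is resolved by exhibiting \<open>block\<close> as a
    trace preserving candidate; uniqueness among all conditional expectations excludes any
    other.\<close>
  have "cond_exp_free S = restrict block (group_cstar UNIV)"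
    unfolding cond_exp_free_def eqs
  proof (rule the_equality)
    show "conditional_expectation (group_cstar UNIV) (group_cstar (free_subgroup S))
        (restrict block (group_cstar UNIV)) \<and>
      (\<forall>a\<in>group_cstar UNIV. canonical_trace (restrict block (group_cstar UNIV) a) = canonical_trace a)"
      by (simp add: conditional_expectation_block canonical_trace_block)
  qed (blast intro: conditional_expectation_eq_block)
  then show ?thesis
    unfolding eqs
    by (metis pure_state_unique_extension_group conditional_expectation_block
        conditional_expectation_eq_block)
qed

end
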